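(* Let $n$ be a positive integer and $Y:=(0,1)^n$. Let $A\in L^{\infty}(Y;\mathbb{R}^{n\times n}_{\mathrm{sym}})$ be uniformly elliptic, i.e., there exist constants $\lambda,\Lambda>0$ such that $\lambda I_n\leq A\leq \Lambda I_n$ a.e. in $Y$, let $b\in L^{\infty}(Y;\mathbb{R}^n)$, and let $f\in L^2(Y)$. Set $\hat{\delta}_0:=(1+\pi^2)^{-1}$ if $\|b\|_{L^\infty(Y)}\neq 0$ and $\hat{\delta}_0:=0$ otherwise. Suppose that there exists $\delta\in(\hat{\delta}_0,1]$ such that $$\frac{|A|^2+|b|^2}{(\mathrm{tr}(A))^2}\leq \frac{1}{n-1+\delta}\quad\text{a.e. in }Y.$$ Let $L:=-A:D^2-b\cdot\nabla$ and $\gamma:=\frac{\mathrm{tr}(A)}{|A|^2+|b|^2}$. Then there exists a unique very weak solution $u\in L^2(Y)$ to $$-D^2:(Au)+\nabla\cdot(bu)=f\ \text{ in }Y,\qquad u=0\ \text{ on }\partial Y.$$ Further, the solution is of the form $$u=\gamma\tilde{u}=\frac{\mathrm{tr}(A)}{|A|^2+|b|^2}(-\Delta\psi),$$ where $\tilde u\in L^2(Y)$ is the unique very weak solution to the renormalized problem $-D^2:(\gamma A\tilde u)+\nabla\cdot(\gamma b\tilde u)=f$ in $Y$, $\tilde u=0$ on $\partial Y$, and $\psi\in H^2(Y)\cap H^1_0(Y)$ is the unique solution to $$(-\Delta\psi,\gamma L\varphi)_{L^2(Y)}=(f,\varphi)_{L^2(Y)}\quad\forall\varphi\in H^2(Y)\cap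 H^1_0(Y).$$
   Context: $\mathbb{R}^{n\times n}_{\mathrm{sym}}$ denotes the symmetric real $n\times n$ matrices, $I_n$ the identity matrix, and matrix inequalities are in the sense of quadratic forms. For matrices $M,N$, $M:N:=\sum_{i,j}M_{ij}N_{ij}$ and $|M|:=\sqrt{M:M}$; $|b|$ is the Euclidean norm. $D^2v$ is the Hessian of $v$, and $L\varphi=-A:D^2\varphi-b\cdot\nabla\varphi$. All functions are real-valued. Very weak solutions: $u\in L^2(Y)$ is a very weak solution to $-D^2:(Au)+\nabla\cdot(bu)=f$ in $Y$, $u=0$ on $\partial Y$, if $(u,L\varphi)_{L^2(Y)}=(f,\varphi)_{L^2(Y)}$ for all $\varphi\in H^2(Y)\cap H^1_0(Y)$. Likewise, $\tilde u\in L^2(Y)$ is a very weak solution to the renormalized problem if $(\tilde u,\gamma L\varphi)_{L^2(Y)}=(f,\varphi)_{L^2(Y)}$ for all $\varphi\in H^2(Y)\cap H^1_0(Y)$. *)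

theory Defs
  imports "HOL-Analysis.Analysis" "HOL-Probability.Essential_Supremum"
begin

text \<open>
  Elements of Lebesgue and Sobolev spaces are represented by Lebesgue measurable functions, and
  equality in such a space is equality almost everywhere with respect to \<^term>\<open>lebesgue_on \<Omega>\<close>.
  On \<^typ>\<open>real^'n^'n\<close> the library's inner product and norm are the Frobenius ones, i.e.
  \<open>M : N = M \<bullet> N\<close> and \<open>\<bar>M\<bar> = norm M\<close>.
\<close>

definition unit_cube :: "(real^'n) set" where
  "unit_cube = {x. \<forall>i. 0 < x $ i \<and> x $ i < 1}"

definition L2_space :: "(real^'n) set \<Rightarrow> ((real^'n) \<Rightarrow> real) set" where
  "L2_space \<Omega> = {u. u \<in> borel_measurable (lebesgue_on \<Omega>)
                   \<and> integrable (lebesgue_on \<Omega>) (\<lambda>x. (u x)\<^sup>2)}"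

definition L2_inner :: "(real^'n) set \<Rightarrow> ((real^'n) \<Rightarrow> real) \<Rightarrow> ((real^'n) \<Rightarrow> real) \<Rightarrow> real" where
  "L2_inner \<Omega> u v = (LINT x|lebesgue_on \<Omega>. u x * v x)"

definition Linf_norm :: "(real^'n) set \<Rightarrow> ((real^'n) \<Rightarrow> 'b::euclidean_space) \<Rightarrow> ereal" where
  "Linf_norm \<Omega> g = esssup (lebesgue_on \<Omega>) (\<lambda>x. ereal (norm (g x)))"

definition Linf_space :: "(real^'n) set \<Rightarrow> ((real^'n) \<Rightarrow> 'b::euclidean_space) set" where
  "Linf_space \<Omega> = {g. g \<in> borel_measurable (lebesgue_on \<Omega>) \<and> Linf_norm \<Omega> g < \<infinity>}"

definition partial_deriv :: "'n \<Rightarrow> ((real^'n) \<Rightarrow> real) \<Rightarrow> (real^'n) \<Rightarrow> real" where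
  "partial_deriv i f x = frechet_derivative f (at x) (axis i 1)"

primrec iter_partial_deriv :: "'n list \<Rightarrow> ((real^'n) \<Rightarrow> real) \<Rightarrow> (real^'n) \<Rightarrow> real" where
  "iter_partial_deriv [] f = f"
| "iter_partial_deriv (i # is) f = partial_deriv i (iter_partial_deriv is f)"

text \<open>Differentiability of all iterated partial derivatives also makes all of them continuous, so
  this is \<open>C\<^sup>\<infinity>\<close>.\<close>

definition smooth :: "((real^'n) \<Rightarrow> real) \<Rightarrow> bool" where
  "smooth f \<longleftrightarrow> (\<forall>is. iter_partial_deriv is f differentiable_on UNIV)"

definition test_functions :: "(real^'n) set \<Rightarrow> ((real^'n) \<Rightarrow> real) set" where
  "test_functions \<Omega> =
     {\<phi>. smooth \<phi> \<and> compact (closure {x. \<phi> x \<noteq> 0}) \<and> closure {x. \<phi> x \<noteq> 0} \<subseteq> \<Omega>}"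

definition has_weak_partial ::
  "(real^'n) set \<Rightarrow> 'n \<Rightarrow> ((real^'n) \<Rightarrow> real) \<Rightarrow> ((real^'n) \<Rightarrow> real) \<Rightarrow> bool" where
  "has_weak_partial \<Omega> i u g \<longleftrightarrow> u \<in> L2_space \<Omega> \<and> g \<in> L2_space \<Omega> \<and>
     (\<forall>\<phi>\<in>test_functions \<Omega>. L2_inner \<Omega> u (partial_deriv i \<phi>) = - L2_inner \<Omega> g \<phi>)"

text \<open>A weak derivative is determined only up to a null set; the following operators pick
  one representative. They are meaningful only for functions that have the weak derivatives
  in question. Only square integrable weak derivatives are considered, as these are the ones
  entering \<open>H\<^sup>1\<close> and \<open>H\<^sup>2\<close>.\<close>

definition weak_partial :: "(real^'n) set \<Rightarrow> 'n \<Rightarrow> ((real^'n) \<Rightarrow> real) \<Rightarrow> (real^'n) \<Rightarrow> real" where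
  "weak_partial \<Omega> i u = (SOME g. has_weak_partial \<Omega> i u g)"

definition weak_grad :: "(real^'n) set \<Rightarrow> ((real^'n) \<Rightarrow> real) \<Rightarrow> (real^'n) \<Rightarrow> real^'n" where
  "weak_grad \<Omega> u x = (\<chi> i. weak_partial \<Omega> i u x)"

definition weak_hessian :: "(real^'n) set \<Rightarrow> ((real^'n) \<Rightarrow> real) \<Rightarrow> (real^'n) \<Rightarrow> real^'n^'n" where
  "weak_hessian \<Omega> u x = (\<chi> i j. weak_partial \<Omega> i (weak_partial \<Omega> j u) x)"

definition weak_laplacian :: "(real^'n) set \<Rightarrow> ((real^'n) \<Rightarrow> real) \<Rightarrow> (real^'n) \<Rightarrow> real" where
  "weak_laplacian \<Omega> u x = trace (weak_hessian \<Omega> u x)"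

definition H1_space :: "(real^'n) set \<Rightarrow> ((real^'n) \<Rightarrow> real) set" where
  "H1_space \<Omega> = {u \<in> L2_space \<Omega>. \<forall>i. \<exists>g. has_weak_partial \<Omega> i u g}"

definition H1_norm :: "(real^'n) set \<Rightarrow> ((real^'n) \<Rightarrow> real) \<Rightarrow> real" where
  "H1_norm \<Omega> u = sqrt (L2_inner \<Omega> u u
     + (\<Sum>i\<in>UNIV. L2_inner \<Omega> (weak_partial \<Omega> i u) (weak_partial \<Omega> i u)))"

definition H2_space :: "(real^'n) set \<Rightarrow> ((real^'n) \<Rightarrow> real) set" where
  "H2_space \<Omega> = {u \<in> H1_space \<Omega>. \<forall>i. weak_partial \<Omega> i u \<in> H1_space \<Omega>}"

definition H10_space :: "(real^'n) set \<Rightarrow> ((real^'n) \<Rightarrow> real) set" where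
  "H10_space \<Omega> = {u \<in> H1_space \<Omega>.
     \<forall>\<epsilon>>0. \<exists>\<phi>\<in>test_functions \<Omega>. H1_norm \<Omega> (\<lambda>x. u x - \<phi> x) < \<epsilon>}"

definition qf_le :: "real^'n^'n \<Rightarrow> real^'n^'n \<Rightarrow> bool" where
  "qf_le M N \<longleftrightarrow> (\<forall>\<xi>. \<xi> \<bullet> (M *v \<xi>) \<le> \<xi> \<bullet> (N *v \<xi>))"

definition uniformly_elliptic :: "(real^'n) set \<Rightarrow> ((real^'n) \<Rightarrow> real^'n^'n) \<Rightarrow> bool" where
  "uniformly_elliptic \<Omega> A \<longleftrightarrow> (\<exists>l u. 0 < l \<and> 0 < u \<and>
     (AE x in lebesgue_on \<Omega>. qf_le (l *\<^sub>R mat 1) (A x) \<and> qf_le (A x) (u *\<^sub>R mat 1)))"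

definition L_op :: "(real^'n) set \<Rightarrow> ((real^'n) \<Rightarrow> real^'n^'n) \<Rightarrow> ((real^'n) \<Rightarrow> real^'n)
    \<Rightarrow> ((real^'n) \<Rightarrow> real) \<Rightarrow> (real^'n) \<Rightarrow> real" where
  "L_op \<Omega> A b \<phi> x = - (A x \<bullet> weak_hessian \<Omega> \<phi> x) - b x \<bullet> weak_grad \<Omega> \<phi> x"

definition renorm :: "((real^'n) \<Rightarrow> real^'n^'n) \<Rightarrow> ((real^'n) \<Rightarrow> real^'n) \<Rightarrow> (real^'n) \<Rightarrow> real" where
  "renorm A b x = trace (A x) / ((norm (A x))\<^sup>2 + (norm (b x))\<^sup>2)"

definition delta0 :: "(real^'n) set \<Rightarrow> ((real^'n) \<Rightarrow> real^'n) \<Rightarrow> real" where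
  "delta0 \<Omega> b = (if Linf_norm \<Omega> b \<noteq> 0 then inverse (1 + pi\<^sup>2) else 0)"

definition very_weak_solution :: "(real^'n) set \<Rightarrow> ((real^'n) \<Rightarrow> real^'n^'n) \<Rightarrow> ((real^'n) \<Rightarrow> real^'n)
    \<Rightarrow> ((real^'n) \<Rightarrow> real) \<Rightarrow> ((real^'n) \<Rightarrow> real) \<Rightarrow> bool" where
  "very_weak_solution \<Omega> A b f u \<longleftrightarrow> u \<in> L2_space \<Omega> \<and>
     (\<forall>\<phi> \<in> H2_space \<Omega> \<inter> H10_space \<Omega>. L2_inner \<Omega> u (L_op \<Omega> A b \<phi>) = L2_inner \<Omega> f \<phi>)"

definition very_weak_solution_renorm ::
  "(real^'n) set \<Rightarrow> ((real^'n) \<Rightarrow> real^'n^'n) \<Rightarrow> ((real^'n) \<Rightarrow> real^'n)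
    \<Rightarrow> ((real^'n) \<Rightarrow> real) \<Rightarrow> ((real^'n) \<Rightarrow> real) \<Rightarrow> bool" where
  "very_weak_solution_renorm \<Omega> A b f u \<longleftrightarrow> u \<in> L2_space \<Omega> \<and>
     (\<forall>\<phi> \<in> H2_space \<Omega> \<inter> H10_space \<Omega>.
        L2_inner \<Omega> u (\<lambda>x. renorm A b x * L_op \<Omega> A b \<phi> x) = L2_inner \<Omega> f \<phi>)"

definition potential_solution :: "(real^'n) set \<Rightarrow> ((real^'n) \<Rightarrow> real^'n^'n) \<Rightarrow> ((real^'n) \<Rightarrow> real^'n)
    \<Rightarrow> ((real^'n) \<Rightarrow> real) \<Rightarrow> ((real^'n) \<Rightarrow> real) \<Rightarrow> bool" where
  "potential_solution \<Omega> A b f \<psi> \<longleftrightarrow> \<psi> \<in> H2_space \<Omega> \<inter> H10_space \<Omega> \<and>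
     (\<forall>\<phi> \<in> H2_space \<Omega> \<inter> H10_space \<Omega>.
        L2_inner \<Omega> (\<lambda>x. - weak_laplacian \<Omega> \<psi> x) (\<lambda>x. renorm A b x * L_op \<Omega> A b \<phi> x)
          = L2_inner \<Omega> f \<phi>)"

definition ex1_ae :: "(real^'n) set \<Rightarrow> (((real^'n) \<Rightarrow> real) \<Rightarrow> bool) \<Rightarrow> bool" where
  "ex1_ae \<Omega> P \<longleftrightarrow> (\<exists>u. P u \<and> (\<forall>v. P v \<longrightarrow> (AE x in lebesgue_on \<Omega>. v x = u x)))"

end

theory Submission
  imports Defs
begin

text \<open>
  On the unit cube the functions \<open>\<Prod>\<^sub>i \<surd>2 sin (\<pi> k\<^sub>i x\<^sub>i)\<close> form an orthonormal basis of \<open>L\<^sup>2\<close> that lies in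
  \<open>H\<^sup>2 \<inter> H\<^sup>1\<^sub>0\<close> and diagonalises the Laplacian, and the partial derivatives of the basis functions are
  again orthogonal. Hence \<open>\<Delta>\<close> maps \<open>H\<^sup>2 \<inter> H\<^sup>1\<^sub>0\<close> bijectively onto \<open>L\<^sup>2\<close>, with \<open>\<parallel>D\<^sup>2\<phi>\<parallel> \<le> \<parallel>\<Delta>\<phi>\<parallel>\<close> and
  \<open>\<pi> \<parallel>\<nabla>\<phi>\<parallel> \<le> \<parallel>\<Delta>\<phi>\<parallel>\<close>.
  The Cordes condition says that \<open>\<bar>\<gamma>A - I\<bar>\<^sup>2 + \<bar>\<gamma>b\<bar>\<^sup>2 \<le> 1 - \<delta>\<close>, so that
  \<open>\<parallel>\<gamma>L\<phi> + \<Delta>\<phi>\<parallel> \<le> q \<parallel>\<Delta>\<phi>\<parallel>\<close> with \<open>q\<^sup>2 = (1 - \<delta>) (1 + \<pi>\<^sup>-\<^sup>2) < 1\<close> (without the factor \<open>1 + \<pi>\<^sup>-\<^sup>2\<close> if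
  \<open>b = 0\<close>). Therefore \<open>\<gamma>L \<circ> (-\<Delta>)\<^sup>-\<^sup>1\<close> is a perturbation of the identity of norm less than one, its adjoint is
  invertible, and the renormalised problem is uniquely solvable; multiplication by \<open>\<gamma>\<close>, which is bounded
  away from \<open>0\<close> and \<open>\<infinity>\<close>, carries its solutions to those of the original problem.
\<close>

section \<open>The space \<open>L\<^sup>2\<close>\<close>

text \<open>The constants come from Parseval. A partial derivative swaps sine and cosine in one
  coordinate and multiplies by \<pi> k_i up to sign, so with lam = sum of (\<pi> k_i)^2 the Hessian
  and the Laplacian of a sine series both carry the total weight lam^2, whence the constant 1, while
  the gradient carries lam and lam >= \<pi>^2. The threshold 1/(1 + \<pi>^2) is the value of
  \<delta> at which (1 - \<delta>)(1 + \<pi>^-2) equals 1. Two points about the sines are delicate.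
  They must lie in \<open>H\<^sup>1\<^sub>0\<close>: a cut-off has slope of order m at distance
  about 1/m from the boundary, and only the linear vanishing of the sine compensates. They must be
  complete, which is obtained from an algebra of cosines acting on the sine system. Elements are
  functions rather than classes, and weak derivatives are arbitrary choices, so all operators are
  linear only up to null sets. The adjoint equation is therefore solved by summing a series of
  scalar functionals and representing the sum.\<close>

lemma L2_spaceD:
  assumes "u \<in> L2_space \<Omega>"
  shows "u \<in> borel_measurable (lebesgue_on \<Omega>)" "integrable (lebesgue_on \<Omega>) (\<lambda>x. (u x)\<^sup>2)"
  using assms by (auto simp: L2_space_def)

lemma L2_mult_integrable:
  assumes "u \<in> L2_space \<Omega>" "v \<in> L2_space \<Omega>"
  shows "integrable (lebesgue_on \<Omega>) (\<lambda>x. u x * v x)"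
proof (rule Bochner_Integration.integrable_bound)
  note [measurable] = L2_spaceD(1)[OF assms(1)] L2_spaceD(1)[OF assms(2)]
  show "integrable (lebesgue_on \<Omega>) (\<lambda>x. (u x)\<^sup>2 + (v x)\<^sup>2)"
    using L2_spaceD(2)[OF assms(1)] L2_spaceD(2)[OF assms(2)] by simp
  show "(\<lambda>x. u x * v x) \<in> borel_measurable (lebesgue_on \<Omega>)" by measurable
  show "AE x in lebesgue_on \<Omega>. norm (u x * v x) \<le> norm ((u x)\<^sup>2 + (v x)\<^sup>2)"
  proof (rule AE_I2)
    fix x
    have "2 * (\<bar>u x\<bar> * \<bar>v x\<bar>) \<le> (u x)\<^sup>2 + (v x)\<^sup>2"
      using sum_squares_bound[of "\<bar>u x\<bar>" "\<bar>v x\<bar>"] by (simp add: mult.assoc)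
    moreover have "0 \<le> \<bar>u x\<bar> * \<bar>v x\<bar>" by simp
    ultimately show "norm (u x * v x) \<le> norm ((u x)\<^sup>2 + (v x)\<^sup>2)"
      unfolding real_norm_def abs_mult by linarith
  qed
qed

lemma L2_zero [simp]: "(\<lambda>x. 0) \<in> L2_space \<Omega>"
  by (simp add: L2_space_def)

lemma L2_scale [intro]: "u \<in> L2_space \<Omega> \<Longrightarrow> (\<lambda>x. c * u x) \<in> L2_space \<Omega>"
  by (auto simp: L2_space_def power_mult_distrib)

lemma L2_add [intro]:
  assumes "u \<in> L2_space \<Omega>" "v \<in> L2_space \<Omega>"
  shows "(\<lambda>x. u x + v x) \<in> L2_space \<Omega>"
  using assms L2_mult_integrable[OF assms]
  by (auto simp: L2_space_def power2_sum mult.assoc)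

lemma L2_minus [intro]: "u \<in> L2_space \<Omega> \<Longrightarrow> (\<lambda>x. - u x) \<in> L2_space \<Omega>"
  by (auto simp: L2_space_def)

lemma L2_diff [intro]: "u \<in> L2_space \<Omega> \<Longrightarrow> v \<in> L2_space \<Omega> \<Longrightarrow> (\<lambda>x. u x - v x) \<in> L2_space \<Omega>"
  using L2_add[of u \<Omega> "\<lambda>x. - v x"] L2_minus[of v \<Omega>] by simp

lemma L2_sum [intro]: "(\<And>i. i \<in> I \<Longrightarrow> u i \<in> L2_space \<Omega>) \<Longrightarrow> (\<lambda>x. \<Sum>i\<in>I. u i x) \<in> L2_space \<Omega>"
  by (induction I rule: infinite_finite_induct) auto

lemma L2_bounded_mult:
  assumes "u \<in> L2_space \<Omega>" "c \<in> borel_measurable (lebesgue_on \<Omega>)"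
    and "AE x in lebesgue_on \<Omega>. \<bar>c x\<bar> \<le> B"
  shows "(\<lambda>x. c x * u x) \<in> L2_space \<Omega>"
proof -
  note [measurable] = L2_spaceD(1)[OF assms(1)] assms(2)
  have "integrable (lebesgue_on \<Omega>) (\<lambda>x. (c x * u x)\<^sup>2)"
  proof (rule Bochner_Integration.integrable_bound)
    show "integrable (lebesgue_on \<Omega>) (\<lambda>x. B\<^sup>2 * (u x)\<^sup>2)"
      using L2_spaceD(2)[OF assms(1)] by simp
    show "AE x in lebesgue_on \<Omega>. norm ((c x * u x)\<^sup>2) \<le> norm (B\<^sup>2 * (u x)\<^sup>2)"
      using assms(3)
    proof eventually_elim
      case (elim x)
      have "(c x)\<^sup>2 \<le> B\<^sup>2" using power_mono[OF elim, of 2] by simp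
      then show ?case by (simp add: power_mult_distrib mult_right_mono)
    qed
  qed measurable
  then show ?thesis by (simp add: L2_space_def)
qed

lemma L2_inner_commute: "L2_inner \<Omega> u v = L2_inner \<Omega> v u"
  by (simp add: L2_inner_def mult.commute)

lemma L2_inner_add_left:
  "u \<in> L2_space \<Omega> \<Longrightarrow> v \<in> L2_space \<Omega> \<Longrightarrow> w \<in> L2_space \<Omega> \<Longrightarrow>
    L2_inner \<Omega> (\<lambda>x. u x + v x) w = L2_inner \<Omega> u w + L2_inner \<Omega> v w"
  by (simp add: L2_inner_def distrib_right L2_mult_integrable)

lemma L2_inner_scale_left: "L2_inner \<Omega> (\<lambda>x. c * u x) w = c * L2_inner \<Omega> u w"
  by (simp add: L2_inner_def mult.assoc)

lemma L2_inner_minus_left: "L2_inner \<Omega> (\<lambda>x. - u x) w = - L2_inner \<Omega> u w"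
  by (simp add: L2_inner_def)

lemma L2_inner_diff_left:
  "u \<in> L2_space \<Omega> \<Longrightarrow> v \<in> L2_space \<Omega> \<Longrightarrow> w \<in> L2_space \<Omega> \<Longrightarrow>
    L2_inner \<Omega> (\<lambda>x. u x - v x) w = L2_inner \<Omega> u w - L2_inner \<Omega> v w"
  by (simp add: L2_inner_def left_diff_distrib L2_mult_integrable)

lemma L2_inner_sum_left:
  "(\<And>i. i \<in> I \<Longrightarrow> u i \<in> L2_space \<Omega>) \<Longrightarrow> w \<in> L2_space \<Omega> \<Longrightarrow>
    L2_inner \<Omega> (\<lambda>x. \<Sum>i\<in>I. u i x) w = (\<Sum>i\<in>I. L2_inner \<Omega> (u i) w)"
  by (simp add: L2_inner_def sum_distrib_right L2_mult_integrable)

lemma L2_inner_add_right: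
  assumes "u \<in> L2_space \<Omega>" "v \<in> L2_space \<Omega>" "w \<in> L2_space \<Omega>"
  shows "L2_inner \<Omega> w (\<lambda>x. u x + v x) = L2_inner \<Omega> w u + L2_inner \<Omega> w v"
  using L2_inner_add_left[OF assms] by (metis L2_inner_commute)

lemma L2_inner_scale_right: "L2_inner \<Omega> w (\<lambda>x. c * u x) = c * L2_inner \<Omega> w u"
  by (metis L2_inner_commute L2_inner_scale_left)

lemma L2_inner_minus_right: "L2_inner \<Omega> w (\<lambda>x. - u x) = - L2_inner \<Omega> w u"
  by (metis L2_inner_commute L2_inner_minus_left)

lemma L2_inner_diff_right:
  assumes "u \<in> L2_space \<Omega>" "v \<in> L2_space \<Omega>" "w \<in> L2_space \<Omega>"
  shows "L2_inner \<Omega> w (\<lambda>x. u x - v x) = L2_inner \<Omega> w u - L2_inner \<Omega> w v"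
  using L2_inner_diff_left[OF assms] by (metis L2_inner_commute)

lemma L2_inner_sum_right:
  assumes "\<And>i. i \<in> I \<Longrightarrow> u i \<in> L2_space \<Omega>" "w \<in> L2_space \<Omega>"
  shows "L2_inner \<Omega> w (\<lambda>x. \<Sum>i\<in>I. u i x) = (\<Sum>i\<in>I. L2_inner \<Omega> w (u i))"
  unfolding L2_inner_commute[of \<Omega> w] using assms by (rule L2_inner_sum_left)

lemma L2_inner_cong_AE:
  assumes "AE x in lebesgue_on \<Omega>. u x = u' x" "AE x in lebesgue_on \<Omega>. v x = v' x"
    "u \<in> borel_measurable (lebesgue_on \<Omega>)" "u' \<in> borel_measurable (lebesgue_on \<Omega>)"
    "v \<in> borel_measurable (lebesgue_on \<Omega>)" "v' \<in> borel_measurable (lebesgue_on \<Omega>)"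
  shows "L2_inner \<Omega> u v = L2_inner \<Omega> u' v'"
  unfolding L2_inner_def
proof (rule integral_cong_AE)
  show "AE x in lebesgue_on \<Omega>. u x * v x = u' x * v' x"
    using assms(1,2) by eventually_elim simp
qed (use assms in measurable)

lemma L2_inner_cong_AE_left:
  "AE x in lebesgue_on \<Omega>. u x = u' x \<Longrightarrow> u \<in> L2_space \<Omega> \<Longrightarrow> u' \<in> L2_space \<Omega> \<Longrightarrow> w \<in> L2_space \<Omega> \<Longrightarrow>
    L2_inner \<Omega> u w = L2_inner \<Omega> u' w"
  by (rule L2_inner_cong_AE) (auto dest: L2_spaceD)

lemma L2_inner_cong_AE_right:
  "AE x in lebesgue_on \<Omega>. u x = u' x \<Longrightarrow> u \<in> L2_space \<Omega> \<Longrightarrow> u' \<in> L2_space \<Omega> \<Longrightarrow> w \<in> L2_space \<Omega> \<Longrightarrow>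
    L2_inner \<Omega> w u = L2_inner \<Omega> w u'"
  by (rule L2_inner_cong_AE) (auto dest: L2_spaceD)

lemma L2_inner_self_nonneg [simp]: "0 \<le> L2_inner \<Omega> u u"
  by (simp add: L2_inner_def)

lemma L2_inner_self_eq_0:
  assumes "u \<in> L2_space \<Omega>" "L2_inner \<Omega> u u = 0"
  shows "AE x in lebesgue_on \<Omega>. u x = 0"
  using integral_nonneg_eq_0_iff_AE[OF L2_mult_integrable[OF assms(1) assms(1)]] assms(2)
  by (simp add: L2_inner_def)

section \<open>Norm, Cauchy-Schwarz and triangle inequality\<close>

definition L2_norm :: "(real^'n) set \<Rightarrow> ((real^'n) \<Rightarrow> real) \<Rightarrow> real" where
  "L2_norm \<Omega> u = sqrt (L2_inner \<Omega> u u)"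

lemma L2_norm_nonneg [simp]: "0 \<le> L2_norm \<Omega> u"
  by (simp add: L2_norm_def)

lemma L2_norm_power2: "(L2_norm \<Omega> u)\<^sup>2 = L2_inner \<Omega> u u"
  by (simp add: L2_norm_def)

lemma L2_Cauchy_Schwarz:
  assumes u: "u \<in> L2_space \<Omega>" and v: "v \<in> L2_space \<Omega>"
  shows "\<bar>L2_inner \<Omega> u v\<bar> \<le> L2_norm \<Omega> u * L2_norm \<Omega> v"
proof (cases "L2_inner \<Omega> v v = 0")
  case True
  have "L2_inner \<Omega> u v = L2_inner \<Omega> u (\<lambda>x. 0)"
    by (rule L2_inner_cong_AE_right[OF L2_inner_self_eq_0[OF v True]]) (use u v in auto)
  then show ?thesis by (simp add: L2_inner_def)
next
  case False
  define V where "V = L2_inner \<Omega> v v"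
  define I where "I = L2_inner \<Omega> u v"
  have V: "V > 0" using False by (simp add: V_def less_le)
  \<comment> \<open>\<open>t\<close> minimises the norm of \<open>u - t v\<close>; that the minimum
    is nonnegative is the claim.\<close>
  define t where "t = I / V"
  have tv: "(\<lambda>x. t * v x) \<in> L2_space \<Omega>" using v by auto
  have d: "(\<lambda>x. u x - t * v x) \<in> L2_space \<Omega>" using u tv by auto
  have "0 \<le> L2_inner \<Omega> (\<lambda>x. u x - t * v x) (\<lambda>x. u x - t * v x)" by simp
  also have "\<dots> = L2_inner \<Omega> u u - 2 * t * I + t * t * V"
    by (simp add: L2_inner_diff_left[OF u tv d] L2_inner_diff_right[OF u tv u] L2_inner_diff_right[OF u tv v]
        L2_inner_scale_left L2_inner_scale_right I_def V_def L2_inner_commute[of \<Omega> v u] algebra_simps)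
  also have "\<dots> = L2_inner \<Omega> u u - I\<^sup>2 / V"
    using V by (simp add: t_def field_simps power2_eq_square)
  finally have "I\<^sup>2 \<le> L2_inner \<Omega> u u * V" using V by (simp add: field_simps)
  then have "sqrt (I\<^sup>2) \<le> sqrt (L2_inner \<Omega> u u * V)" by (rule real_sqrt_le_mono)
  then show ?thesis by (simp add: L2_norm_def I_def V_def real_sqrt_mult)
qed

lemma L2_norm_triangle:
  assumes u: "u \<in> L2_space \<Omega>" and v: "v \<in> L2_space \<Omega>"
  shows "L2_norm \<Omega> (\<lambda>x. u x + v x) \<le> L2_norm \<Omega> u + L2_norm \<Omega> v"
proof (rule power2_le_imp_le)
  have "(L2_norm \<Omega> (\<lambda>x. u x + v x))\<^sup>2 = L2_inner \<Omega> u u + 2 * L2_inner \<Omega> u v + L2_inner \<Omega> v v"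
    using assms by (simp add: L2_norm_power2 L2_inner_add_left L2_inner_add_right L2_add L2_inner_commute[of \<Omega> v u])
  also have "\<dots> \<le> (L2_norm \<Omega> u + L2_norm \<Omega> v)\<^sup>2"
    using L2_Cauchy_Schwarz[OF assms] by (simp add: power2_sum L2_norm_power2)
  finally show "(L2_norm \<Omega> (\<lambda>x. u x + v x))\<^sup>2 \<le> (L2_norm \<Omega> u + L2_norm \<Omega> v)\<^sup>2" .
qed simp

lemma L2_norm_scale: "L2_norm \<Omega> (\<lambda>x. c * u x) = \<bar>c\<bar> * L2_norm \<Omega> u"
  by (simp add: L2_norm_def L2_inner_scale_left L2_inner_scale_right real_sqrt_mult mult.assoc[symmetric])

lemma L2_norm_minus: "L2_norm \<Omega> (\<lambda>x. - u x) = L2_norm \<Omega> u"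
  by (simp add: L2_norm_def L2_inner_minus_left L2_inner_minus_right)

lemma L2_norm_cong_AE:
  "AE x in lebesgue_on \<Omega>. u x = v x \<Longrightarrow> u \<in> L2_space \<Omega> \<Longrightarrow> v \<in> L2_space \<Omega> \<Longrightarrow> L2_norm \<Omega> u = L2_norm \<Omega> v"
  unfolding L2_norm_def by (subst L2_inner_cong_AE[where u'=v and v'=v]) (auto dest: L2_spaceD)

lemma L2_norm_mono:
  assumes "u \<in> L2_space \<Omega>" "v \<in> L2_space \<Omega>" "AE x in lebesgue_on \<Omega>. \<bar>u x\<bar> \<le> \<bar>v x\<bar>"
  shows "L2_norm \<Omega> u \<le> L2_norm \<Omega> v"
  unfolding L2_norm_def L2_inner_def
proof (rule real_sqrt_le_mono, rule integral_mono_AE)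
  show "AE x in lebesgue_on \<Omega>. u x * u x \<le> v x * v x"
    using assms(3) by eventually_elim (metis abs_le_square_iff power2_eq_square)
qed (use assms L2_mult_integrable in auto)

text \<open>Membership is part of the notion because the integral of a non-integrable function is 0,
  so a small \<open>L2_norm\<close> alone carries no information.\<close>

definition L2_lim :: "(real^'n) set \<Rightarrow> (nat \<Rightarrow> (real^'n) \<Rightarrow> real) \<Rightarrow> ((real^'n) \<Rightarrow> real) \<Rightarrow> bool" where
  "L2_lim \<Omega> s u \<longleftrightarrow> (\<forall>m. s m \<in> L2_space \<Omega>) \<and> u \<in> L2_space \<Omega> \<and>
     (\<lambda>m. L2_norm \<Omega> (\<lambda>x. s m x - u x)) \<longlonglongrightarrow> 0"

lemma L2_limD:
  assumes "L2_lim \<Omega> s u"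
  shows "s m \<in> L2_space \<Omega>" "u \<in> L2_space \<Omega>" "(\<lambda>m. L2_norm \<Omega> (\<lambda>x. s m x - u x)) \<longlonglongrightarrow> 0"
  using assms by (auto simp: L2_lim_def)

lemma L2_lim_add:
  assumes "L2_lim \<Omega> s u" "L2_lim \<Omega> t v"
  shows "L2_lim \<Omega> (\<lambda>m x. s m x + t m x) (\<lambda>x. u x + v x)"
proof -
  note s = L2_limD[OF assms(1)] and t = L2_limD[OF assms(2)]
  have "(\<lambda>m. L2_norm \<Omega> (\<lambda>x. (s m x + t m x) - (u x + v x))) \<longlonglongrightarrow> 0"
  proof (rule tendsto_sandwich[of "\<lambda>m. 0"])
    show "(\<lambda>m. L2_norm \<Omega> (\<lambda>x. s m x - u x) + L2_norm \<Omega> (\<lambda>x. t m x - v x)) \<longlonglongrightarrow> 0"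
      using tendsto_add[OF s(3) t(3)] by simp
    have "L2_norm \<Omega> (\<lambda>x. (s m x + t m x) - (u x + v x))
        \<le> L2_norm \<Omega> (\<lambda>x. s m x - u x) + L2_norm \<Omega> (\<lambda>x. t m x - v x)" for m
      using L2_norm_triangle[OF L2_diff[OF s(1,2)] L2_diff[OF t(1,2)], of m m]
      by (simp add: algebra_simps)
    then show "\<forall>\<^sub>F m in sequentially. L2_norm \<Omega> (\<lambda>x. (s m x + t m x) - (u x + v x))
        \<le> L2_norm \<Omega> (\<lambda>x. s m x - u x) + L2_norm \<Omega> (\<lambda>x. t m x - v x)" by simp
  qed auto
  then show ?thesis using s t by (auto simp: L2_lim_def)
qed

lemma L2_lim_scale:
  assumes "L2_lim \<Omega> s u"
  shows "L2_lim \<Omega> (\<lambda>m x. c * s m x) (\<lambda>x. c * u x)"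
proof -
  note s = L2_limD[OF assms(1)]
  have "(\<lambda>m. \<bar>c\<bar> * L2_norm \<Omega> (\<lambda>x. s m x - u x)) \<longlonglongrightarrow> \<bar>c\<bar> * 0"
    by (intro tendsto_intros s)
  then show ?thesis using s by (auto simp: L2_lim_def right_diff_distrib[symmetric] L2_norm_scale)
qed

lemma L2_lim_inner:
  assumes "L2_lim \<Omega> s u" "w \<in> L2_space \<Omega>"
  shows "(\<lambda>m. L2_inner \<Omega> (s m) w) \<longlonglongrightarrow> L2_inner \<Omega> u w"
proof -
  note s = L2_limD[OF assms(1)]
  have "(\<lambda>m. L2_inner \<Omega> (\<lambda>x. s m x - u x) w) \<longlonglongrightarrow> 0"
  proof (rule Lim_null_comparison)
    show "\<forall>\<^sub>F m in sequentially. norm (L2_inner \<Omega> (\<lambda>x. s m x - u x) w)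
        \<le> L2_norm \<Omega> (\<lambda>x. s m x - u x) * L2_norm \<Omega> w"
      using L2_Cauchy_Schwarz[OF L2_diff[OF s(1,2)] assms(2)] by simp
    show "(\<lambda>m. L2_norm \<Omega> (\<lambda>x. s m x - u x) * L2_norm \<Omega> w) \<longlonglongrightarrow> 0"
      using tendsto_mult_right[OF s(3), of "L2_norm \<Omega> w"] by simp
  qed
  then have "(\<lambda>m. L2_inner \<Omega> (s m) w - L2_inner \<Omega> u w) \<longlonglongrightarrow> 0"
    using s assms(2) by (simp add: L2_inner_diff_left)
  then show ?thesis by (simp add: LIM_zero_iff)
qed

lemma L2_lim_norm:
  assumes "L2_lim \<Omega> s u"
  shows "(\<lambda>m. L2_norm \<Omega> (s m)) \<longlonglongrightarrow> L2_norm \<Omega> u"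
proof -
  note s = L2_limD[OF assms(1)]
  have "norm (L2_norm \<Omega> (s m) - L2_norm \<Omega> u) \<le> L2_norm \<Omega> (\<lambda>x. s m x - u x)" for m
    using L2_norm_triangle[OF L2_diff[OF s(1,2)] s(2), of m]
      L2_norm_triangle[OF L2_diff[OF s(2,1)] s(1), of m m]
      L2_norm_minus[of \<Omega> "\<lambda>x. s m x - u x"]
    by simp
  then have "(\<lambda>m. L2_norm \<Omega> (s m) - L2_norm \<Omega> u) \<longlonglongrightarrow> 0"
    by (intro Lim_null_comparison[OF _ s(3)]) simp
  then show ?thesis by (simp add: LIM_zero_iff)
qed

text \<open>Passes to the nonnegative integral, to which Fatou's lemma applies.\<close>

lemma L2_nn_integral:
  assumes "u \<in> L2_space \<Omega>"
  shows "(\<integral>\<^sup>+x. ennreal ((u x)\<^sup>2) \<partial>lebesgue_on \<Omega>) = ennreal ((L2_norm \<Omega> u)\<^sup>2)"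
proof -
  have "(L2_norm \<Omega> u)\<^sup>2 = (LINT x|lebesgue_on \<Omega>. (u x)\<^sup>2)"
    unfolding L2_norm_power2 by (simp add: L2_inner_def power2_eq_square)
  then show ?thesis using nn_integral_eq_integral[OF L2_spaceD(2)[OF assms]] by simp
qed

text \<open>Riesz-Fischer. Increments along a fast subsequence are summable in
  \<open>L\<^sup>1\<close>, since on a finite measure space the \<open>L\<^sup>1\<close> norm is
  controlled by the \<open>L\<^sup>2\<close> norm; hence the subsequence converges almost
  everywhere. Fatou's lemma then yields both membership of the limit and convergence of the whole
  sequence.\<close>

lemma L2_complete:
  assumes fin: "finite_measure (lebesgue_on \<Omega>)"
    and s: "\<And>m. s m \<in> L2_space \<Omega>"
    and cau: "\<And>e. e > 0 \<Longrightarrow> \<exists>N. \<forall>m\<ge>N. \<forall>k\<ge>N. L2_norm \<Omega> (\<lambda>x. s m x - s k x) < e"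
  shows "\<exists>u. L2_lim \<Omega> s u"
proof -
  interpret finite_measure "lebesgue_on \<Omega>" by fact
  let ?M = "lebesgue_on \<Omega>"
  have [measurable]: "s m \<in> borel_measurable ?M" for m using L2_spaceD[OF s] by blast
  have one: "(\<lambda>x. 1) \<in> L2_space \<Omega>" by (simp add: L2_space_def)
  obtain N where N: "\<And>j m k. m \<ge> N j \<Longrightarrow> k \<ge> N j \<Longrightarrow> L2_norm \<Omega> (\<lambda>x. s m x - s k x) < (1/2)^j"
    using cau[of "(1/2)^j" for j] by (metis zero_less_power half_gt_zero zero_less_one)
  \<comment> \<open>The sum makes \<open>r\<close> monotone and at least \<open>N j\<close>; the
    summand \<open>j\<close> makes it unbounded, so late indices also pass every other Cauchy
    threshold.\<close>
  define r where "r j = (\<Sum>i\<le>j. N i) + j" for j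
  have rN: "r j \<ge> N j" for j unfolding r_def by (rule trans_le_add1, rule member_le_sum) auto
  have rmono: "r j \<le> r (Suc j)" for j by (simp add: r_def)
  have rj: "j \<le> r j" for j by (simp add: r_def)
  define d where "d j x = s (r (Suc j)) x - s (r j) x" for j x
  have d: "d j \<in> L2_space \<Omega>" for j using s by (auto simp: d_def[abs_def])
  have dabs: "(\<lambda>x. \<bar>d j x\<bar>) \<in> L2_space \<Omega>" for j
    using d[of j] by (auto simp: L2_space_def)
  have di: "integrable ?M (\<lambda>x. \<bar>d j x\<bar>)" for j
    using L2_mult_integrable[OF dabs one] by simp
  have dint: "(LINT x|?M. \<bar>d j x\<bar>) \<le> (1/2)^j * L2_norm \<Omega> (\<lambda>x. 1)" for j
  proof -
    have "(LINT x|?M. \<bar>d j x\<bar>) = L2_inner \<Omega> (\<lambda>x. \<bar>d j x\<bar>) (\<lambda>x. 1)" by (simp add: L2_inner_def)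
    also have "\<dots> \<le> L2_norm \<Omega> (\<lambda>x. \<bar>d j x\<bar>) * L2_norm \<Omega> (\<lambda>x. 1)"
      using L2_Cauchy_Schwarz[OF dabs one, of j] by simp
    also have "L2_norm \<Omega> (\<lambda>x. \<bar>d j x\<bar>) = L2_norm \<Omega> (d j)"
      by (simp add: L2_norm_def L2_inner_def)
    also have "\<dots> * L2_norm \<Omega> (\<lambda>x. 1) \<le> (1/2)^j * L2_norm \<Omega> (\<lambda>x. 1)"
      unfolding d_def using N[of j "r (Suc j)" "r j"] rN[of j] rmono[of j]
      by (intro mult_right_mono) auto
    finally show ?thesis .
  qed
  have "AE x in ?M. summable (\<lambda>j. \<bar>d j x\<bar>)"
  proof -
    have "(\<integral>\<^sup>+x. (\<Sum>j. ennreal \<bar>d j x\<bar>) \<partial>?M) = (\<Sum>j. \<integral>\<^sup>+x. ennreal \<bar>d j x\<bar> \<partial>?M)"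
      unfolding d_def by (intro nn_integral_suminf) measurable
    also have "\<dots> = (\<Sum>j. ennreal (LINT x|?M. \<bar>d j x\<bar>))"
      by (intro arg_cong[where f=suminf] ext nn_integral_eq_integral di) auto
    also have "\<dots> \<noteq> \<infinity>"
    proof -
      have "summable (\<lambda>j. (1/2::real)^j * L2_norm \<Omega> (\<lambda>x. 1))"
        by (intro summable_mult2 summable_geometric) simp
      then have "summable (\<lambda>j. LINT x|?M. \<bar>d j x\<bar>)"
        by (rule summable_comparison_test'[of _ 0]) (use dint in auto)
      then show ?thesis by (simp add: ennreal_suminf_neq_top)
    qed
    finally have "AE x in ?M. (\<Sum>j. ennreal \<bar>d j x\<bar>) \<noteq> \<infinity>"
      by (intro nn_integral_noteq_infinite) (simp_all add: d_def)
    then show ?thesis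
      by eventually_elim (auto intro: summable_suminf_not_top)
  qed
  then have conv: "AE x in ?M. convergent (\<lambda>j. s (r j) x)"
  proof eventually_elim
    case (elim x)
    then have "summable (\<lambda>j. d j x)" by (rule summable_rabs_cancel)
    then have "convergent (\<lambda>n. \<Sum>j<n. d j x)" by (simp add: summable_iff_convergent)
    moreover have "(\<Sum>j<n. d j x) = s (r n) x - s (r 0) x" for n
      unfolding d_def by (rule sum_lessThan_telescope)
    ultimately show ?case by (simp add: convergent_diff_const_right_iff)
  qed
  define u where "u x = lim (\<lambda>j. s (r j) x)" for x
  have [measurable]: "u \<in> borel_measurable ?M" unfolding u_def by measurable
  have lim: "AE x in ?M. (\<lambda>j. s (r j) x) \<longlonglongrightarrow> u x"
    using conv by eventually_elim (auto simp: u_def convergent_LIMSEQ_iff)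
  \<comment> \<open>A Cauchy bound \<open>e\<close> between terms of the sequence survives for the
    distance to the pointwise limit along \<open>r\<close>.\<close>
  have fatou: "(\<integral>\<^sup>+x. ennreal ((s m x - u x)\<^sup>2) \<partial>?M) \<le> ennreal (e\<^sup>2)"
    if "e > 0" and K: "\<forall>m\<ge>K. \<forall>k\<ge>K. L2_norm \<Omega> (\<lambda>x. s m x - s k x) < e" and "m \<ge> K" for e K m
  proof -
    have "(\<integral>\<^sup>+x. ennreal ((s m x - u x)\<^sup>2) \<partial>?M)
        = (\<integral>\<^sup>+x. liminf (\<lambda>j. ennreal ((s m x - s (r j) x)\<^sup>2)) \<partial>?M)"
    proof (rule nn_integral_cong_AE)
      show "AE x in ?M. ennreal ((s m x - u x)\<^sup>2) = liminf (\<lambda>j. ennreal ((s m x - s (r j) x)\<^sup>2))"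
        using lim
      proof eventually_elim
        case (elim x)
        then have "(\<lambda>j. ennreal ((s m x - s (r j) x)\<^sup>2)) \<longlonglongrightarrow> ennreal ((s m x - u x)\<^sup>2)"
          by (intro tendsto_ennrealI tendsto_intros)
        then show ?case by (metis lim_imp_Liminf sequentially_bot)
      qed
    qed
    also have "\<dots> \<le> liminf (\<lambda>j. \<integral>\<^sup>+x. ennreal ((s m x - s (r j) x)\<^sup>2) \<partial>?M)"
      by (rule nn_integral_liminf) measurable
    also have "\<dots> \<le> ennreal (e\<^sup>2)"
    proof (rule Liminf_le)
      show "\<forall>\<^sub>F j in sequentially. (\<integral>\<^sup>+x. ennreal ((s m x - s (r j) x)\<^sup>2) \<partial>?M) \<le> ennreal (e\<^sup>2)"
      proof (rule eventually_sequentiallyI)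
        fix j assume "K \<le> j"
        then have "r j \<ge> K" using rj[of j] by simp
        have df: "(\<lambda>x. s m x - s (r j) x) \<in> L2_space \<Omega>" using s by auto
        have "(\<integral>\<^sup>+x. ennreal ((s m x - s (r j) x)\<^sup>2) \<partial>?M) = ennreal ((L2_norm \<Omega> (\<lambda>x. s m x - s (r j) x))\<^sup>2)"
          by (rule L2_nn_integral[OF df])
        also have "\<dots> \<le> ennreal (e\<^sup>2)"
          using K \<open>m \<ge> K\<close> \<open>r j \<ge> K\<close> by (intro ennreal_leI power_mono) (auto intro: less_imp_le)
        finally show "(\<integral>\<^sup>+x. ennreal ((s m x - s (r j) x)\<^sup>2) \<partial>?M) \<le> ennreal (e\<^sup>2)" .
      qed
    qed simp
    finally show ?thesis .
  qed
  obtain K1 where K1: "\<forall>m\<ge>K1. \<forall>k\<ge>K1. L2_norm \<Omega> (\<lambda>x. s m x - s k x) < 1" using cau[of 1] by auto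
  have "integrable ?M (\<lambda>x. (s K1 x - u x)\<^sup>2)"
  proof (rule integrableI_bounded)
    show "(\<integral>\<^sup>+ x. ennreal (norm ((s K1 x - u x)\<^sup>2)) \<partial>?M) < \<infinity>"
      using fatou[OF _ K1 order_refl] by (simp add: le_less_trans)
  qed measurable
  then have "(\<lambda>x. s K1 x - u x) \<in> L2_space \<Omega>" by (simp add: L2_space_def)
  from L2_diff[OF s[of K1] this] have u: "u \<in> L2_space \<Omega>" by simp
  have "(\<lambda>m. L2_norm \<Omega> (\<lambda>x. s m x - u x)) \<longlonglongrightarrow> 0"
  proof (rule LIMSEQ_I)
    fix e :: real assume e: "0 < e"
    then obtain K where K: "\<forall>m\<ge>K. \<forall>k\<ge>K. L2_norm \<Omega> (\<lambda>x. s m x - s k x) < e/2" using cau[of "e/2"] by auto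
    have "L2_norm \<Omega> (\<lambda>x. s m x - u x) \<le> e/2" if "m \<ge> K" for m
    proof -
      have df: "(\<lambda>x. s m x - u x) \<in> L2_space \<Omega>" using s u by auto
      have "ennreal ((L2_norm \<Omega> (\<lambda>x. s m x - u x))\<^sup>2) = (\<integral>\<^sup>+x. ennreal ((s m x - u x)\<^sup>2) \<partial>?M)"
        by (rule L2_nn_integral[OF df, symmetric])
      also have "\<dots> \<le> ennreal ((e/2)\<^sup>2)" using fatou[OF _ K that] e by simp
      finally show ?thesis using e by (simp add: power2_le_iff_abs_le)
    qed
    then show "\<exists>no. \<forall>n\<ge>no. norm (L2_norm \<Omega> (\<lambda>x. s n x - u x) - 0) < e"
      using e by (intro exI[of _ K]) (force intro: le_less_trans[of _ "e/2"])
  qed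
  then show ?thesis using s u by (auto simp: L2_lim_def)
qed

section \<open>Smooth functions of product form\<close>

text \<open>\<open>deriv\<close> is total, so differentiability has to be demanded at every
  order.\<close>

definition smooth1 :: "(real \<Rightarrow> real) \<Rightarrow> bool" where
  "smooth1 h \<longleftrightarrow> (\<forall>m x. (deriv ^^ m) h field_differentiable at x)"

lemma smooth1_has_deriv: "smooth1 h \<Longrightarrow> (h has_real_derivative deriv h x) (at x)"
  unfolding smooth1_def by (metis funpow_0 field_differentiable_derivI)

lemma smooth1_deriv: "smooth1 h \<Longrightarrow> smooth1 (deriv h)"
  unfolding smooth1_def by (metis funpow_Suc_right comp_apply)

lemma smooth1_continuous: "smooth1 h \<Longrightarrow> continuous_on S h"
  using smooth1_has_deriv DERIV_isCont continuous_at_imp_continuous_on by blast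

text \<open>By induction all iterated derivatives of \<open>h\<close> stay in the invariant set
  \<open>S\<close>. Smoothness is thus proved by exhibiting a family closed under
  differentiation.\<close>

lemma smooth1_coinduct:
  assumes "h \<in> S" and step: "\<And>g. g \<in> S \<Longrightarrow> \<exists>g'\<in>S. \<forall>x. (g has_real_derivative g' x) (at x)"
  shows "smooth1 h"
proof -
  have "(deriv ^^ m) h \<in> S" for m
  proof (induction m)
    case (Suc m)
    then obtain g' where g': "g' \<in> S" "\<forall>x. ((deriv ^^ m) h has_real_derivative g' x) (at x)"
      using step by blast
    then have "deriv ((deriv ^^ m) h) = g'" by (intro ext DERIV_imp_deriv) simp
    then show ?case using g' by simp
  qed (use assms in simp)
  then show ?thesis
    unfolding smooth1_def using step field_differentiable_def by blast
qed

text \<open>The derivative of a product is a sum of products, so sums are included to make the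
  family closed under differentiation.\<close>

inductive_set smooth1_products :: "(real \<Rightarrow> real) set" where
  prod: "smooth1 f \<Longrightarrow> smooth1 g \<Longrightarrow> (\<lambda>x. f x * g x) \<in> smooth1_products"
| add: "f \<in> smooth1_products \<Longrightarrow> g \<in> smooth1_products \<Longrightarrow> (\<lambda>x. f x + g x) \<in> smooth1_products"

lemma smooth1_mult:
  assumes "smooth1 f" "smooth1 g"
  shows "smooth1 (\<lambda>x. f x * g x)"
proof (rule smooth1_coinduct[of _ smooth1_products])
  fix g assume "g \<in> smooth1_products"
  then show "\<exists>g'\<in>smooth1_products. \<forall>x. (g has_real_derivative g' x) (at x)"
  proof induction
    case (prod f g)
    show ?case
    proof (intro bexI allI)
      show "((\<lambda>x. f x * g x) has_real_derivative deriv f x * g x + f x * deriv g x) (at x)" for x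
        using smooth1_has_deriv[OF prod(1)] smooth1_has_deriv[OF prod(2)]
        by (auto intro!: derivative_eq_intros)
    qed (intro smooth1_products.intros smooth1_deriv prod)
  next
    case (add f g)
    then obtain f' g' where "f' \<in> smooth1_products" "\<forall>x. (f has_real_derivative f' x) (at x)"
      "g' \<in> smooth1_products" "\<forall>x. (g has_real_derivative g' x) (at x)" by blast
    then show ?case
      by (intro bexI[of _ "\<lambda>x. f' x + g' x"]) (auto intro!: derivative_eq_intros smooth1_products.add)
  qed
qed (use assms smooth1_products.prod in blast)

lemma smooth1_affine:
  assumes "smooth1 h"
  shows "smooth1 (\<lambda>x. h (a * x + c))"
\<comment> \<open>The factor \<open>k\<close> collects the powers of \<open>a\<close> that the chain
  rule produces.\<close>
proof (rule smooth1_coinduct[of _ "{\<lambda>x. k * g (a * x + c) | k g. smooth1 g}"])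
  show "(\<lambda>x. h (a * x + c)) \<in> {\<lambda>x. k * g (a * x + c) | k g. smooth1 g}"
    using assms by (intro CollectI exI[of _ 1] exI[of _ h]) simp
  fix f assume "f \<in> {\<lambda>x. k * g (a * x + c) | k g. smooth1 g}"
  then obtain k g where f: "f = (\<lambda>x. k * g (a * x + c))" "smooth1 g" by blast
  show "\<exists>g'\<in>{\<lambda>x. k * g (a * x + c) | k g. smooth1 g}. \<forall>x. (f has_real_derivative g' x) (at x)"
  proof (intro bexI[of _ "\<lambda>x. (k * a) * deriv g (a * x + c)"] allI)
    fix x
    have "((\<lambda>x. g (a * x + c)) has_real_derivative deriv g (a * x + c) * a) (at x)"
      by (rule DERIV_chain2[OF smooth1_has_deriv[OF f(2)]]) (auto intro!: derivative_eq_intros)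
    then show "(f has_real_derivative (k * a) * deriv g (a * x + c)) (at x)"
      unfolding f by (auto intro!: derivative_eq_intros)
  qed (use smooth1_deriv[OF f(2)] in blast)
qed

lemma smooth1_sin_cos: "smooth1 (\<lambda>x. p * sin (w * x) + q * cos (w * x))"
proof (rule smooth1_coinduct[of _ "{\<lambda>x. p * sin (w * x) + q * cos (w * x) | p q. True}"])
  fix f assume "f \<in> {\<lambda>x. p * sin (w * x) + q * cos (w * x) | p q. True}"
  then obtain p q where f: "f = (\<lambda>x. p * sin (w * x) + q * cos (w * x))" by blast
  show "\<exists>g'\<in>{\<lambda>x. p * sin (w * x) + q * cos (w * x) | p q. True}. \<forall>x. (f has_real_derivative g' x) (at x)"
  proof (intro bexI[of _ "\<lambda>x. (- q * w) * sin (w * x) + (p * w) * cos (w * x)"] allI)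
    show "(f has_real_derivative (- q * w) * sin (w * x) + (p * w) * cos (w * x)) (at x)" for x
      unfolding f by (auto intro!: derivative_eq_intros)
  qed blast
qed blast

text \<open>The classical flat function. Besides being smooth at 0 it tends to 1 at infinity, so
  \<open>bump (m * t - 1)\<close> is a smooth cut-off that approaches 1 for each t > 0 as m
  grows.\<close>

definition bump :: "real \<Rightarrow> real" where
  "bump t = (if t > 0 then exp (- (1 / t)) else 0)"

lemma bump_nonneg [simp]: "0 \<le> bump t" and bump_le_1 [simp]: "bump t \<le> 1"
  by (auto simp: bump_def)

lemma poly_exp_decay: "((\<lambda>x. poly p x * exp (- x)) \<longlongrightarrow> (0::real)) at_top"
proof -
  have "((\<lambda>x. \<Sum>i\<le>degree p. coeff p i * (x ^ i / exp x)) \<longlongrightarrow> (\<Sum>i\<le>degree p. coeff p i * 0)) at_top"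
    by (intro tendsto_intros tendsto_power_div_exp_0)
  then show ?thesis
    by (simp add: poly_altdef sum_distrib_right exp_minus divide_inverse mult.assoc)
qed

text \<open>With y = 1/t the derivative of p(y) exp(-y) in t is y^2 (p(y) - p'(y)) exp(-y), which
  has the same form; \<open>monom 1 2\<close> is the factor y^2 from the chain rule.\<close>

lemma bump_family_deriv:
  fixes p :: "real poly"
  defines "B \<equiv> \<lambda>p t::real. if t > 0 then poly p (1 / t) * exp (- (1 / t)) else 0"
  shows "(B p has_real_derivative B (monom 1 2 * (p - pderiv p)) x) (at x)"
proof -
  consider "x < 0" | "x = 0" | "x > 0" by linarith
  then show ?thesis
  proof cases
    case 1
    have "((\<lambda>t. 0) has_real_derivative 0) (at x)" by simp
    then have "(B p has_real_derivative 0) (at x)"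
      by (rule has_field_derivative_transform_within_open[of _ _ _ "{..<0}"]) (use 1 in \<open>auto simp: B_def\<close>)
    then show ?thesis using 1 by (simp add: B_def)
  next
    case 3
    have "((\<lambda>t. poly p (1 / t) * exp (- (1 / t))) has_real_derivative
        (poly (pderiv p) (1 / x) * (- (1 / x\<^sup>2))) * exp (- (1 / x))
        + poly p (1 / x) * (exp (- (1 / x)) * (1 / x\<^sup>2))) (at x)"
      using 3 by (auto intro!: derivative_eq_intros DERIV_chain2[OF poly_DERIV] simp: power2_eq_square)
    also have "(poly (pderiv p) (1 / x) * (- (1 / x\<^sup>2))) * exp (- (1 / x))
        + poly p (1 / x) * (exp (- (1 / x)) * (1 / x\<^sup>2)) = B (monom 1 2 * (p - pderiv p)) x"
      using 3 by (simp add: B_def poly_monom field_simps)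
    finally show ?thesis
      by (rule has_field_derivative_transform_within_open[of _ _ _ "{0<..}"]) (use 3 in \<open>auto simp: B_def\<close>)
  next
    case 2
    have "((\<lambda>y. (B p y - B p 0) / (y - 0)) \<longlongrightarrow> 0) (at 0)"
    proof (rule filterlim_split_at)
      show "((\<lambda>y. (B p y - B p 0) / (y - 0)) \<longlongrightarrow> 0) (at_left 0)"
        by (rule tendsto_eventually) (auto simp: B_def eventually_at_filter)
      \<comment> \<open>\<open>pCons 0 p\<close> is the polynomial X p(X): dividing by y supplies
        one more power of 1/y, and the exponential still wins.\<close>
      have "((\<lambda>y. poly (pCons 0 p) (inverse y) * exp (- inverse y)) \<longlongrightarrow> 0) (at_right 0)"
        by (rule filterlim_compose[OF poly_exp_decay filterlim_inverse_at_top_right])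
      then show "((\<lambda>y. (B p y - B p 0) / (y - 0)) \<longlongrightarrow> 0) (at_right 0)"
        by (rule Lim_transform_eventually) (auto simp: B_def eventually_at_filter field_simps)
    qed
    then show ?thesis using 2 by (simp add: has_field_derivative_iff B_def)
  qed
qed

lemma bump_smooth1: "smooth1 bump"
proof (rule smooth1_coinduct[of _ "range (\<lambda>p t. if t > 0 then poly p (1 / t) * exp (- (1 / t)) else 0)"])
  show "bump \<in> range (\<lambda>p t. if t > 0 then poly p (1 / t) * exp (- (1 / t)) else 0)"
    by (rule range_eqI[of _ _ 1]) (auto simp: bump_def)
  fix g assume "g \<in> range (\<lambda>p t. if t > 0 then poly p (1 / t) * exp (- (1 / t)) else (0::real))"
  then obtain p where "g = (\<lambda>t. if t > 0 then poly p (1 / t) * exp (- (1 / t)) else 0)" by auto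
  with bump_family_deriv[of p]
  show "\<exists>g'\<in>range (\<lambda>p t. if t > 0 then poly p (1 / t) * exp (- (1 / t)) else (0::real)).
      \<forall>x. (g has_real_derivative g' x) (at x)"
    by (intro bexI[OF _ rangeI[of _ "monom 1 2 * (p - pderiv p)"]]) simp
qed

lemma bump_deriv: "deriv bump t = (if t > 0 then exp (- (1 / t)) / t\<^sup>2 else 0)"
proof -
  have "bump = (\<lambda>t. if t > 0 then poly 1 (1 / t) * exp (- (1 / t)) else 0)"
    by (auto simp: bump_def)
  with bump_family_deriv[of 1 t] show ?thesis
    by (intro DERIV_imp_deriv) (auto simp: poly_monom power_one_over field_simps)
qed

section \<open>Tensor products of functions of one variable and their partial derivatives\<close>

definition tensor :: "('n \<Rightarrow> real \<Rightarrow> real) \<Rightarrow> real^'n \<Rightarrow> real" where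
  "tensor h x = (\<Prod>i\<in>UNIV. h i (x $ i))"

lemma tensor_remove: "tensor h x = h i (x $ i) * (\<Prod>j\<in>UNIV - {i}. h j (x $ j))"
  unfolding tensor_def by (rule prod.remove) auto

lemma tensor_upd: "tensor (h(i := g)) x = g (x $ i) * (\<Prod>j\<in>UNIV - {i}. h j (x $ j))"
  unfolding tensor_remove[of _ x i] by (intro arg_cong2[where f="(*)"] prod.cong) auto

lemma tensor_has_derivative:
  assumes "\<And>i. (h i has_real_derivative h' i) (at (x $ i))"
  shows "(tensor h has_derivative (\<lambda>y. \<Sum>i\<in>UNIV. (h' i * y $ i) * (\<Prod>j\<in>UNIV - {i}. h j (x $ j)))) (at x)"
proof -
  have "((\<lambda>x. h i (x $ i)) has_derivative (\<lambda>y. h' i * y $ i)) (at x)" for i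
  proof -
    have "((\<lambda>x. x $ i) has_derivative (\<lambda>y. y $ i)) (at x)"
      by (rule bounded_linear_imp_has_derivative) (rule bounded_linear_vec_nth)
    from has_derivative_compose[OF this, of "h i" "(*) (h' i)"] assms[of i]
    show ?thesis by (simp add: has_field_derivative_def)
  qed
  then show ?thesis unfolding tensor_def[abs_def]
    by (rule has_derivative_prod)
qed

lemma partial_deriv_eq: "(f has_derivative f') (at x) \<Longrightarrow> partial_deriv i f x = f' (axis i 1)"
  by (simp add: partial_deriv_def frechet_derivative_at[symmetric])

lemma partial_deriv_tensor:
  assumes "\<And>i. smooth1 (h i)"
  shows "partial_deriv i (tensor h) = tensor (h(i := deriv (h i)))"
proof
  fix x
  have "partial_deriv i (tensor h) x
      = (\<Sum>k\<in>UNIV. (deriv (h k) (x $ k) * (axis i 1 :: real^'a) $ k) * (\<Prod>j\<in>UNIV - {k}. h j (x $ j)))"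
    by (rule partial_deriv_eq[OF tensor_has_derivative]) (rule smooth1_has_deriv[OF assms])
  also have "\<dots> = (\<Sum>k\<in>UNIV. if k = i then deriv (h k) (x $ k) * (\<Prod>j\<in>UNIV - {k}. h j (x $ j)) else 0)"
    by (intro sum.cong) (auto simp: axis_def)
  finally show "partial_deriv i (tensor h) x = tensor (h(i := deriv (h i))) x"
    by (simp add: tensor_upd)
qed

text \<open>A partial derivative replaces one factor by its derivative, so tensor products of smooth
  factors stay in their class and smoothness in n variables reduces to one variable.\<close>

lemma iter_partial_deriv_tensor:
  assumes "\<And>i. smooth1 (h i)"
  shows "\<exists>g. (\<forall>i. smooth1 (g i)) \<and> iter_partial_deriv is (tensor h) = tensor g"
proof (induction "is")
  case (Cons i "is")
  then obtain g where g: "\<And>i. smooth1 (g i)" "iter_partial_deriv is (tensor h) = tensor g" by blast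
  moreover have "smooth1 ((g(i := deriv (g i))) j)" for j
    using g(1) by (simp add: smooth1_deriv)
  moreover have "iter_partial_deriv (i # is) (tensor h) = tensor (g(i := deriv (g i)))"
    by (simp only: iter_partial_deriv.simps g partial_deriv_tensor)
  ultimately show ?case by blast
qed (use assms in auto)

lemma tensor_differentiable: "(\<And>i. smooth1 (h i)) \<Longrightarrow> tensor h differentiable at x"
  by (rule differentiableI, rule tensor_has_derivative, rule smooth1_has_deriv)

lemma smooth_tensor:
  assumes "\<And>i. smooth1 (h i)"
  shows "smooth (tensor h)"
  unfolding smooth_def
proof
  fix "is"
  obtain g where "\<And>i. smooth1 (g i)" "iter_partial_deriv is (tensor h) = tensor g"
    using iter_partial_deriv_tensor[of h "is"] assms by blast
  then show "iter_partial_deriv is (tensor h) differentiable_on UNIV"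
    by (auto simp: differentiable_on_def tensor_differentiable)
qed

lemma smooth_differentiable: "smooth f \<Longrightarrow> f differentiable at x"
  unfolding smooth_def by (metis differentiable_on_def iter_partial_deriv.simps(1) UNIV_I)

lemma smooth_partial_deriv: "smooth f \<Longrightarrow> smooth (partial_deriv i f)"
  unfolding smooth_def
proof
  fix "is" assume "\<forall>is. iter_partial_deriv is f differentiable_on UNIV"
  moreover have "iter_partial_deriv is (partial_deriv i f) = iter_partial_deriv (is @ [i]) f"
    by (induction "is") auto
  ultimately show "iter_partial_deriv is (partial_deriv i f) differentiable_on UNIV" by simp
qed

lemma smooth_continuous_on: "smooth f \<Longrightarrow> continuous_on S f"
  by (rule continuous_at_imp_continuous_on)
    (simp add: smooth_differentiable differentiable_imp_continuous_within)

lemma continuous_on_tensor: "(\<And>i. smooth1 (h i)) \<Longrightarrow> continuous_on S (tensor h)"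
  by (rule smooth_continuous_on, rule smooth_tensor)

section \<open>Integration by parts for \<open>C\<^sup>1\<close> functions\<close>

abbreviation Q :: "(real^'n) set" where
  "Q \<equiv> unit_cube"

lemma unit_cube_eq_box: "(Q :: (real^'n) set) = box 0 1"
  by (auto simp: unit_cube_def mem_box_cart)

lemma unit_cube_lebesgue [measurable, simp]: "(Q :: (real^'n) set) \<in> sets lebesgue"
  by (simp add: unit_cube_eq_box)

lemma finite_measure_unit_cube: "finite_measure (lebesgue_on (Q :: (real^'n) set))"
  using emeasure_lborel_box_finite[of "0::real^'n" 1]
  by (intro finite_measureI) (simp add: emeasure_restrict_space unit_cube_eq_box)

lemma continuous_compact_bound:
  fixes u :: "'a::topological_space \<Rightarrow> real"
  assumes "continuous_on UNIV u" "compact K"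
  obtains B where "\<And>x. x \<in> K \<Longrightarrow> \<bar>u x\<bar> \<le> B"
proof -
  have "bounded (u ` K)"
    using assms by (intro compact_imp_bounded compact_continuous_image) (auto intro: continuous_on_subset)
  then show ?thesis using that by (auto simp: bounded_iff)
qed

lemma L2_bounded:
  assumes "u \<in> borel_measurable (lebesgue_on (Q :: (real^'n) set))"
    and "\<And>x. x \<in> Q \<Longrightarrow> \<bar>u x\<bar> \<le> B"
  shows "u \<in> L2_space Q"
proof -
  interpret finite_measure "lebesgue_on (Q :: (real^'n) set)" by (rule finite_measure_unit_cube)
  have "integrable (lebesgue_on Q) (\<lambda>x. (u x)\<^sup>2)"
  proof (rule integrable_const_bound[of _ "B\<^sup>2"])
    show "AE x in lebesgue_on Q. norm ((u x)\<^sup>2) \<le> B\<^sup>2"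
      using power_mono[OF assms(2), of _ 2] by (intro AE_I2) simp
  qed (use assms in measurable)
  then show ?thesis using assms by (simp add: L2_space_def)
qed

lemma continuous_measurable_lebesgue_on:
  fixes u :: "real^'n \<Rightarrow> real"
  assumes "continuous_on UNIV u"
  shows "u \<in> borel_measurable (lebesgue_on \<Omega>)"
  using borel_measurable_continuous_onI[OF assms]
  by (intro measurable_restrict_space1 measurable_completion) simp

lemma continuous_L2:
  fixes u :: "real^'n \<Rightarrow> real"
  assumes "continuous_on UNIV u"
  shows "u \<in> L2_space Q"
proof -
  obtain B where "\<And>x. x \<in> cbox 0 1 \<Longrightarrow> \<bar>u x\<bar> \<le> B"
    using continuous_compact_bound[OF assms compact_cbox] by metis
  then show ?thesis
    by (intro L2_bounded[of _ B] continuous_measurable_lebesgue_on assms)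
      (use box_subset_cbox in \<open>auto simp: unit_cube_eq_box\<close>)
qed

text \<open>Passes from the completed measure on the cube to \<open>lborel\<close>, where
  translation invariance and Fubini are applied; for a Borel function completion changes
  nothing.\<close>

lemma integral_unit_cube_lborel:
  fixes u :: "real^'n \<Rightarrow> real"
  assumes [measurable]: "u \<in> borel_measurable borel"
  shows "(LINT x|lebesgue_on Q. u x) = (LINT x|lborel. indicator Q x * u x)"
proof -
  have [measurable]: "(Q :: (real^'n) set) \<in> sets borel" by (simp add: unit_cube_eq_box)
  have "(LINT x|lebesgue_on Q. u x) = (LINT x|lebesgue. indicator Q x *\<^sub>R u x)"
    by (rule integral_restrict_space) simp
  also have "\<dots> = (LINT x|lborel. indicator Q x * u x)"
    by (simp add: integral_completion)
  finally show ?thesis .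
qed

text \<open>Translation invariance makes the difference quotients of \<open>F\<close> integrate to zero.\<close>

lemma integral_partial_deriv_eq_0:
  fixes F :: "real^'n \<Rightarrow> real"
  assumes F: "\<And>x. F differentiable at x" and G: "continuous_on UNIV (partial_deriv i F)"
    and supp: "\<And>x. F x \<noteq> 0 \<Longrightarrow> norm x \<le> R"
  shows "(LINT x|lborel. partial_deriv i F x) = 0"
proof -
  let ?e = "axis i 1 :: real^'n"
  have cF: "continuous_on UNIV F"
    by (rule continuous_at_imp_continuous_on) (simp add: F differentiable_imp_continuous_within)
  have [measurable]: "F \<in> borel_measurable borel" "partial_deriv i F \<in> borel_measurable borel"
    using cF G by (auto intro: borel_measurable_continuous_onI)
  have G0: "partial_deriv i F x = 0" if "norm x > R" for x
  proof -
    have "((\<lambda>x. 0) has_derivative (\<lambda>y. 0)) (at x)" by simp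
    then have "(F has_derivative (\<lambda>y. 0)) (at x)"
    proof (rule has_derivative_transform_within_open)
      show "open {y::real^'n. norm y > R}" by (intro open_Collect_less continuous_intros)
    qed (use that supp in force)+
    then show ?thesis by (simp add: partial_deriv_eq)
  qed
  obtain B where B: "\<And>x. x \<in> cball 0 R \<Longrightarrow> \<bar>partial_deriv i F x\<bar> \<le> B"
    using continuous_compact_bound[OF G compact_cball] by metis
  have GB: "\<bar>partial_deriv i F x\<bar> \<le> max B 0" for x
    using B[of x] G0[of x] by (cases "norm x > R") (auto simp: max_def)
  have line: "((\<lambda>t. F (x + t *\<^sub>R ?e)) has_real_derivative partial_deriv i F (x + t *\<^sub>R ?e)) (at t)" for x t
  proof -
    have "(F has_derivative frechet_derivative F (at (x + t *\<^sub>R ?e))) (at (x + t *\<^sub>R ?e))"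
      using F frechet_derivative_works by blast
    moreover have "((\<lambda>t. x + t *\<^sub>R ?e) has_derivative (\<lambda>s. s *\<^sub>R ?e)) (at t)"
      by (auto intro!: derivative_eq_intros)
    ultimately have "((\<lambda>t. F (x + t *\<^sub>R ?e)) has_derivative
        (\<lambda>s. frechet_derivative F (at (x + t *\<^sub>R ?e)) (s *\<^sub>R ?e))) (at t)"
      using has_derivative_compose[of "\<lambda>t. x + t *\<^sub>R ?e" _ t UNIV F] by blast
    moreover have "frechet_derivative F (at y) (s *\<^sub>R ?e) = s * partial_deriv i F y" for s y
      unfolding partial_deriv_def using linear_frechet_derivative[OF F[of y]]
      by (simp add: linear_cmul)
    ultimately show ?thesis by (simp add: has_field_derivative_def mult_commute_abs)
  qed
  define q where "q m x = real (Suc m) * (F (x + (1 / real (Suc m)) *\<^sub>R ?e) - F x)" for m x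
  have q_lim: "(\<lambda>m. q m x) \<longlonglongrightarrow> partial_deriv i F x" for x
  proof -
    have "((\<lambda>t. (F (x + t *\<^sub>R ?e) - F x) / t) \<longlongrightarrow> partial_deriv i F x) (at 0)"
      using line[of x 0] by (simp add: has_field_derivative_iff)
    moreover have "filterlim (\<lambda>m. 1 / real (Suc m)) (at 0) sequentially"
      by (rule filterlim_atI) (use LIMSEQ_inverse_real_of_nat in \<open>auto simp: inverse_eq_divide\<close>)
    ultimately have "(\<lambda>m. (F (x + (1 / real (Suc m)) *\<^sub>R ?e) - F x) / (1 / real (Suc m)))
        \<longlonglongrightarrow> partial_deriv i F x"
      by (rule filterlim_compose)
    then show ?thesis by (simp add: q_def[abs_def] mult.commute)
  qed
  \<comment> \<open>The mean value theorem bounds the quotient by the maximum of the derivative. The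
    step has length at most 1, so for x outside the ball of radius \<open>R + 1\<close> both
    evaluation points lie outside the ball of radius \<open>R\<close> and the quotient is 0.\<close>
  have q_bound: "\<bar>q m x\<bar> \<le> max B 0 * indicator (cball 0 (R + 1)) x" for m x
  proof (cases "x \<in> cball 0 (R + 1)")
    case True
    have "(0::real) < 1 / real (Suc m)" by simp
    then obtain z where z: "F (x + (1 / real (Suc m)) *\<^sub>R ?e) - F (x + 0 *\<^sub>R ?e)
        = (1 / real (Suc m) - 0) * partial_deriv i F (x + z *\<^sub>R ?e)"
      using MVT2[of 0 "1 / real (Suc m)" "\<lambda>t. F (x + t *\<^sub>R ?e)" "\<lambda>t. partial_deriv i F (x + t *\<^sub>R ?e)"] line
      by blast
    then have "q m x = partial_deriv i F (x + z *\<^sub>R ?e)" by (simp add: q_def)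
    then show ?thesis using GB True by simp
  next
    case False
    then have n: "norm x > R + 1" by simp
    have "norm x \<le> norm (x + (1 / real (Suc m)) *\<^sub>R ?e) + norm ((1 / real (Suc m)) *\<^sub>R ?e)"
      using norm_triangle_ineq4[of "x + (1 / real (Suc m)) *\<^sub>R ?e" "(1 / real (Suc m)) *\<^sub>R ?e"] by simp
    moreover have "norm ((1 / real (Suc m)) *\<^sub>R ?e) \<le> 1" by simp
    ultimately have "norm (x + (1 / real (Suc m)) *\<^sub>R ?e) > R" using n by linarith
    then have "F (x + (1 / real (Suc m)) *\<^sub>R ?e) = 0" "F x = 0"
      using supp[of x] supp[of "x + (1 / real (Suc m)) *\<^sub>R ?e"] n by auto
    then show ?thesis by (simp add: q_def)
  qed
  have q_meas [measurable]: "q m \<in> borel_measurable borel" for m unfolding q_def by measurable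
  have dom: "integrable lborel (\<lambda>x. max B 0 * indicator (cball 0 (R + 1)) x :: real)"
    by (intro integrable_mult_right integrable_real_indicator) (simp_all add: emeasure_lborel_cball_finite[unfolded infinity_ennreal_def])
  have "(\<lambda>m. LINT x|lborel. q m x) \<longlonglongrightarrow> (LINT x|lborel. partial_deriv i F x)"
    by (rule integral_dominated_convergence[OF _ _ dom]) (use q_lim q_bound in auto)
  moreover have "(LINT x|lborel. q m x) = 0" for m
  proof -
    obtain B' where B': "\<And>x. x \<in> cball 0 R \<Longrightarrow> \<bar>F x\<bar> \<le> B'"
      using continuous_compact_bound[OF cF compact_cball] by metis
    have Fi: "integrable lborel F"
    proof (rule Bochner_Integration.integrable_bound)
      show "integrable lborel (\<lambda>x. B' * indicator (cball 0 R) x :: real)"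
        by (intro integrable_mult_right integrable_real_indicator) (simp_all add: emeasure_lborel_cball_finite[unfolded infinity_ennreal_def])
      show "AE x in lborel. norm (F x) \<le> norm (B' * indicator (cball 0 R) x)"
        using B' supp by (intro AE_I2) (force simp: indicator_def)
    qed simp
    let ?c = "(1 / real (Suc m)) *\<^sub>R ?e"
    have "integrable (distr lborel borel ((+) ?c)) F" using Fi by (simp add: lborel_distr_plus)
    then have "integrable lborel (\<lambda>x. F (?c + x))" by (subst (asm) integrable_distr_eq) auto
    moreover have "(LINT x|lborel. F (?c + x)) = (LINT x|distr lborel borel ((+) ?c). F x)"
      by (subst integral_distr) auto
    moreover have "q m x = real (Suc m) * (F (?c + x) - F x)" for x
      by (simp only: q_def add.commute)
    ultimately show ?thesis using Fi by (simp add: lborel_distr_plus del: of_nat_Suc)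
  qed
  ultimately show ?thesis by (simp add: LIMSEQ_const_iff)
qed

lemma test_functions_smooth: "\<phi> \<in> test_functions \<Omega> \<Longrightarrow> smooth \<phi>"
  by (simp add: test_functions_def)

lemma test_functions_L2: "\<phi> \<in> test_functions Q \<Longrightarrow> \<phi> \<in> L2_space Q"
  by (simp add: test_functions_smooth continuous_L2 smooth_continuous_on)

lemma test_functions_partial_L2: "\<phi> \<in> test_functions Q \<Longrightarrow> partial_deriv i \<phi> \<in> L2_space Q"
  by (simp add: test_functions_smooth continuous_L2 smooth_continuous_on smooth_partial_deriv)

text \<open>Leibniz rule for \<open>u \<phi>\<close>, whose partial derivative integrates to zero
  over the whole space. The compact support comes from the test function alone, so \<open>u\<close>
  may be nonzero on the boundary of the cube, as cosines are.\<close>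

lemma C1_has_weak_partial:
  fixes u :: "real^'n \<Rightarrow> real"
  assumes u: "\<And>x. u differentiable at x" and du: "continuous_on UNIV (partial_deriv i u)"
  shows "has_weak_partial Q i u (partial_deriv i u)"
  unfolding has_weak_partial_def
proof (intro conjI ballI)
  have cu: "continuous_on UNIV u"
    by (rule continuous_at_imp_continuous_on) (simp add: u differentiable_imp_continuous_within)
  show uL: "u \<in> L2_space Q" and duL: "partial_deriv i u \<in> L2_space Q"
    using cu du by (auto intro: continuous_L2)
  fix \<phi> :: "real^'n \<Rightarrow> real" assume \<phi>: "\<phi> \<in> test_functions Q"
  then have sm: "smooth \<phi>" and K: "compact (closure {x. \<phi> x \<noteq> 0})" "closure {x. \<phi> x \<noteq> 0} \<subseteq> Q"
    by (auto simp: test_functions_def)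
  have c\<phi>: "continuous_on UNIV \<phi>" "continuous_on UNIV (partial_deriv i \<phi>)"
    using sm by (auto intro: smooth_continuous_on smooth_partial_deriv)
  have pd: "partial_deriv i (\<lambda>x. u x * \<phi> x) x = u x * partial_deriv i \<phi> x + partial_deriv i u x * \<phi> x" for x
    by (subst partial_deriv_eq[OF has_derivative_mult])
      (use u smooth_differentiable[OF sm] in \<open>auto simp: frechet_derivative_works[symmetric] partial_deriv_def\<close>)
  have \<phi>0: "\<phi> x = 0 \<and> partial_deriv i \<phi> x = 0" if "x \<notin> closure {x. \<phi> x \<noteq> 0}" for x
  proof
    show "\<phi> x = 0" using that closure_subset[of "{x. \<phi> x \<noteq> 0}"] by auto
    have "((\<lambda>x. 0) has_derivative (\<lambda>y. 0)) (at x)" by simp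
    then have "(\<phi> has_derivative (\<lambda>y. 0)) (at x)"
    proof (rule has_derivative_transform_within_open)
      show "open (- closure {x. \<phi> x \<noteq> 0})" by auto
    qed (use that closure_subset[of "{x. \<phi> x \<noteq> 0}"] in auto)
    then show "partial_deriv i \<phi> x = 0" by (simp add: partial_deriv_eq)
  qed
  obtain R where R: "\<And>x. x \<in> closure {x. \<phi> x \<noteq> 0} \<Longrightarrow> norm x \<le> R"
    using compact_imp_bounded[OF K(1)] unfolding bounded_iff by blast
  have int0: "(LINT x|lborel. partial_deriv i (\<lambda>x. u x * \<phi> x) x) = 0"
  proof (rule integral_partial_deriv_eq_0)
    show "(\<lambda>x. u x * \<phi> x) differentiable at x" for x
      using u smooth_differentiable[OF sm] by (rule differentiable_mult)
    show "continuous_on UNIV (partial_deriv i (\<lambda>x. u x * \<phi> x))"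
      unfolding pd[abs_def] by (intro continuous_intros cu du c\<phi>)
    show "norm x \<le> R" if "u x * \<phi> x \<noteq> 0" for x
      using that \<phi>0[of x] R[of x] by (cases "x \<in> closure {x. \<phi> x \<noteq> 0}") simp_all
  qed
  \<comment> \<open>The test function and its derivative vanish off the support, which lies in the
    cube, so restricting the integral to the cube loses nothing.\<close>
  have "u x * partial_deriv i \<phi> x + partial_deriv i u x * \<phi> x
      = indicator Q x * (u x * partial_deriv i \<phi> x + partial_deriv i u x * \<phi> x)" for x
    using K(2) \<phi>0[of x] by (cases "x \<in> closure {x. \<phi> x \<noteq> 0}") (auto simp: indicator_def)
  then have "(LINT x|lborel. partial_deriv i (\<lambda>x. u x * \<phi> x) x)
      = (LINT x|lborel. indicator Q x * (u x * partial_deriv i \<phi> x + partial_deriv i u x * \<phi> x))"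
    unfolding pd by (intro Bochner_Integration.integral_cong) auto
  also have "\<dots> = (LINT x|lebesgue_on Q. u x * partial_deriv i \<phi> x + partial_deriv i u x * \<phi> x)"
    by (rule integral_unit_cube_lborel[symmetric])
      (intro borel_measurable_continuous_onI continuous_intros cu du c\<phi>)
  also have "\<dots> = L2_inner Q u (partial_deriv i \<phi>) + L2_inner Q (partial_deriv i u) \<phi>"
    unfolding L2_inner_def using uL duL test_functions_L2[OF \<phi>] test_functions_partial_L2[OF \<phi>]
    by (simp add: L2_mult_integrable)
  finally show "L2_inner Q u (partial_deriv i \<phi>) = - L2_inner Q (partial_deriv i u) \<phi>"
    using int0 by simp
qed

section \<open>Smooth cut-offs of boxes\<close>

definition box_bump :: "real^'n \<Rightarrow> real^'n \<Rightarrow> nat \<Rightarrow> real^'n \<Rightarrow> real" where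
  "box_bump a b m = tensor (\<lambda>i t. bump (real m * (t - a $ i) - 1) * bump (real m * (b $ i - t) - 1))"

lemma tensor_bounds:
  assumes "\<And>i. 0 \<le> h i (x $ i)" "\<And>i. h i (x $ i) \<le> 1"
  shows "0 \<le> tensor h x" "tensor h x \<le> 1"
  unfolding tensor_def using assms by (simp_all add: prod_nonneg prod_le_1)

lemma smooth1_cutoff: "smooth1 (\<lambda>t. bump (real m * (t - a) - 1) * bump (real m * (b - t) - 1))"
proof (rule smooth1_mult)
  show "smooth1 (\<lambda>t. bump (real m * (t - a) - 1))"
    using smooth1_affine[OF bump_smooth1, of "real m" "- real m * a - 1"] by (simp add: algebra_simps)
  show "smooth1 (\<lambda>t. bump (real m * (b - t) - 1))"
    using smooth1_affine[OF bump_smooth1, of "- real m" "real m * b - 1"] by (simp add: algebra_simps)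
qed

text \<open>The margin \<open>1 / m\<close> puts the closure of the support into a closed box inside
  the open one. The shift by -1 in the cut-offs is what produces this margin.\<close>

lemma tensor_test_function:
  assumes "\<And>i. smooth1 (h i)" and "0 < m" and "\<And>i t. h i t \<noteq> 0 \<Longrightarrow> a $ i + 1 / real m \<le> t \<and> t \<le> b $ i - 1 / real m"
    and "box a b \<subseteq> \<Omega>"
  shows "tensor h \<in> test_functions \<Omega>"
proof -
  let ?K = "cbox (\<chi> i. a $ i + 1 / real m) (\<chi> i. b $ i - 1 / real m)"
  have "{x. tensor h x \<noteq> 0} \<subseteq> ?K"
    using assms(3) by (auto simp: tensor_def mem_box_cart)
  then have "closure {x. tensor h x \<noteq> 0} \<subseteq> ?K" by (simp add: closure_minimal closed_cbox)
  moreover have "?K \<subseteq> box a b"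
    using assms(2) by (auto simp: mem_box_cart) (smt (verit) divide_pos_pos of_nat_0_less_iff)+
  moreover have "compact (closure {x. tensor h x \<noteq> 0})"
    using \<open>closure {x. tensor h x \<noteq> 0} \<subseteq> ?K\<close> compact_cbox bounded_subset bounded_cbox
    by (meson closed_closure compact_eq_bounded_closed)
  ultimately show ?thesis
    using assms by (auto simp: test_functions_def smooth_tensor)
qed

lemma bump_tendsto_1:
  assumes "c > 0"
  shows "(\<lambda>m. bump (real m * c - 1)) \<longlonglongrightarrow> 1"
proof -
  have "filterlim (\<lambda>m. c * real m) at_top sequentially"
    using tendsto_const assms filterlim_real_sequentially by (rule filterlim_tendsto_pos_mult_at_top)
  then have lim: "filterlim (\<lambda>m. real m * c - 1) at_top sequentially"
    using filterlim_tendsto_add_at_top[OF tendsto_const[of "- 1"]] by (simp add: mult.commute)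
  have "((\<lambda>t. exp (- (1 / t))) \<longlongrightarrow> exp (- (0::real))) at_top"
    by (intro tendsto_intros tendsto_divide_0[OF tendsto_const] filterlim_at_top_imp_at_infinity filterlim_ident)
  then have "((\<lambda>t. exp (- (1 / t))) \<longlongrightarrow> (1::real)) at_top" by simp
  then have "(bump \<longlongrightarrow> 1) at_top"
    by (rule Lim_transform_eventually)
      (auto simp: bump_def eventually_at_top_linorder intro!: exI[of _ 1])
  from filterlim_compose[OF this lim] show ?thesis .
qed

lemma box_bump_tendsto: "(\<lambda>m. box_bump a b m x) \<longlonglongrightarrow> indicator (box a b) x"
proof -
  have *: "(\<lambda>m. bump (real m * (x $ i - a $ i) - 1) * bump (real m * (b $ i - x $ i) - 1))
      \<longlonglongrightarrow> (if a $ i < x $ i \<and> x $ i < b $ i then 1 else 0)" for i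
  proof (cases "a $ i < x $ i \<and> x $ i < b $ i")
    case True
    then show ?thesis
      using tendsto_mult[OF bump_tendsto_1[of "x $ i - a $ i"] bump_tendsto_1[of "b $ i - x $ i"]] by simp
  next
    case False
    have "bump (real m * c - 1) = 0" if "c \<le> 0" for m c
      using mult_nonneg_nonpos[of "real m" c] that by (simp add: bump_def)
    then have "(\<lambda>m. bump (real m * (x $ i - a $ i) - 1) * bump (real m * (b $ i - x $ i) - 1)) = (\<lambda>m. 0)"
      using False by (intro ext) (metis diff_le_0_iff_le mult_eq_0_iff not_le_imp_less)
    moreover have "(if a $ i < x $ i \<and> x $ i < b $ i then 1 else 0::real) = 0" using False by simp
    ultimately show ?thesis by (simp only: tendsto_const)
  qed
  have "(\<lambda>m. box_bump a b m x) \<longlonglongrightarrow> (\<Prod>i\<in>UNIV. if a $ i < x $ i \<and> x $ i < b $ i then 1 else 0)"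
    unfolding box_bump_def tensor_def by (intro tendsto_prod *)
  moreover have "(\<Prod>i\<in>UNIV. if a $ i < x $ i \<and> x $ i < b $ i then 1 else 0::real) = indicator (box a b) x"
    by (auto simp: indicator_def mem_box_cart intro!: prod.neutral) 
  ultimately show ?thesis by simp
qed

section \<open>Weak derivatives on the unit cube\<close>

text \<open>Open boxes are closed under intersection and generate the Borel sets, so vanishing
  integrals extend to all Borel sets by a Dynkin argument. Lebesgue sets differ from Borel sets by
  null sets, and a function whose integral over every measurable set is 0 vanishes almost
  everywhere.\<close>

lemma AE_zero_of_box_integrals:
  fixes w :: "real^'n \<Rightarrow> real"
  assumes w: "integrable (lebesgue_on Q) w"
    and box: "\<And>a b. box a b \<subseteq> Q \<Longrightarrow> (LINT x:box a b|lebesgue_on Q. w x) = 0"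
  shows "AE x in lebesgue_on Q. w x = 0"
proof -
  let ?Q = "Q :: (real^'n) set"
  let ?M = "lebesgue_on ?Q"
  have [measurable]: "w \<in> borel_measurable ?M" using w by auto
  have setsM: "A \<inter> ?Q \<in> sets ?M" if "A \<in> sets borel" for A :: "(real^'n) set"
    using that by (auto simp: sets_restrict_space_iff)
  have sint: "set_integrable ?M A w" if "A \<in> sets ?M" for A
    unfolding set_integrable_def using w that by (rule integrable_mult_indicator[rotated])
  \<comment> \<open>The cube is itself one of the boxes; complements in the Dynkin argument are
    taken relative to it.\<close>
  have total: "(LINT x:?Q|?M. w x) = 0" using box[of 0 1] by (simp add: unit_cube_eq_box)
  have borel0: "(LINT x:(A \<inter> ?Q)|?M. w x) = 0" if "A \<in> sets borel" for A :: "(real^'n) set"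
  proof -
    have "Int_stable (range (\<lambda>(a, b). box a b :: (real^'n) set))"
      by (auto simp: Int_stable_def Int_interval_cart box_Int_box)
    moreover have "range (\<lambda>(a, b). box a b :: (real^'n) set) \<subseteq> Pow UNIV" by simp
    moreover have "A \<in> sigma_sets UNIV (range (\<lambda>(a, b). box a b))"
      using that by (simp add: borel_eq_box)
    ultimately show ?thesis
    proof (induction rule: sigma_sets_induct_disjoint)
      case (basic A)
      then obtain a b :: "real^'n" where A: "A = box a b" by auto
      obtain c d :: "real^'n" where cd: "box a b \<inter> ?Q = box c d"
        unfolding unit_cube_eq_box box_Int_box by blast
      have "box c d \<subseteq> ?Q" using cd by blast
      then show ?case unfolding A cd by (rule box)
    next
      case (compl A)
      have A: "A \<in> sets borel" using compl(1) by (simp add: borel_eq_box)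
      have "(LINT x:?Q|?M. w x) = (LINT x:(A \<inter> ?Q) \<union> ((UNIV - A) \<inter> ?Q)|?M. w x)"
        by (rule arg_cong[where f="\<lambda>S. LINT x:S|?M. w x"]) auto
      also have "\<dots> = (LINT x:(A \<inter> ?Q)|?M. w x) + (LINT x:((UNIV - A) \<inter> ?Q)|?M. w x)"
        using A by (intro set_integral_Un sint setsM) auto
      finally show ?case using compl(2) total by simp
    next
      case (union A)
      have A: "A i \<in> sets borel" for i using union(2) by (auto simp: borel_eq_box)
      have "(LINT x:(\<Union>i. A i \<inter> ?Q)|?M. w x) = (\<Sum>i. LINT x:(A i \<inter> ?Q)|?M. w x)"
      proof (rule lebesgue_integral_countable_add)
        show "A i \<inter> ?Q \<inter> (A j \<inter> ?Q) = {}" if "i \<noteq> j" for i j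
          using union(1) that by (auto simp: disjoint_family_on_def)
        show "set_integrable ?M (\<Union>i. A i \<inter> ?Q) w"
          by (intro sint sets.countable_UN) (use setsM[OF A] in auto)
      qed (rule setsM[OF A])
      also have "\<dots> = 0" by (simp add: union(3))
      also have "(\<Union>i. A i \<inter> ?Q) = (\<Union>i. A i) \<inter> ?Q" by auto
      finally show ?case .
    qed (auto simp: set_lebesgue_integral_def)
  qed
  have "(LINT x:A|?M. w x) = (LINT x:A|?M. 0)" if "A \<in> sets ?M" for A
  proof -
    have A: "A \<in> sets lebesgue" "A \<subseteq> ?Q" using that by (auto simp: sets_restrict_space_iff)
    obtain S N N' where SN: "A = S \<union> N" "N \<subseteq> N'" "N' \<in> null_sets lborel" "S \<in> sets lborel"
      using A(1) by (rule sets_completionE)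
    have "AE x in lebesgue. x \<notin> N'" using SN(3) by (intro AE_not_in null_sets_completionI)
    then have N': "AE x in ?M. x \<notin> N'" by (auto simp: AE_restrict_space_iff)
    have S: "S \<in> sets ?M" using SN A by (auto simp: sets_restrict_space_iff)
    have "(LINT x:A|?M. w x) = (LINT x:S|?M. w x)"
      unfolding set_lebesgue_integral_def
    proof (rule integral_cong_AE)
      show "AE x in ?M. indicat_real A x *\<^sub>R w x = indicat_real S x *\<^sub>R w x"
        using N' by eventually_elim (use SN in \<open>auto simp: indicator_def\<close>)
    qed (use that S in measurable)
    also have "S = S \<inter> ?Q" using SN A by auto
    finally show ?thesis using borel0[of S] SN(4) by (simp add: set_lebesgue_integral_def)
  qed
  from density_unique_real[OF w _ this] show ?thesis by simp
qed

text \<open>Box cut-offs are test functions that tend to indicators of boxes, with the absolute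
  value of \<open>w\<close> as majorant; it is integrable because the cube has finite
  measure.\<close>

lemma fundamental_lemma_of_variations:
  fixes w :: "real^'n \<Rightarrow> real"
  assumes w: "w \<in> L2_space Q"
    and test: "\<And>\<phi>. \<phi> \<in> test_functions Q \<Longrightarrow> L2_inner Q w \<phi> = 0"
  shows "AE x in lebesgue_on Q. w x = 0"
proof (rule AE_zero_of_box_integrals)
  let ?M = "lebesgue_on (Q :: (real^'n) set)"
  have "(\<lambda>x. 1) \<in> L2_space (Q :: (real^'n) set)" by (rule continuous_L2) simp
  from L2_mult_integrable[OF w this] show wi: "integrable ?M w" by simp
  note [measurable] = borel_measurable_integrable[OF wi]
  fix a b :: "real^'n" assume ab: "box a b \<subseteq> Q"
  have sm: "smooth1 (\<lambda>t. bump (real m * (t - a $ i) - 1) * bump (real m * (b $ i - t) - 1))" for m i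
    by (rule smooth1_cutoff)
  have meas[measurable]: "box_bump a b m \<in> borel_measurable ?M" for m
    unfolding box_bump_def by (intro continuous_measurable_lebesgue_on continuous_on_tensor sm)
  have box_M[measurable]: "box a b \<in> sets ?M" using ab by (auto simp: sets_restrict_space_iff)
  have "(\<lambda>m. LINT x|?M. w x * box_bump a b (Suc m) x) \<longlonglongrightarrow> (LINT x|?M. w x * indicator (box a b) x)"
  proof (rule integral_dominated_convergence[where w="\<lambda>x. \<bar>w x\<bar>"])
    show "AE x in ?M. (\<lambda>m. w x * box_bump a b (Suc m) x) \<longlonglongrightarrow> w x * indicator (box a b) x"
      using LIMSEQ_Suc[OF box_bump_tendsto] by (intro AE_I2 tendsto_intros)
    have "0 \<le> box_bump a b m x \<and> box_bump a b m x \<le> 1" for m x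
      unfolding box_bump_def by (intro conjI tensor_bounds mult_nonneg_nonneg mult_le_one) auto
    then show "AE x in ?M. norm (w x * box_bump a b (Suc m) x) \<le> \<bar>w x\<bar>" for m
      by (intro AE_I2) (simp add: abs_mult mult_left_le)
  qed (use wi in auto)
  moreover have "(LINT x|?M. w x * box_bump a b (Suc m) x) = 0" for m
  proof -
    have "bump (real m' * c - 1) \<noteq> 0 \<longleftrightarrow> c > 1 / real m'" if "m' > 0" for m' c
      using that by (auto simp: bump_def field_simps)
    then have "box_bump a b (Suc m) \<in> test_functions Q"
      unfolding box_bump_def
      by (intro tensor_test_function[where m="Suc m" and a=a and b=b] sm ab) (force simp del: of_nat_Suc)+
    from test[OF this] show ?thesis by (simp add: L2_inner_def)
  qed
  ultimately have "(LINT x|?M. w x * indicator (box a b) x) = 0" by (simp add: LIMSEQ_const_iff)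
  then show "(LINT x:box a b|?M. w x) = 0" by (simp add: set_lebesgue_integral_def mult.commute)
qed

section \<open>Calculus of weak derivatives: uniqueness, linearity, closedness\<close>

lemma has_weak_partialD:
  assumes "has_weak_partial \<Omega> i u g"
  shows "u \<in> L2_space \<Omega>" "g \<in> L2_space \<Omega>"
    "\<phi> \<in> test_functions \<Omega> \<Longrightarrow> L2_inner \<Omega> u (partial_deriv i \<phi>) = - L2_inner \<Omega> g \<phi>"
  using assms by (auto simp: has_weak_partial_def)

lemma has_weak_partial_unique:
  assumes "has_weak_partial Q i u g" "has_weak_partial Q i u g'"
  shows "AE x in lebesgue_on Q. g x = g' x"
proof -
  note g = has_weak_partialD[OF assms(1)] and g' = has_weak_partialD[OF assms(2)]
  have "AE x in lebesgue_on Q. g x - g' x = 0"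
    using g g' by (intro fundamental_lemma_of_variations) (auto simp: L2_inner_diff_left test_functions_L2)
  then show ?thesis by simp
qed

lemma has_weak_partial_cong_AE:
  assumes "has_weak_partial Q i u g" "AE x in lebesgue_on Q. u x = u' x"
    "AE x in lebesgue_on Q. g x = g' x" "u' \<in> L2_space Q" "g' \<in> L2_space Q"
  shows "has_weak_partial Q i u' g'"
proof -
  note g = has_weak_partialD[OF assms(1)]
  have "L2_inner Q u' (partial_deriv i \<phi>) = - L2_inner Q g' \<phi>"
    if \<phi>: "\<phi> \<in> test_functions Q" for \<phi>
    using g(3)[OF \<phi>] L2_inner_cong_AE_left[OF assms(2) g(1) assms(4) test_functions_partial_L2[OF \<phi>]]
      L2_inner_cong_AE_left[OF assms(3) g(2) assms(5) test_functions_L2[OF \<phi>]] by metis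
  then show ?thesis using assms by (simp add: has_weak_partial_def)
qed

lemma has_weak_partial_add:
  assumes "has_weak_partial Q i u g" "has_weak_partial Q i v h"
  shows "has_weak_partial Q i (\<lambda>x. u x + v x) (\<lambda>x. g x + h x)"
  using assms by (auto simp: has_weak_partial_def L2_inner_add_left test_functions_L2 test_functions_partial_L2)

lemma has_weak_partial_scale:
  assumes "has_weak_partial Q i u g"
  shows "has_weak_partial Q i (\<lambda>x. c * u x) (\<lambda>x. c * g x)"
  using assms by (auto simp: has_weak_partial_def L2_inner_scale_left)

lemma has_weak_partial_diff:
  assumes "has_weak_partial Q i u g" "has_weak_partial Q i v h"
  shows "has_weak_partial Q i (\<lambda>x. u x - v x) (\<lambda>x. g x - h x)"
  using has_weak_partial_add[OF assms(1) has_weak_partial_scale[OF assms(2), of "- 1"]] by simp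

lemma has_weak_partial_sum:
  assumes "\<And>k. k \<in> I \<Longrightarrow> has_weak_partial Q i (u k) (g k)"
  shows "has_weak_partial Q i (\<lambda>x. \<Sum>k\<in>I. u k x) (\<lambda>x. \<Sum>k\<in>I. g k x)"
  using assms
proof (induction I rule: infinite_finite_induct)
  case (insert k I)
  then show ?case by (auto intro: has_weak_partial_add)
qed (auto simp: has_weak_partial_def L2_inner_def)

text \<open>Weak differentiation is a closed operator: for a fixed test function both sides of the
  defining identity are continuous in \<open>L\<^sup>2\<close>.\<close>

lemma has_weak_partial_lim:
  assumes "\<And>m. has_weak_partial Q i (s m) (t m)" and s: "L2_lim Q s u"
    and t: "L2_lim Q t g"
  shows "has_weak_partial Q i u g"
  unfolding has_weak_partial_def
proof (intro conjI ballI)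
  fix \<phi> :: "real^'a \<Rightarrow> real" assume \<phi>: "\<phi> \<in> test_functions Q"
  have "(\<lambda>m. L2_inner Q (s m) (partial_deriv i \<phi>)) \<longlonglongrightarrow> L2_inner Q u (partial_deriv i \<phi>)"
    by (rule L2_lim_inner[OF s test_functions_partial_L2[OF \<phi>]])
  moreover have "(\<lambda>m. - L2_inner Q (t m) \<phi>) \<longlonglongrightarrow> - L2_inner Q g \<phi>"
    by (intro tendsto_minus L2_lim_inner[OF t test_functions_L2[OF \<phi>]])
  ultimately show "L2_inner Q u (partial_deriv i \<phi>) = - L2_inner Q g \<phi>"
    using has_weak_partialD(3)[OF assms(1) \<phi>] by (simp add: LIMSEQ_unique)
qed (use s t in \<open>auto dest: L2_limD\<close>)

lemma weak_partial_works: "has_weak_partial \<Omega> i u g \<Longrightarrow> has_weak_partial \<Omega> i u (weak_partial \<Omega> i u)"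
  unfolding weak_partial_def by (rule someI[of "has_weak_partial \<Omega> i u"])

lemma weak_partial_AE:
  "has_weak_partial Q i u g \<Longrightarrow> AE x in lebesgue_on Q. weak_partial Q i u x = g x"
  using has_weak_partial_unique weak_partial_works by blast

lemma H1_spaceI: "(\<And>i. has_weak_partial \<Omega> i u (g i)) \<Longrightarrow> u \<in> H1_space \<Omega>"
  by (auto simp: H1_space_def dest: has_weak_partialD)

lemma H1_space_weak_partial: "u \<in> H1_space \<Omega> \<Longrightarrow> has_weak_partial \<Omega> i u (weak_partial \<Omega> i u)"
  by (auto simp: H1_space_def intro: weak_partial_works)

text \<open>\<open>H2_space\<close> refers to the chosen representatives of the first derivatives.
  Any explicit family \<open>g\<close> of first derivatives agrees with them almost everywhere, so
  derivatives of \<open>g\<close> serve as second derivatives of \<open>u\<close>.\<close>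

lemma H2_spaceI:
  assumes "\<And>i. has_weak_partial Q i u (g i)" "\<And>i j. has_weak_partial Q i (g j) (h i j)"
  shows "u \<in> H2_space Q"
    and "AE x in lebesgue_on Q. weak_partial Q i (weak_partial Q j u) x = h i j x"
proof -
  have *: "has_weak_partial Q i (weak_partial Q j u) (h i j)" for i j
    using weak_partial_AE[OF assms(1)[of j]] has_weak_partialD(2)[OF weak_partial_works[OF assms(1)[of j]]]
      has_weak_partialD(2)[OF assms(2)]
    by (intro has_weak_partial_cong_AE[OF assms(2)]) auto
  then have "weak_partial Q j u \<in> H1_space Q" for j by (rule H1_spaceI)
  then show "u \<in> H2_space Q" using H1_spaceI[OF assms(1)] by (auto simp: H2_space_def)
  show "AE x in lebesgue_on Q. weak_partial Q i (weak_partial Q j u) x = h i j x"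
    by (rule weak_partial_AE[OF *])
qed

lemma H2_spaceD:
  assumes "u \<in> H2_space \<Omega>"
  shows "has_weak_partial \<Omega> i u (weak_partial \<Omega> i u)"
    and "has_weak_partial \<Omega> i (weak_partial \<Omega> j u) (weak_partial \<Omega> i (weak_partial \<Omega> j u))"
  using assms by (auto simp: H2_space_def intro: H1_space_weak_partial)

lemma test_has_weak_partial: "\<phi> \<in> test_functions Q \<Longrightarrow> has_weak_partial Q i \<phi> (partial_deriv i \<phi>)"
  by (intro C1_has_weak_partial smooth_differentiable smooth_continuous_on smooth_partial_deriv test_functions_smooth)

section \<open>Test functions form a vector space\<close>

lemma iter_partial_deriv_lincomb:
  assumes "smooth f" "smooth g"
  shows "iter_partial_deriv is (\<lambda>x. a * f x + c * g x)
    = (\<lambda>x. a * iter_partial_deriv is f x + c * iter_partial_deriv is g x)"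
proof (induction "is")
  case (Cons i "is")
  have "iter_partial_deriv is f differentiable at x" "iter_partial_deriv is g differentiable at x" for x
    using assms by (auto simp: smooth_def differentiable_on_def)
  then have "((\<lambda>x. a * iter_partial_deriv is f x + c * iter_partial_deriv is g x) has_derivative
      (\<lambda>y. a * frechet_derivative (iter_partial_deriv is f) (at x) y
         + c * frechet_derivative (iter_partial_deriv is g) (at x) y)) (at x)" for x
    by (intro has_derivative_add has_derivative_mult_right) (simp_all add: frechet_derivative_works[symmetric])
  from partial_deriv_eq[OF this] Cons show ?case by (auto simp: partial_deriv_def)
qed simp

lemma smooth_lincomb:
  assumes "smooth f" "smooth g"
  shows "smooth (\<lambda>x. a * f x + c * g x)"
  using assms unfolding smooth_def iter_partial_deriv_lincomb[OF assms]
  by (auto intro!: differentiable_add differentiable_mult simp: differentiable_on_def)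

lemma test_functions_lincomb:
  assumes "\<phi> \<in> test_functions \<Omega>" "\<psi> \<in> test_functions \<Omega>"
  shows "(\<lambda>x. a * \<phi> x + c * \<psi> x) \<in> test_functions \<Omega>"
proof -
  have sub: "closure {x. a * \<phi> x + c * \<psi> x \<noteq> 0} \<subseteq> closure {x. \<phi> x \<noteq> 0} \<union> closure {x. \<psi> x \<noteq> 0}"
    unfolding closure_Un[symmetric] by (rule closure_mono) auto
  moreover have "compact (closure {x. a * \<phi> x + c * \<psi> x \<noteq> 0})"
    using assms bounded_subset[OF _ sub] by (auto simp: test_functions_def compact_eq_bounded_closed)
  ultimately show ?thesis
    using assms smooth_lincomb by (auto simp: test_functions_def)
qed

lemma partial_deriv_lincomb:
  assumes "smooth f" "smooth g"
  shows "partial_deriv i (\<lambda>x. a * f x + c * g x) = (\<lambda>x. a * partial_deriv i f x + c * partial_deriv i g x)"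
  using iter_partial_deriv_lincomb[OF assms, of "[i]"] by simp

section \<open>The space \<open>H\<^sup>1\<^sub>0\<close>: approximation, limits and integration by
  parts\<close>

lemma L2_norm_le_H1_norm:
  "L2_norm \<Omega> v \<le> H1_norm \<Omega> v" "L2_norm \<Omega> (weak_partial \<Omega> i v) \<le> H1_norm \<Omega> v"
proof -
  show "L2_norm \<Omega> v \<le> H1_norm \<Omega> v"
    unfolding L2_norm_def H1_norm_def by (rule real_sqrt_le_mono) (simp add: sum_nonneg)
  have "L2_inner \<Omega> (weak_partial \<Omega> i v) (weak_partial \<Omega> i v)
      \<le> (\<Sum>i\<in>UNIV. L2_inner \<Omega> (weak_partial \<Omega> i v) (weak_partial \<Omega> i v))"
    by (rule member_le_sum) auto
  then show "L2_norm \<Omega> (weak_partial \<Omega> i v) \<le> H1_norm \<Omega> v"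
    unfolding L2_norm_def H1_norm_def by (intro real_sqrt_le_mono) (simp add: add_increasing)
qed

text \<open>\<open>H1_norm\<close> involves chosen weak derivatives of the difference
  \<open>u x - \<phi> x\<close>. These agree almost everywhere with the differences of the
  derivatives, which turns one small norm into a bound for each component.\<close>

lemma H10_approx:
  assumes "u \<in> H10_space Q" "e > 0"
  obtains \<phi> where "\<phi> \<in> test_functions Q" "L2_norm Q (\<lambda>x. \<phi> x - u x) < e"
    "\<And>i. L2_norm Q (\<lambda>x. partial_deriv i \<phi> x - weak_partial Q i u x) < e"
proof -
  obtain \<phi> where \<phi>: "\<phi> \<in> test_functions Q" and lt: "H1_norm Q (\<lambda>x. u x - \<phi> x) < e"
    using assms by (auto simp: H10_space_def)
  have u: "has_weak_partial Q i u (weak_partial Q i u)" for i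
    using assms by (auto simp: H10_space_def intro: H1_space_weak_partial)
  note p = test_has_weak_partial[OF \<phi>]
  have "L2_norm Q (\<lambda>x. partial_deriv i \<phi> x - weak_partial Q i u x) < e" for i
  proof -
    note d = has_weak_partial_diff[OF u p]
    have "L2_norm Q (\<lambda>x. partial_deriv i \<phi> x - weak_partial Q i u x)
        = L2_norm Q (\<lambda>x. weak_partial Q i u x - partial_deriv i \<phi> x)"
      using L2_norm_minus[of Q "\<lambda>x. weak_partial Q i u x - partial_deriv i \<phi> x"] by simp
    also have "\<dots> = L2_norm Q (weak_partial Q i (\<lambda>x. u x - \<phi> x))"
      by (rule L2_norm_cong_AE[OF weak_partial_AE[OF d] has_weak_partialD(2)[OF weak_partial_works[OF d]]
            has_weak_partialD(2)[OF d], symmetric])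
    also have "\<dots> < e" using L2_norm_le_H1_norm(2) lt by (rule le_less_trans)
    finally show ?thesis .
  qed
  moreover have "L2_norm Q (\<lambda>x. \<phi> x - u x) < e"
    using L2_norm_le_H1_norm(1)[of Q "\<lambda>x. u x - \<phi> x"] lt L2_norm_minus[of Q "\<lambda>x. u x - \<phi> x"]
    by simp
  ultimately show ?thesis using that \<phi> by blast
qed

lemma H10_seq:
  assumes "u \<in> H10_space Q"
  obtains s where "\<And>m. s m \<in> test_functions Q" "L2_lim Q s u"
    "\<And>i. L2_lim Q (\<lambda>m. partial_deriv i (s m)) (weak_partial Q i u)"
proof -
  have u: "has_weak_partial Q i u (weak_partial Q i u)" for i
    using assms by (auto simp: H10_space_def intro: H1_space_weak_partial)
  have "\<exists>\<phi>. \<phi> \<in> test_functions Q \<and> L2_norm Q (\<lambda>x. \<phi> x - u x) < inverse (Suc m)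
      \<and> (\<forall>i. L2_norm Q (\<lambda>x. partial_deriv i \<phi> x - weak_partial Q i u x) < inverse (Suc m))" for m
    using H10_approx[OF assms, of "inverse (Suc m)"] by (metis inverse_positive_iff_positive of_nat_0_less_iff zero_less_Suc)
  then obtain s where s: "\<And>m. s m \<in> test_functions Q"
    "\<And>m. L2_norm Q (\<lambda>x. s m x - u x) < inverse (Suc m)"
    "\<And>m i. L2_norm Q (\<lambda>x. partial_deriv i (s m) x - weak_partial Q i u x) < inverse (Suc m)"
    by metis
  have lim: "f \<longlonglongrightarrow> 0" if "\<And>m. 0 \<le> f m" "\<And>m. f m < inverse (Suc m)" for f :: "nat \<Rightarrow> real"
    by (rule tendsto_sandwich[OF _ _ tendsto_const LIMSEQ_inverse_real_of_nat])
      (use that in \<open>auto intro!: always_eventually less_imp_le simp del: of_nat_Suc\<close>)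
  show ?thesis
  proof (rule that[OF s(1)])
    show "L2_lim Q s u"
      unfolding L2_lim_def using has_weak_partialD[OF u] test_functions_L2[OF s(1)] s(2) by (auto intro: lim)
    show "L2_lim Q (\<lambda>m. partial_deriv i (s m)) (weak_partial Q i u)" for i
      unfolding L2_lim_def using has_weak_partialD[OF u] test_functions_partial_L2[OF s(1)] s(3) by (auto intro: lim)
  qed
qed

text \<open>Closedness identifies the \<open>g i\<close> as weak derivatives of the limit; the
  \<open>H1_norm\<close> of the error is then an explicit expression in the component errors, each
  of which tends to 0.\<close>

lemma H10_I:
  assumes s: "\<And>m. s m \<in> test_functions Q" "L2_lim Q s u"
    "\<And>i. L2_lim Q (\<lambda>m. partial_deriv i (s m)) (g i)"
  shows "u \<in> H10_space Q" "has_weak_partial Q i u (g i)"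
proof -
  have u: "has_weak_partial Q i u (g i)" for i
    by (rule has_weak_partial_lim[OF test_has_weak_partial[OF s(1)] s(2,3)])
  then show "has_weak_partial Q i u (g i)" .
  have eq: "H1_norm Q (\<lambda>x. u x - s m x) = sqrt ((L2_norm Q (\<lambda>x. s m x - u x))\<^sup>2
      + (\<Sum>i\<in>UNIV. (L2_norm Q (\<lambda>x. partial_deriv i (s m) x - g i x))\<^sup>2))" for m
  proof -
    have "L2_norm Q (weak_partial Q i (\<lambda>x. u x - s m x))
        = L2_norm Q (\<lambda>x. partial_deriv i (s m) x - g i x)" for i
    proof -
      note d = has_weak_partial_diff[OF u test_has_weak_partial[OF s(1)]]
      have "L2_norm Q (weak_partial Q i (\<lambda>x. u x - s m x))
        = L2_norm Q (\<lambda>x. g i x - partial_deriv i (s m) x)"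
        using weak_partial_AE[OF d] has_weak_partialD(2)[OF d] has_weak_partialD(2)[OF weak_partial_works[OF d]]
        by (intro L2_norm_cong_AE) auto
      also have "\<dots> = L2_norm Q (\<lambda>x. partial_deriv i (s m) x - g i x)"
        using L2_norm_minus[of Q "\<lambda>x. partial_deriv i (s m) x - g i x"] by simp
      finally show ?thesis .
    qed
    moreover have "L2_norm Q (\<lambda>x. u x - s m x) = L2_norm Q (\<lambda>x. s m x - u x)"
      using L2_norm_minus[of Q "\<lambda>x. s m x - u x"] by simp
    ultimately show ?thesis unfolding H1_norm_def L2_norm_power2[symmetric] by simp
  qed
  have "(\<lambda>m. sqrt ((L2_norm Q (\<lambda>x. s m x - u x))\<^sup>2
      + (\<Sum>i\<in>UNIV. (L2_norm Q (\<lambda>x. partial_deriv i (s m) x - g i x))\<^sup>2)))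
      \<longlonglongrightarrow> sqrt (0\<^sup>2 + (\<Sum>i\<in>(UNIV::'a set). 0\<^sup>2))"
    by (intro tendsto_intros L2_limD[OF s(2)] L2_limD[OF s(3)])
  then have lim: "(\<lambda>m. H1_norm Q (\<lambda>x. u x - s m x)) \<longlonglongrightarrow> 0" by (simp add: eq)
  have "\<exists>\<phi>\<in>test_functions Q. H1_norm Q (\<lambda>x. u x - \<phi> x) < \<epsilon>" if \<epsilon>: "\<epsilon> > 0" for \<epsilon>
  proof -
    obtain m where "H1_norm Q (\<lambda>x. u x - s m x) < \<epsilon>"
      using order_tendstoD(2)[OF lim \<epsilon>] by (auto simp: eventually_sequentially)
    then show ?thesis using s(1) by blast
  qed
  then show "u \<in> H10_space Q" using H1_spaceI[OF u] by (simp add: H10_space_def)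
qed

text \<open>Each \<open>s m\<close> is replaced by a test function within 1/(m + 1) of it, in value
  and in first derivatives; the replacing sequence has the same limits.\<close>

lemma H10_lim:
  assumes s: "\<And>m. s m \<in> H10_space Q" "L2_lim Q s u"
    and p: "\<And>m i. has_weak_partial Q i (s m) (p i m)" "\<And>i. L2_lim Q (p i) (g i)"
  shows "u \<in> H10_space Q"
proof -
  have "\<exists>\<phi>. \<phi> \<in> test_functions Q \<and> L2_norm Q (\<lambda>x. \<phi> x - s m x) < inverse (Suc m)
      \<and> (\<forall>i. L2_norm Q (\<lambda>x. partial_deriv i \<phi> x - weak_partial Q i (s m) x) < inverse (Suc m))" for m
    using H10_approx[OF s(1), of "inverse (Suc m)"] by (metis inverse_positive_iff_positive of_nat_0_less_iff zero_less_Suc)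
  then obtain t where t: "\<And>m. t m \<in> test_functions Q"
    "\<And>m. L2_norm Q (\<lambda>x. t m x - s m x) < inverse (Suc m)"
    "\<And>m i. L2_norm Q (\<lambda>x. partial_deriv i (t m) x - weak_partial Q i (s m) x) < inverse (Suc m)"
    by metis
  have t3: "L2_norm Q (\<lambda>x. partial_deriv i (t m) x - p i m x) < inverse (Suc m)" for m i
  proof -
    have "L2_norm Q (\<lambda>x. partial_deriv i (t m) x - weak_partial Q i (s m) x)
      = L2_norm Q (\<lambda>x. partial_deriv i (t m) x - p i m x)"
      using weak_partial_AE[OF p(1)] has_weak_partialD(2)[OF p(1)] test_functions_partial_L2[OF t(1)]
        has_weak_partialD(2)[OF weak_partial_works[OF p(1)]]
      by (intro L2_norm_cong_AE L2_diff) auto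
    then show ?thesis using t(3)[of i m] by simp
  qed
  have lim: "L2_lim Q a v" if a: "\<And>m. a m \<in> L2_space Q" and c: "L2_lim Q c v"
    and ac: "\<And>m. L2_norm Q (\<lambda>x. a m x - c m x) < inverse (Suc m)" for a c and v :: "real^'a \<Rightarrow> real"
  proof -
    have le: "norm (L2_norm Q (\<lambda>x. a m x - v x)) \<le> inverse (Suc m) + L2_norm Q (\<lambda>x. c m x - v x)" for m
      using L2_norm_triangle[OF L2_diff[OF a L2_limD(1)[OF c]] L2_diff[OF L2_limD(1,2)[OF c]], of m m m] ac[of m]
      by simp
    have "(\<lambda>m. inverse (Suc m) + L2_norm Q (\<lambda>x. c m x - v x)) \<longlonglongrightarrow> 0"
      using tendsto_add[OF LIMSEQ_inverse_real_of_nat L2_limD(3)[OF c]] by simp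
    then have "(\<lambda>m. L2_norm Q (\<lambda>x. a m x - v x)) \<longlonglongrightarrow> 0"
      by (rule Lim_null_comparison[OF always_eventually[OF allI[OF le]]])
    then show ?thesis using a L2_limD(2)[OF c] by (simp add: L2_lim_def)
  qed
  show ?thesis
    by (rule H10_I(1)[OF t(1) lim[OF _ s(2) t(2)] lim[OF _ p(2) t3]])
      (simp_all add: t(1) test_functions_L2 test_functions_partial_L2)
qed

lemma H10_lincomb:
  assumes u: "u \<in> H10_space Q" and v: "v \<in> H10_space Q"
  shows "(\<lambda>x. a * u x + c * v x) \<in> H10_space Q"
proof -
  obtain s where s: "\<And>m. s m \<in> test_functions Q" "L2_lim Q s u"
    "\<And>i. L2_lim Q (\<lambda>m. partial_deriv i (s m)) (weak_partial Q i u)"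
    using H10_seq[OF u] by metis
  obtain t where t: "\<And>m. t m \<in> test_functions Q" "L2_lim Q t v"
    "\<And>i. L2_lim Q (\<lambda>m. partial_deriv i (t m)) (weak_partial Q i v)"
    using H10_seq[OF v] by metis
  show ?thesis
  proof (rule H10_I(1))
    show "(\<lambda>x. a * s m x + c * t m x) \<in> test_functions Q" for m
      by (rule test_functions_lincomb[OF s(1) t(1)])
    show "L2_lim Q (\<lambda>m x. a * s m x + c * t m x) (\<lambda>x. a * u x + c * v x)"
      by (intro L2_lim_add L2_lim_scale s t)
    show "L2_lim Q (\<lambda>m. partial_deriv i (\<lambda>x. a * s m x + c * t m x))
        (\<lambda>x. a * weak_partial Q i u x + c * weak_partial Q i v x)" for i
      unfolding partial_deriv_lincomb[OF test_functions_smooth[OF s(1)] test_functions_smooth[OF t(1)]]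
      by (intro L2_lim_add L2_lim_scale s t)
  qed
qed

text \<open>For test functions the identity defines the weak derivative of \<open>w\<close>, and
  \<open>z\<close> is a limit of test functions, so no boundary term appears. Nothing is imposed on
  \<open>w\<close> at the boundary, so \<open>w\<close> may be a cosine.\<close>

lemma H10_weak_ibp:
  assumes z: "z \<in> H10_space Q" and w: "has_weak_partial Q i w g"
  shows "L2_inner Q w (weak_partial Q i z) = - L2_inner Q g z"
proof -
  obtain s where s: "\<And>m. s m \<in> test_functions Q" "L2_lim Q s z"
    "\<And>i. L2_lim Q (\<lambda>m. partial_deriv i (s m)) (weak_partial Q i z)"
    using H10_seq[OF z] by metis
  have "(\<lambda>m. L2_inner Q (partial_deriv i (s m)) w) \<longlonglongrightarrow> L2_inner Q (weak_partial Q i z) w"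
    by (rule L2_lim_inner[OF s(3) has_weak_partialD(1)[OF w]])
  moreover have "(\<lambda>m. - L2_inner Q (s m) g) \<longlonglongrightarrow> - L2_inner Q z g"
    by (intro tendsto_minus L2_lim_inner[OF s(2) has_weak_partialD(2)[OF w]])
  moreover have "L2_inner Q (partial_deriv i (s m)) w = - L2_inner Q (s m) g" for m
    using has_weak_partialD(3)[OF w s(1)] by (simp add: L2_inner_commute)
  ultimately show ?thesis by (simp add: LIMSEQ_unique L2_inner_commute)
qed

section \<open>The trigonometric system\<close>

text \<open>Fubini: Lebesgue measure is the image of the product measure over the basis vectors, and
  the indicator of the cube is itself a product, absorbed here into the factors
  \<open>H i\<close>.\<close>

lemma integral_tensor:
  fixes h :: "'n::finite \<Rightarrow> real \<Rightarrow> real"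
  assumes I: "\<And>i. has_bochner_integral lborel (\<lambda>t. indicator {0<..<1} t * h i t) (J i)"
    and cont: "\<And>i. continuous_on UNIV (h i)"
  shows "(LINT x|lebesgue_on Q. tensor h x) = (\<Prod>i\<in>UNIV. J i)"
proof -
  interpret product_sigma_finite "\<lambda>_::real^'n. lborel :: real measure"
    by standard
  define H where "H i t = indicator {0<..<1} t * h i t" for i t
  have Hi: "integrable lborel (H i)" and HJ: "(LINT t|lborel. H i t) = J i" for i
    using I[of i] by (auto simp: H_def[abs_def] has_bochner_integral_iff)
  have [measurable]: "h i \<in> borel_measurable borel" for i
    using cont by (rule borel_measurable_continuous_onI)
  have [measurable]: "H i \<in> borel_measurable borel" for i unfolding H_def by measurable
  have [measurable]: "tensor h \<in> borel_measurable borel" unfolding tensor_def by measurable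
  have [measurable]: "tensor H \<in> borel_measurable borel" unfolding tensor_def by measurable
  have Basis: "(Basis :: (real^'n) set) = (\<lambda>i. axis i 1) ` UNIV" by (auto simp: Basis_vec_def)
  have inj: "inj_on (\<lambda>i::'n. axis i (1::real)) UNIV" by (auto simp: inj_on_def axis_eq_axis)
  have "(LINT x|lebesgue_on Q. tensor h x) = (LINT x|lborel. indicator Q x * tensor h x)"
    by (rule integral_unit_cube_lborel) measurable
  also have "indicator Q x * tensor h x = tensor H x" for x
  proof -
    have "(\<Prod>i\<in>UNIV. indicator {0<..<1} (x $ i)) = (indicator Q x :: real)"
      by (auto simp: indicator_def unit_cube_def)
    then show ?thesis by (simp add: tensor_def H_def prod.distrib)
  qed
  then have "(LINT x|lborel. indicator Q x * tensor h x) = (LINT x|lborel. tensor H x)" by simp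
  also have "\<dots> = (LINT x|distr (Pi\<^sub>M (Basis :: (real^'n) set) (\<lambda>_. lborel)) borel (\<lambda>f. \<Sum>b\<in>Basis. f b *\<^sub>R b). tensor H x)"
    by (subst lborel_eq) (rule refl)
  also have "\<dots> = (LINT f|Pi\<^sub>M (Basis :: (real^'n) set) (\<lambda>_. lborel). tensor H (\<Sum>b\<in>Basis. f b *\<^sub>R b))"
    by (rule integral_distr) measurable
  also have "tensor H (\<Sum>b\<in>Basis. f b *\<^sub>R b) = (\<Prod>b\<in>Basis. H (axis_index b) (f b))" for f
  proof -
    have "(\<Sum>b\<in>Basis. f b *\<^sub>R b) $ i = (\<Sum>j\<in>UNIV. f (axis j 1) * (if j = i then 1 else 0))" for i :: 'n
      unfolding Basis sum.reindex[OF inj] sum_component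
      by (intro sum.cong) (auto simp: axis_def)
    moreover have "(\<Sum>j\<in>UNIV. f (axis j 1) * (if j = i then 1 else 0)) = f (axis i 1)" for i :: 'n by (simp add: if_distrib cong: if_cong)
    ultimately have "(\<Sum>b\<in>Basis. f b *\<^sub>R b) $ i = f (axis i 1)" for i :: 'n by simp
    then show ?thesis by (simp add: tensor_def Basis prod.reindex[OF inj] axis_index_axis)
  qed
  then have "(LINT f|Pi\<^sub>M (Basis :: (real^'n) set) (\<lambda>_. lborel). tensor H (\<Sum>b\<in>Basis. f b *\<^sub>R b))
      = (LINT f|Pi\<^sub>M (Basis :: (real^'n) set) (\<lambda>_. lborel). (\<Prod>b\<in>Basis. H (axis_index b) (f b)))" by simp
  also have "\<dots> = (\<Prod>b\<in>(Basis :: (real^'n) set). LINT t|lborel. H (axis_index b) t)"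
    by (rule product_integral_prod) (auto simp: Hi)
  also have "\<dots> = (\<Prod>i\<in>UNIV. J i)"
    by (simp add: Basis prod.reindex[OF inj] axis_index_axis HJ)
  finally show ?thesis .
qed

text \<open>An integer \<open>m\<close> covers both the difference and the sum of two frequencies.
  For nonzero \<open>m\<close> the antiderivative is a multiple of a sine that vanishes at both ends
  of the interval.\<close>

lemma integral_cos_pi_int:
  "has_bochner_integral lborel (\<lambda>t. indicator {0<..<1} t * cos (pi * of_int m * t)) (if m = 0 then 1 else 0)"
proof -
  define S where "S t = (if m = 0 then t else sin (pi * of_int m * t) / (pi * of_int m))" for t :: real
  have "(S has_vector_derivative cos (pi * of_int m * t)) (at t within {0..1})" for t
  proof (cases "m = 0")
    case False
    then have "((\<lambda>t. sin (pi * of_int m * t) / (pi * of_int m)) has_real_derivative cos (pi * of_int m * t)) (at t)"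
      by (auto intro!: derivative_eq_intros)
    then show ?thesis using False
      by (simp add: S_def[abs_def] has_real_derivative_iff_has_vector_derivative has_vector_derivative_at_within)
  qed (simp add: S_def[abs_def])
  then have "has_bochner_integral lborel (\<lambda>t. indicator {0..1} t *\<^sub>R cos (pi * of_int m * t)) (S 1 - S 0)"
    by (intro has_bochner_integral_FTC_Icc) (auto intro!: continuous_intros)
  moreover have "sin (pi * of_int m) = 0" by (auto simp: sin_zero_iff_int2 mult.commute)
  then have "S 1 - S 0 = (if m = 0 then 1 else 0)" by (simp add: S_def)
  ultimately have "has_bochner_integral lborel (\<lambda>t. indicator {0..1} t * cos (pi * of_int m * t)) (if m = 0 then 1 else 0)"
    by simp
  then show ?thesis
  proof (subst has_bochner_integral_cong_AE)
    show "AE t in lborel. indicator {0<..<1} t * cos (pi * of_int m * t)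
        = indicator {0..1} t * cos (pi * of_int m * t)"
      using AE_lborel_singleton[of 0] AE_lborel_singleton[of "1::real"]
      by eventually_elim (auto simp: indicator_def)
  qed auto
qed

text \<open>\<open>True\<close> stands for cosine and \<open>False\<close> for sine, so that
  differentiation negates the flag. The factor \<open>sqrt 2\<close> normalises on the unit interval
  for positive frequencies.\<close>

definition trig1 :: "bool \<Rightarrow> nat \<Rightarrow> real \<Rightarrow> real" where
  "trig1 s k t = sqrt 2 * (if s then cos (pi * real k * t) else sin (pi * real k * t))"

lemma trig1_smooth1: "smooth1 (trig1 s k)"
  using smooth1_sin_cos[of "sqrt 2" "pi * real k" 0] smooth1_sin_cos[of 0 "pi * real k" "sqrt 2"]
  by (cases s) (simp_all add: trig1_def[abs_def])

lemma trig1_deriv: "deriv (trig1 s k) t = (if s then - 1 else 1) * (pi * real k) * trig1 (\<not> s) k t"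
  unfolding trig1_def[abs_def] by (rule DERIV_imp_deriv) (auto intro!: derivative_eq_intros)

lemma trig1_bound: "\<bar>trig1 s k t\<bar> \<le> sqrt 2"
  by (auto simp: trig1_def abs_mult mult_left_le)

text \<open>The product formulas leave cosines of frequencies \<open>k - l\<close> and
  \<open>k + l\<close>. Frequencies start at 1, so the sum is never 0, and sines and cosines are
  orthonormal alike.\<close>

lemma trig1_orthonormal:
  assumes "1 \<le> k" "1 \<le> l"
  shows "has_bochner_integral lborel (\<lambda>t. indicator {0<..<1} t * (trig1 s k t * trig1 s l t)) (if k = l then 1 else 0)"
proof -
  let ?m = "int k - int l" and ?p = "int k + int l"
  note m = integral_cos_pi_int[of ?m] and p = integral_cos_pi_int[of ?p]
  have p0: "?p \<noteq> 0" using assms by simp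
  have eq: "trig1 s k t * trig1 s l t = cos (pi * of_int ?m * t) + (if s then 1 else - 1) * cos (pi * of_int ?p * t)" for t
    by (simp add: trig1_def cos_add cos_diff ring_distribs)
  have "has_bochner_integral lborel (\<lambda>t. indicator {0<..<1} t * cos (pi * of_int ?m * t)
      + (if s then 1 else - 1) * (indicator {0<..<1} t * cos (pi * of_int ?p * t)))
      ((if ?m = 0 then 1 else 0) + (if s then 1 else - 1) * (if ?p = 0 then 1 else 0))"
    by (intro has_bochner_integral_add has_bochner_integral_mult_right m p)
  then show ?thesis using p0 unfolding eq by (simp add: ring_distribs mult.left_commute)
qed

definition trig :: "('n \<Rightarrow> bool) \<Rightarrow> ('n \<Rightarrow> nat) \<Rightarrow> real^'n \<Rightarrow> real" where
  "trig \<sigma> k = tensor (\<lambda>i. trig1 (\<sigma> i) (k i))"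

lemma continuous_on_trig: "continuous_on S (trig \<sigma> k)"
  unfolding trig_def by (rule continuous_on_tensor) (rule trig1_smooth1)

lemma trig_L2 [simp]: "trig \<sigma> k \<in> L2_space Q"
  by (rule continuous_L2) (rule continuous_on_trig)

lemma tensor_mult: "tensor h x * tensor g x = tensor (\<lambda>i t. h i t * g i t) x"
  by (simp add: tensor_def prod.distrib)

lemma trig_orthonormal:
  fixes k l :: "'n::finite \<Rightarrow> nat"
  assumes "\<And>i. 1 \<le> k i" "\<And>i. 1 \<le> l i"
  shows "L2_inner Q (trig \<sigma> k) (trig \<sigma> l) = (if k = l then 1 else 0)"
proof -
  have "L2_inner Q (trig \<sigma> k) (trig \<sigma> l) = (\<Prod>i\<in>UNIV. if k i = l i then 1 else 0)"
    unfolding L2_inner_def trig_def tensor_mult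
    by (intro integral_tensor trig1_orthonormal assms continuous_on_mult smooth1_continuous trig1_smooth1)
  also have "\<dots> = (if k = l then 1 else 0)" by (auto simp: fun_eq_iff)
  finally show ?thesis .
qed

definition flip :: "('n \<Rightarrow> bool) \<Rightarrow> 'n \<Rightarrow> 'n \<Rightarrow> bool" where
  "flip \<sigma> i = \<sigma>(i := \<not> \<sigma> i)"

text \<open>Differentiating a cosine costs a sign, so two derivatives in the same coordinate give
  -(\<pi> k_i)^2 from either start.\<close>

definition dcoef :: "('n \<Rightarrow> bool) \<Rightarrow> 'n \<Rightarrow> ('n \<Rightarrow> nat) \<Rightarrow> real" where
  "dcoef \<sigma> i k = (if \<sigma> i then - 1 else 1) * (pi * real (k i))"

lemma partial_deriv_trig:
  fixes k :: "'n::finite \<Rightarrow> nat"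
  shows "partial_deriv i (trig \<sigma> k) = (\<lambda>x. dcoef \<sigma> i k * trig (flip \<sigma> i) k x)"
proof
  fix x :: "real^'n"
  have "partial_deriv i (trig \<sigma> k) x = tensor ((\<lambda>i. trig1 (\<sigma> i) (k i))(i := deriv (trig1 (\<sigma> i) (k i)))) x"
    unfolding trig_def by (subst partial_deriv_tensor) (auto intro: trig1_smooth1)
  also have "\<dots> = dcoef \<sigma> i k * (trig1 (\<not> \<sigma> i) (k i) (x $ i) * (\<Prod>j\<in>UNIV - {i}. trig1 (\<sigma> j) (k j) (x $ j)))"
    by (simp add: tensor_upd trig1_deriv dcoef_def)
  also have "trig1 (\<not> \<sigma> i) (k i) (x $ i) * (\<Prod>j\<in>UNIV - {i}. trig1 (\<sigma> j) (k j) (x $ j))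
      = tensor ((\<lambda>i. trig1 (\<sigma> i) (k i))(i := trig1 (\<not> \<sigma> i) (k i))) x"
    by (rule tensor_upd[symmetric])
  also have "(\<lambda>i. trig1 (\<sigma> i) (k i))(i := trig1 (\<not> \<sigma> i) (k i)) = (\<lambda>j. trig1 (flip \<sigma> i j) (k j))"
    by (auto simp: flip_def)
  finally show "partial_deriv i (trig \<sigma> k) x = dcoef \<sigma> i k * trig (flip \<sigma> i) k x"
    by (simp add: trig_def)
qed

lemma trig_has_weak_partial:
  "has_weak_partial Q i (trig \<sigma> k) (\<lambda>x. dcoef \<sigma> i k * trig (flip \<sigma> i) k x)"
proof -
  have "trig \<sigma> k differentiable at x" for x
    unfolding trig_def by (rule tensor_differentiable) (rule trig1_smooth1)
  moreover have "continuous_on UNIV (partial_deriv i (trig \<sigma> k))"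
    unfolding partial_deriv_trig by (intro continuous_intros continuous_on_trig)
  ultimately show ?thesis
    using C1_has_weak_partial[of "trig \<sigma> k" i] by (simp add: partial_deriv_trig)
qed

section \<open>Products of sines have zero boundary values\<close>

lemma L2_lim_dominated:
  assumes s: "\<And>m. s m \<in> borel_measurable (lebesgue_on Q)"
    and u: "u \<in> borel_measurable (lebesgue_on Q)"
    and B: "\<And>m x. x \<in> Q \<Longrightarrow> \<bar>s m x\<bar> \<le> B"
    and lim: "\<And>x. x \<in> Q \<Longrightarrow> (\<lambda>m. s m x) \<longlonglongrightarrow> u x"
  shows "L2_lim Q s u"
proof -
  let ?M = "lebesgue_on (Q :: (real^'a) set)"
  interpret finite_measure ?M by (rule finite_measure_unit_cube)
  note [measurable] = s u
  have uB: "\<bar>u x\<bar> \<le> B" if "x \<in> Q" for x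
    using tendsto_rabs[OF lim[OF that]] B[OF that] by (intro LIMSEQ_le_const2) auto
  have "(\<lambda>m. LINT x|?M. (s m x - u x) * (s m x - u x)) \<longlonglongrightarrow> (LINT x|?M. 0)"
  proof (rule integral_dominated_convergence[where w="\<lambda>x. (B + B) * (B + B)"])
    show "AE x in ?M. (\<lambda>m. (s m x - u x) * (s m x - u x)) \<longlonglongrightarrow> 0"
    proof (rule AE_I2)
      fix x assume "x \<in> space ?M"
      then have "(\<lambda>m. (s m x - u x) * (s m x - u x)) \<longlonglongrightarrow> (u x - u x) * (u x - u x)"
        by (intro tendsto_intros lim) simp_all
      then show "(\<lambda>m. (s m x - u x) * (s m x - u x)) \<longlonglongrightarrow> 0" by simp
    qed
    show "AE x in ?M. norm ((s m x - u x) * (s m x - u x)) \<le> (B + B) * (B + B)" for m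
    proof (rule AE_I2)
      fix x assume "x \<in> space ?M"
      then have "\<bar>s m x - u x\<bar> \<le> B + B" using B[of x m] uB[of x] by simp
      then show "norm ((s m x - u x) * (s m x - u x)) \<le> (B + B) * (B + B)"
        unfolding real_norm_def abs_mult by (intro mult_mono) auto
    qed
  qed auto
  then have "(\<lambda>m. L2_norm Q (\<lambda>x. s m x - u x)) \<longlonglongrightarrow> 0"
    unfolding L2_norm_def L2_inner_def using tendsto_real_sqrt by fastforce
  then show ?thesis using L2_bounded[OF s B] L2_bounded[OF u uB] by (simp add: L2_lim_def)
qed

text \<open>With y = 1/s the expression becomes (y + y^2) exp(-y). The bound 3 is 1 + 2, from exp y
  >= y and 2 exp y >= y^2. For s = m t - 1 the weight s + 1 is m t, the form in which the estimate
  is applied.\<close>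

lemma bump_deriv_decay:
  assumes "s > 0"
  shows "\<bar>(s + 1) * deriv bump s\<bar> \<le> 3" "\<bar>(s + 1) * deriv bump s\<bar> \<le> 1 / s + (1 / s)\<^sup>2"
proof -
  define y where "y = 1 / s"
  have y: "y > 0" using assms by (simp add: y_def)
  have eq: "(s + 1) * deriv bump s = exp (- y) * y + exp (- y) * y\<^sup>2"
    using assms by (simp add: bump_deriv y_def field_simps power2_eq_square)
  have "exp y \<ge> 1 + y + y\<^sup>2 / 2" using y by (intro exp_lower_Taylor_quadratic) simp
  then have e: "exp y \<ge> y" "2 * exp y \<ge> y\<^sup>2" using y by (auto intro: order_trans[rotated])
  have "exp (- y) * y \<le> 1" "exp (- y) * y\<^sup>2 \<le> 2"
    using e by (auto simp: exp_minus field_simps)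
  then show "\<bar>(s + 1) * deriv bump s\<bar> \<le> 3" unfolding eq using y by simp
  have nn: "0 \<le> exp (- y) * y" "0 \<le> exp (- y) * y\<^sup>2" using y by simp_all
  have "exp (- y) * y \<le> y" "exp (- y) * y\<^sup>2 \<le> y\<^sup>2"
    using y by (auto intro!: mult_left_le_one_le)
  then show "\<bar>(s + 1) * deriv bump s\<bar> \<le> 1 / s + (1 / s)\<^sup>2"
    unfolding eq y_def[symmetric] using nn by linarith
qed

lemma scaled_bump_deriv:
  assumes t: "t > 0"
  shows "\<bar>t * (real m * deriv bump (real m * t - 1))\<bar> \<le> 3"
    and "(\<lambda>m. t * (real m * deriv bump (real m * t - 1))) \<longlonglongrightarrow> 0"
proof -
  have eq: "t * (real m * deriv bump (real m * t - 1)) = ((real m * t - 1) + 1) * deriv bump (real m * t - 1)" for m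
    by simp
  have 0: "deriv bump s = 0" if "s \<le> 0" for s using that by (simp add: bump_deriv)
  show "\<bar>t * (real m * deriv bump (real m * t - 1))\<bar> \<le> 3" for m
    unfolding eq using bump_deriv_decay(1)[of "real m * t - 1"] 0[of "real m * t - 1"]
    by (cases "real m * t - 1 > 0") auto
  have lim: "filterlim (\<lambda>m. real m * t - 1) at_top sequentially"
    using filterlim_tendsto_add_at_top[OF tendsto_const[of "- 1"]
        filterlim_tendsto_pos_mult_at_top[OF tendsto_const t filterlim_real_sequentially]]
    by (simp add: mult.commute)
  have "((\<lambda>s. (s + 1) * deriv bump s) \<longlongrightarrow> 0) at_top"
  proof (rule Lim_null_comparison)
    show "\<forall>\<^sub>F s in at_top. norm ((s + 1) * deriv bump s) \<le> 1 / s + (1 / s)\<^sup>2"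
      using eventually_gt_at_top[of 0] by eventually_elim (use bump_deriv_decay(2) in simp)
    have "((\<lambda>s::real. 1 / s + (1 / s)\<^sup>2) \<longlongrightarrow> 0 + 0\<^sup>2) at_top"
      by (intro tendsto_add tendsto_power tendsto_divide_0[OF tendsto_const]
          filterlim_at_top_imp_at_infinity filterlim_ident)
    then show "((\<lambda>s::real. 1 / s + (1 / s)\<^sup>2) \<longlongrightarrow> 0) at_top" by simp
  qed
  from filterlim_compose[OF this lim]
  show "(\<lambda>m. t * (real m * deriv bump (real m * t - 1))) \<longlonglongrightarrow> 0" unfolding eq .
qed

definition cut :: "nat \<Rightarrow> real \<Rightarrow> real" where
  "cut m t = bump (real m * (t - 0) - 1) * bump (real m * (1 - t) - 1)"

lemma cut_smooth1: "smooth1 (cut m)"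
  unfolding cut_def[abs_def] by (rule smooth1_cutoff)

lemma cut_bound: "\<bar>cut m t\<bar> \<le> 1"
  by (auto simp: cut_def abs_mult intro!: mult_le_one)

lemma cut_tendsto: "0 < t \<Longrightarrow> t < 1 \<Longrightarrow> (\<lambda>m. cut m t) \<longlonglongrightarrow> 1"
  using tendsto_mult[OF bump_tendsto_1[of "t - 0"] bump_tendsto_1[of "1 - t"]] by (simp add: cut_def)

lemma cut_deriv: "deriv (cut m) t = real m * deriv bump (real m * t - 1) * bump (real m * (1 - t) - 1)
    - bump (real m * t - 1) * (real m * deriv bump (real m * (1 - t) - 1))"
proof -
  have 1: "((\<lambda>t. bump (real m * (t - 0) - 1)) has_real_derivative deriv bump (real m * (t - 0) - 1) * real m) (at t)"
    by (rule DERIV_chain2[OF smooth1_has_deriv[OF bump_smooth1]]) (auto intro!: derivative_eq_intros)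
  have 2: "((\<lambda>t. bump (real m * (1 - t) - 1)) has_real_derivative deriv bump (real m * (1 - t) - 1) * (- real m)) (at t)"
    by (rule DERIV_chain2[OF smooth1_has_deriv[OF bump_smooth1]]) (auto intro!: derivative_eq_intros)
  show ?thesis unfolding cut_def[abs_def]
    by (rule DERIV_imp_deriv) (use DERIV_mult[OF 1 2] in \<open>simp add: algebra_simps\<close>)
qed

text \<open>A sine of integer frequency vanishes at both ends of the unit interval and has Lipschitz
  constant \<pi> k, so the distance to either end controls it.\<close>

lemma sin_pi_nat_bound:
  assumes "0 < t" "t < 1"
  shows "\<bar>sin (pi * real k * t)\<bar> \<le> pi * real k * t" "\<bar>sin (pi * real k * t)\<bar> \<le> pi * real k * (1 - t)"
proof -
  have le: "\<bar>sin x\<bar> \<le> x" if "0 \<le> x" for x :: real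
    using abs_sin_x_le_abs_x[of x] that by simp
  show "\<bar>sin (pi * real k * t)\<bar> \<le> pi * real k * t" using assms by (intro le) simp
  have "sin (pi * real k * t) = sin (real k * pi - pi * real k * (1 - t))" by (simp add: algebra_simps)
  also have "\<bar>\<dots>\<bar> = \<bar>sin (pi * real k * (1 - t))\<bar>" by (simp add: sin_diff abs_mult)
  finally show "\<bar>sin (pi * real k * t)\<bar> \<le> pi * real k * (1 - t)"
    using le[of "pi * real k * (1 - t)"] assms by simp
qed

text \<open>The slope of the cut-off is large only near an end, where the sine is small: the sine
  divided by the distance to an end is at most \<pi> k, and the distance times the scaled bump
  derivative is at most 3 and tends to 0. The two ends together give the constant 6.\<close>

lemma sin_cut_deriv:
  assumes t: "0 < t" "t < 1"
  shows "\<bar>sin (pi * real k * t) * deriv (cut m) t\<bar> \<le> 6 * (pi * real k)"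
    and "(\<lambda>m. sin (pi * real k * t) * deriv (cut m) t) \<longlonglongrightarrow> 0"
proof -
  let ?S = "sin (pi * real k * t)"
  define X where "X m = t * (real m * deriv bump (real m * t - 1))" for m
  define Y where "Y m = (1 - t) * (real m * deriv bump (real m * (1 - t) - 1))" for m
  have X: "\<bar>X m\<bar> \<le> 3" "X \<longlonglongrightarrow> 0" and Y: "\<bar>Y m\<bar> \<le> 3" "Y \<longlonglongrightarrow> 0" for m
    using scaled_bump_deriv[of t] scaled_bump_deriv[of "1 - t"] t by (auto simp: X_def[abs_def] Y_def[abs_def])
  have eq: "?S * deriv (cut m) t = (?S / t) * X m * bump (real m * (1 - t) - 1)
      - (?S / (1 - t)) * Y m * bump (real m * t - 1)" for m
    using t by (simp add: cut_deriv X_def Y_def field_simps)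
  have Sb: "\<bar>?S / t\<bar> \<le> pi * real k" "\<bar>?S / (1 - t)\<bar> \<le> pi * real k"
    using sin_pi_nat_bound[OF t, of k] t by (auto simp: field_simps)
  have b: "\<bar>a * Z * bump c\<bar> \<le> p * \<bar>Z\<bar>" if "\<bar>a\<bar> \<le> p" for a Z c p
    using mult_mono[OF mult_right_mono[OF that, of "\<bar>Z\<bar>"] bump_le_1[of c]] that by (simp add: abs_mult)
  have le: "\<bar>?S * deriv (cut m) t\<bar> \<le> (pi * real k) * \<bar>X m\<bar> + (pi * real k) * \<bar>Y m\<bar>" for m
    unfolding eq using b[OF Sb(1), of "X m" "real m * (1 - t) - 1"] b[OF Sb(2), of "Y m" "real m * t - 1"]
    by linarith
  also have "(pi * real k) * \<bar>X m\<bar> + (pi * real k) * \<bar>Y m\<bar> \<le> (pi * real k) * 3 + (pi * real k) * 3"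
    using X Y by (intro add_mono mult_left_mono) auto
  finally show "\<bar>?S * deriv (cut m) t\<bar> \<le> 6 * (pi * real k)" by simp
  show "(\<lambda>m. ?S * deriv (cut m) t) \<longlonglongrightarrow> 0"
  proof (rule Lim_null_comparison)
    show "\<forall>\<^sub>F m in sequentially. norm (?S * deriv (cut m) t) \<le> (pi * real k) * \<bar>X m\<bar> + (pi * real k) * \<bar>Y m\<bar>"
      using le by simp
    have "(\<lambda>m. (pi * real k) * \<bar>X m\<bar> + (pi * real k) * \<bar>Y m\<bar>) \<longlonglongrightarrow> (pi * real k) * \<bar>0\<bar> + (pi * real k) * \<bar>0\<bar>"
      by (intro tendsto_intros X Y)
    then show "(\<lambda>m. (pi * real k) * \<bar>X m\<bar> + (pi * real k) * \<bar>Y m\<bar>) \<longlonglongrightarrow> 0" by simp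
  qed
qed

lemma tensor_abs_bound:
  fixes h :: "'n::finite \<Rightarrow> real \<Rightarrow> real"
  assumes "\<And>i. \<bar>h i (x $ i)\<bar> \<le> B i"
  shows "\<bar>tensor h x\<bar> \<le> (\<Prod>i\<in>UNIV. B i)"
  unfolding tensor_def abs_prod using assms by (intro prod_mono) auto

text \<open>Each sine factor is multiplied by the cut-off of the unit interval. The resulting test
  functions and their first derivatives are bounded and converge pointwise on the cube, including
  the term in which the derivative falls on the cut-off, and so they converge in
  \<open>L\<^sup>2\<close>.\<close>

lemma trig_H10:
  fixes k :: "'n::finite \<Rightarrow> nat"
  shows "trig (\<lambda>_. False) k \<in> H10_space Q"
proof -
  define h where "h m i t = trig1 False (k i) t * cut m t" for m i t
  have hs: "smooth1 (h m i)" for m i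
    unfolding h_def[abs_def] by (intro smooth1_mult trig1_smooth1 cut_smooth1)
  have hd: "deriv (h m i) t = pi * real (k i) * trig1 True (k i) t * cut m t
      + sqrt 2 * (sin (pi * real (k i) * t) * deriv (cut m) t)" for m i t
    unfolding h_def[abs_def]
    using DERIV_mult[OF smooth1_has_deriv[OF trig1_smooth1[of False "k i"], of t] smooth1_has_deriv[OF cut_smooth1[of m], of t]]
    by (intro DERIV_imp_deriv) (simp add: trig1_deriv trig1_def mult_ac)
  have hb: "\<bar>h m i t\<bar> \<le> sqrt 2" for m i t
    unfolding h_def using mult_mono[OF trig1_bound[of False "k i" t] cut_bound[of m t]] by (simp add: abs_mult)
  have hdb: "\<bar>deriv (h m i) t\<bar> \<le> pi * real (k i) * sqrt 2 + sqrt 2 * (6 * (pi * real (k i)))"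
    if "0 < t" "t < 1" for m i t
  proof -
    have "\<bar>trig1 True (k i) t * cut m t\<bar> \<le> sqrt 2"
      using mult_mono[OF trig1_bound[of True "k i" t] cut_bound[of m t]] by (simp add: abs_mult)
    then have "\<bar>pi * real (k i) * (trig1 True (k i) t * cut m t)\<bar> \<le> pi * real (k i) * sqrt 2"
      by (simp add: abs_mult mult_left_mono)
    moreover have "\<bar>sqrt 2 * (sin (pi * real (k i) * t) * deriv (cut m) t)\<bar> \<le> sqrt 2 * (6 * (pi * real (k i)))"
      using sin_cut_deriv(1)[OF that, of "k i" m] by (simp add: abs_mult)
    moreover have "deriv (h m i) t = pi * real (k i) * (trig1 True (k i) t * cut m t)
        + sqrt 2 * (sin (pi * real (k i) * t) * deriv (cut m) t)" by (simp add: hd)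
    ultimately show ?thesis by linarith
  qed
  have hl: "(\<lambda>m. h m i t) \<longlonglongrightarrow> trig1 False (k i) t" if "0 < t" "t < 1" for i t
    unfolding h_def using tendsto_mult[OF tendsto_const cut_tendsto[OF that]] by simp
  have hdl: "(\<lambda>m. deriv (h m i) t) \<longlonglongrightarrow> pi * real (k i) * trig1 True (k i) t" if "0 < t" "t < 1" for i t
    unfolding hd
    using tendsto_add[OF tendsto_mult[OF tendsto_const[of "pi * real (k i) * trig1 True (k i) t"] cut_tendsto[OF that]]
        tendsto_mult[OF tendsto_const[of "sqrt 2"] sin_cut_deriv(2)[OF that, of "k i"]]] by simp
  have pd: "partial_deriv i (tensor (h m)) = tensor ((h m)(i := deriv (h m i)))" for i m
    by (rule partial_deriv_tensor) (rule hs)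
  show ?thesis
  proof (rule H10_I(1))
    \<comment> \<open>The index starts at 1: for \<open>m = 0\<close> the quantity
      \<open>1 / real m\<close> is 0 and leaves no margin.\<close>
    show "tensor (h (Suc m)) \<in> test_functions Q" for m
    proof (rule tensor_test_function[where m="Suc m" and a=0 and b=1])
      fix i t assume "h (Suc m) i t \<noteq> 0"
      then have "bump (real (Suc m) * (t - 0) - 1) \<noteq> 0" "bump (real (Suc m) * (1 - t) - 1) \<noteq> 0"
        by (auto simp: h_def cut_def)
      then have "real (Suc m) * (t - 0) > 1" "real (Suc m) * (1 - t) > 1"
        by (auto simp: bump_def split: if_splits)
      then show "(0::real^'n) $ i + 1 / real (Suc m) \<le> t \<and> t \<le> (1::real^'n) $ i - 1 / real (Suc m)"
        by (auto simp: field_simps)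
    qed (simp_all add: hs unit_cube_eq_box)
    show "L2_lim Q (\<lambda>m. tensor (h (Suc m))) (trig (\<lambda>_. False) k)"
    proof (rule L2_lim_dominated)
      show "\<bar>tensor (h (Suc m)) x\<bar> \<le> (\<Prod>i\<in>(UNIV::'n set). sqrt 2)" for m x
        by (rule tensor_abs_bound) (rule hb)
      show "(\<lambda>m. tensor (h (Suc m)) x) \<longlonglongrightarrow> trig (\<lambda>_. False) k x" if "x \<in> Q" for x
        unfolding trig_def tensor_def using that
        by (intro tendsto_prod LIMSEQ_Suc[OF hl]) (auto simp: unit_cube_def)
    qed (auto intro!: continuous_measurable_lebesgue_on continuous_on_trig continuous_on_tensor hs)
    show "L2_lim Q (\<lambda>m. partial_deriv i (tensor (h (Suc m))))
        (\<lambda>x. dcoef (\<lambda>_. False) i k * trig (flip (\<lambda>_. False) i) k x)" for i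
      unfolding partial_deriv_trig[symmetric]
    proof (rule L2_lim_dominated)
      show "partial_deriv i (tensor (h (Suc m))) \<in> borel_measurable (lebesgue_on Q)" for m
        by (intro continuous_measurable_lebesgue_on smooth_continuous_on smooth_partial_deriv smooth_tensor hs)
      show "partial_deriv i (trig (\<lambda>_. False) k) \<in> borel_measurable (lebesgue_on Q)"
        unfolding trig_def
        by (intro continuous_measurable_lebesgue_on smooth_continuous_on smooth_partial_deriv smooth_tensor trig1_smooth1)
      fix x :: "real^'n" assume x: "x \<in> Q"
      then have x01: "0 < x $ j" "x $ j < 1" for j by (auto simp: unit_cube_def)
      show "\<bar>partial_deriv i (tensor (h (Suc m))) x\<bar>
          \<le> (\<Prod>j\<in>UNIV. if j = i then pi * real (k i) * sqrt 2 + sqrt 2 * (6 * (pi * real (k i))) else sqrt 2)" for m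
        unfolding pd by (rule tensor_abs_bound) (use hb hdb x01 in auto)
      have "(\<lambda>m. deriv (h (Suc m) i) (x $ i) * (\<Prod>j\<in>UNIV - {i}. h (Suc m) j (x $ j)))
          \<longlonglongrightarrow> pi * real (k i) * trig1 True (k i) (x $ i) * (\<Prod>j\<in>UNIV - {i}. trig1 False (k j) (x $ j))"
        by (intro tendsto_mult tendsto_prod LIMSEQ_Suc[OF hl] LIMSEQ_Suc[OF hdl] x01)
      also have "pi * real (k i) * trig1 True (k i) (x $ i) * (\<Prod>j\<in>UNIV - {i}. trig1 False (k j) (x $ j))
          = partial_deriv i (trig (\<lambda>_. False) k) x"
        unfolding trig_def by (subst partial_deriv_tensor) (auto intro: trig1_smooth1 simp: tensor_upd trig1_deriv)
      finally show "(\<lambda>m. partial_deriv i (tensor (h (Suc m))) x) \<longlonglongrightarrow> partial_deriv i (trig (\<lambda>_. False) k) x"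
        unfolding pd tensor_upd .
    qed
  qed
qed

section \<open>Sine series and the Poisson problem\<close>

definition modes :: "nat \<Rightarrow> ('n::finite \<Rightarrow> nat) set" where
  "modes N = {k. \<forall>i. 1 \<le> k i \<and> k i \<le> N}"

lemma finite_modes [simp]: "finite (modes N :: ('n::finite \<Rightarrow> nat) set)"
proof -
  have "modes N = PiE (UNIV :: 'n set) (\<lambda>_. {1..N})" by (auto simp: modes_def PiE_def Pi_def)
  moreover have "finite (PiE (UNIV :: 'n set) (\<lambda>_. {1..N}))" by (rule finite_PiE) auto
  ultimately show ?thesis by (simp only:)
qed

lemma modes_mono: "M \<le> N \<Longrightarrow> modes M \<subseteq> modes N"
  by (auto simp: modes_def intro: order_trans)

lemma modes_pos: "k \<in> modes N \<Longrightarrow> 1 \<le> k i"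
  by (simp add: modes_def)

lemma eventually_modes:
  assumes "\<And>i. 1 \<le> k i"
  shows "\<forall>\<^sub>F N in sequentially. k \<in> modes N"
proof (rule eventually_sequentiallyI)
  fix N assume "(\<Sum>i\<in>UNIV. k i) \<le> N"
  then show "k \<in> modes N"
    using assms member_le_sum[of _ UNIV k] by (auto simp: modes_def intro: order_trans)
qed

definition fsum :: "('n::finite \<Rightarrow> bool) \<Rightarrow> (('n \<Rightarrow> nat) \<Rightarrow> real) \<Rightarrow> nat \<Rightarrow> real^'n \<Rightarrow> real" where
  "fsum \<sigma> c N x = (\<Sum>k\<in>modes N. c k * trig \<sigma> k x)"

lemma trig_sum_L2: "(\<lambda>x. \<Sum>k\<in>F. c k * trig \<sigma> k x) \<in> L2_space Q"
  by (intro L2_sum L2_scale trig_L2)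

lemma fsum_L2: "fsum \<sigma> c N \<in> L2_space Q"
  unfolding fsum_def[abs_def] by (rule trig_sum_L2)

lemma trig_sum_inner:
  assumes "finite F" "\<And>k i. k \<in> F \<Longrightarrow> 1 \<le> k i" "\<And>i. 1 \<le> l i"
  shows "L2_inner Q (\<lambda>x. \<Sum>k\<in>F. c k * trig \<sigma> k x) (trig \<sigma> l) = (if l \<in> F then c l else 0)"
proof -
  have "L2_inner Q (\<lambda>x. \<Sum>k\<in>F. c k * trig \<sigma> k x) (trig \<sigma> l)
      = (\<Sum>k\<in>F. c k * L2_inner Q (trig \<sigma> k) (trig \<sigma> l))"
    by (simp add: L2_inner_sum_left L2_scale L2_inner_scale_left)
  also have "\<dots> = (\<Sum>k\<in>F. if k = l then c k else 0)"
    using assms by (intro sum.cong) (auto simp: trig_orthonormal)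
  also have "\<dots> = (if l \<in> F then c l else 0)" using assms(1) by simp
  finally show ?thesis .
qed

lemma trig_sum_norm:
  assumes "finite F" "\<And>k i. k \<in> F \<Longrightarrow> 1 \<le> k i"
  shows "(L2_norm Q (\<lambda>x. \<Sum>k\<in>F. c k * trig \<sigma> k x))\<^sup>2 = (\<Sum>k\<in>F. (c k)\<^sup>2)"
proof -
  have "(L2_norm Q (\<lambda>x. \<Sum>k\<in>F. c k * trig \<sigma> k x))\<^sup>2
      = (\<Sum>l\<in>F. L2_inner Q (\<lambda>x. \<Sum>k\<in>F. c k * trig \<sigma> k x) (\<lambda>x. c l * trig \<sigma> l x))"
    unfolding L2_norm_power2 by (rule L2_inner_sum_right) (intro L2_scale trig_L2 trig_sum_L2)+
  also have "\<dots> = (\<Sum>l\<in>F. c l * c l)"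
    using assms by (intro sum.cong) (auto simp: L2_inner_scale_right trig_sum_inner)
  finally show ?thesis by (simp add: power2_eq_square)
qed

text \<open>By Parseval the squared distance of two partial sums is the difference of two sums of
  squared coefficients, and these form a bounded increasing, hence Cauchy, sequence.\<close>

lemma fsum_converges:
  assumes bound: "\<And>N. (\<Sum>k\<in>modes N. (c k)\<^sup>2) \<le> C"
  shows "\<exists>v. L2_lim Q (fsum \<sigma> c) v"
proof (rule L2_complete[OF finite_measure_unit_cube fsum_L2])
  define a where "a N = (\<Sum>k\<in>modes N. (c k)\<^sup>2)" for N
  have dist: "(L2_norm Q (\<lambda>x. fsum \<sigma> c m x - fsum \<sigma> c n x))\<^sup>2 = a m - a n" if "n \<le> m" for m n
  proof -
    have "fsum \<sigma> c m x - fsum \<sigma> c n x = (\<Sum>k\<in>modes m - modes n. c k * trig \<sigma> k x)" for x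
      unfolding fsum_def using modes_mono[OF that] by (subst sum_diff) auto
    moreover have "(L2_norm Q (\<lambda>x. \<Sum>k\<in>modes m - modes n. c k * trig \<sigma> k x))\<^sup>2
        = (\<Sum>k\<in>modes m - modes n. (c k)\<^sup>2)"
      by (rule trig_sum_norm) (use modes_pos in auto)
    ultimately have "(L2_norm Q (\<lambda>x. fsum \<sigma> c m x - fsum \<sigma> c n x))\<^sup>2 = (\<Sum>k\<in>modes m - modes n. (c k)\<^sup>2)"
      by simp
    also have "\<dots> = a m - a n" unfolding a_def using modes_mono[OF that] by (subst sum_diff) auto
    finally show ?thesis .
  qed
  have dist2: "(L2_norm Q (\<lambda>x. fsum \<sigma> c m x - fsum \<sigma> c n x))\<^sup>2 = \<bar>a m - a n\<bar>" for m n
  proof (cases "n \<le> m")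
    case True
    have "0 \<le> a m - a n" using dist[OF True, symmetric] by simp
    then show ?thesis using dist[OF True] by simp
  next
    case False
    then have *: "m \<le> n" by simp
    have "0 \<le> a n - a m" using dist[OF *, symmetric] by simp
    moreover have "L2_norm Q (\<lambda>x. fsum \<sigma> c m x - fsum \<sigma> c n x) = L2_norm Q (\<lambda>x. fsum \<sigma> c n x - fsum \<sigma> c m x)"
      using L2_norm_minus[of Q "\<lambda>x. fsum \<sigma> c m x - fsum \<sigma> c n x"] by simp
    ultimately show ?thesis using dist[OF *] by simp
  qed
  have "incseq a" unfolding a_def by (intro monoI sum_mono2) (auto dest: modes_mono)
  moreover have "\<forall>N. a N \<le> C" using bound by (simp add: a_def)
  ultimately obtain L where "a \<longlonglongrightarrow> L" by (rule incseq_convergent)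
  then have cau: "Cauchy a" by (rule LIMSEQ_imp_Cauchy)
  fix e :: real assume e: "0 < e"
  obtain M where M: "\<And>m n. m \<ge> M \<Longrightarrow> n \<ge> M \<Longrightarrow> \<bar>a m - a n\<bar> < e\<^sup>2"
    using CauchyD[OF cau, of "e\<^sup>2"] e by auto
  have "L2_norm Q (\<lambda>x. fsum \<sigma> c m x - fsum \<sigma> c n x) < e" if "m \<ge> M" "n \<ge> M" for m n
    using M[OF that] e unfolding dist2[symmetric] by (simp add: power2_less_imp_less)
  then show "\<exists>N. \<forall>m\<ge>N. \<forall>k\<ge>N. L2_norm Q (\<lambda>x. fsum \<sigma> c m x - fsum \<sigma> c k x) < e" by blast
qed

lemma fsum_lim_coeff:
  assumes "L2_lim Q (fsum \<sigma> c) v" "\<And>i. 1 \<le> l i"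
  shows "L2_inner Q v (trig \<sigma> l) = c l"
proof (rule LIMSEQ_unique)
  show "(\<lambda>N. L2_inner Q (fsum \<sigma> c N) (trig \<sigma> l)) \<longlonglongrightarrow> L2_inner Q v (trig \<sigma> l)"
    using assms(1) trig_L2 by (rule L2_lim_inner)
  show "(\<lambda>N. L2_inner Q (fsum \<sigma> c N) (trig \<sigma> l)) \<longlonglongrightarrow> c l"
  proof (rule tendsto_eventually)
    have *: "L2_inner Q (fsum \<sigma> c N) (trig \<sigma> l) = (if l \<in> modes N then c l else 0)" for N
      unfolding fsum_def[abs_def] by (rule trig_sum_inner) (use modes_pos assms(2) in auto)
    show "\<forall>\<^sub>F N in sequentially. L2_inner Q (fsum \<sigma> c N) (trig \<sigma> l) = c l"
      using eventually_modes[of l, OF assms(2)] by eventually_elim (simp add: *)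
  qed
qed

lemma fsum_lim_norm:
  assumes "L2_lim Q (fsum \<sigma> c) v"
  shows "(\<lambda>N. \<Sum>k\<in>modes N. (c k)\<^sup>2) \<longlonglongrightarrow> (L2_norm Q v)\<^sup>2"
proof -
  have "(L2_norm Q (fsum \<sigma> c N))\<^sup>2 = (\<Sum>k\<in>modes N. (c k)\<^sup>2)" for N
    unfolding fsum_def[abs_def] using modes_pos by (intro trig_sum_norm) auto
  then show ?thesis using tendsto_power[OF L2_lim_norm[OF assms], of 2] by simp
qed

lemma bessel_inequality:
  assumes g: "g \<in> L2_space Q"
  shows "(\<Sum>k\<in>modes N. (L2_inner Q g (trig \<sigma> k))\<^sup>2) \<le> (L2_norm Q g)\<^sup>2"
proof -
  define c where "c k = L2_inner Q g (trig \<sigma> k)" for k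
  let ?s = "fsum \<sigma> c N"
  note s = fsum_L2[of \<sigma> c N]
  have gs: "L2_inner Q g ?s = (\<Sum>k\<in>modes N. (c k)\<^sup>2)"
    unfolding fsum_def[abs_def]
    by (subst L2_inner_sum_right) (auto simp: g L2_scale L2_inner_scale_right c_def power2_eq_square)
  have ss: "L2_inner Q ?s ?s = (\<Sum>k\<in>modes N. (c k)\<^sup>2)"
    unfolding L2_norm_power2[symmetric] unfolding fsum_def[abs_def] using modes_pos by (intro trig_sum_norm) auto
  have "0 \<le> L2_inner Q (\<lambda>x. g x - ?s x) (\<lambda>x. g x - ?s x)" by simp
  also have "\<dots> = (L2_norm Q g)\<^sup>2 - (\<Sum>k\<in>modes N. (c k)\<^sup>2)"
    using gs ss L2_inner_commute[of Q ?s g]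
    by (simp add: L2_inner_diff_left[OF g s L2_diff[OF g s]] L2_inner_diff_right[OF g s g]
        L2_inner_diff_right[OF g s s] L2_norm_power2)
  finally show ?thesis by (simp add: c_def)
qed

text \<open>Term-by-term differentiation, legitimate by closedness once the differentiated series
  converges; that series lives in the system \<open>flip \<sigma> i\<close>.\<close>

lemma fsum_has_weak_partial:
  assumes "L2_lim Q (fsum \<sigma> c) u" "L2_lim Q (fsum (flip \<sigma> i) (\<lambda>k. dcoef \<sigma> i k * c k)) g"
  shows "has_weak_partial Q i u g"
proof (rule has_weak_partial_lim[OF _ assms])
  show "has_weak_partial Q i (fsum \<sigma> c N) (fsum (flip \<sigma> i) (\<lambda>k. dcoef \<sigma> i k * c k) N)" for N
  proof -
    have "has_weak_partial Q i (\<lambda>x. \<Sum>k\<in>modes N. c k * trig \<sigma> k x)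
      (\<lambda>x. \<Sum>k\<in>modes N. c k * (dcoef \<sigma> i k * trig (flip \<sigma> i) k x))"
      by (intro has_weak_partial_sum has_weak_partial_scale trig_has_weak_partial)
    then show ?thesis by (simp add: fsum_def[abs_def] mult_ac)
  qed
qed

section \<open>Completeness of the sine system\<close>

abbreviation sinb :: "('n \<Rightarrow> nat) \<Rightarrow> real^'n \<Rightarrow> real" where
  "sinb \<equiv> trig (\<lambda>_. False)"

text \<open>Product-to-sum formula. The hypothesis makes \<open>k i - 1\<close> a true subtraction;
  the frequency 0 that it may produce gives the zero function.\<close>

lemma cos_mult_sinb:
  fixes k :: "'n::finite \<Rightarrow> nat"
  assumes "1 \<le> k i"
  shows "cos (pi * x $ i) * sinb k x = 1 / 2 * sinb (k(i := k i + 1)) x + 1 / 2 * sinb (k(i := k i - 1)) x"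
proof -
  have *: "cos (pi * t) * trig1 False (k i) t = 1 / 2 * trig1 False (k i + 1) t + 1 / 2 * trig1 False (k i - 1) t" for t
  proof -
    have "real (k i - 1) = real (k i) - 1" using assms by simp
    then show ?thesis by (simp add: trig1_def ring_distribs sin_add sin_diff)
  qed
  define P where "P = (\<Prod>j\<in>UNIV - {i}. trig1 False (k j) (x $ j))"
  have "(\<lambda>j. trig1 False ((k(i := l)) j)) = (\<lambda>j. trig1 False (k j))(i := trig1 False l)" for l
    by auto
  then have upd: "sinb (k(i := l)) x = trig1 False l (x $ i) * P" for l
    unfolding trig_def P_def by (simp only: tensor_upd)
  have "sinb k x = trig1 False (k i) (x $ i) * P"
    using upd[of "k i"] by simp
  then have "cos (pi * x $ i) * sinb k x = (cos (pi * x $ i) * trig1 False (k i) (x $ i)) * P" by simp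
  then show ?thesis unfolding * upd by (simp add: algebra_simps)
qed

lemma sinb_zero:
  fixes k :: "'n::finite \<Rightarrow> nat"
  assumes "k i = 0"
  shows "sinb k x = 0"
  unfolding trig_def tensor_remove[of _ x i] using assms by (simp add: trig1_def)

text \<open>Multiplication by \<open>cos (\<pi> x\<^sub>i)\<close> preserves the span of the sine basis, and these cosines
  generate a dense algebra, so the product of \<open>w\<close> with the lowest mode is orthogonal to all
  continuous functions.\<close>

lemma sine_complete:
  fixes w :: "real^'n \<Rightarrow> real"
  assumes w: "w \<in> L2_space Q"
    and orth: "\<And>k. (\<And>i. 1 \<le> k i) \<Longrightarrow> L2_inner Q w (sinb k) = 0"
  shows "AE x in lebesgue_on Q. w x = 0"
proof -
  \<comment> \<open>Orthogonality is asked for all frequencies, including those with a zero entry,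
    for which the sine product vanishes. This makes \<open>G\<close> stable under the shift to
    \<open>k i - 1\<close>.\<close>
  define G where "G F \<longleftrightarrow> continuous_on UNIV F \<and> (\<forall>k. L2_inner Q w (\<lambda>x. F x * sinb k x) = 0)"
    for F :: "real^'n \<Rightarrow> real"
  have GL: "(\<lambda>x. F x * sinb k x) \<in> L2_space Q" if "G F" for F k
    using that by (intro continuous_L2 continuous_on_mult continuous_on_trig) (simp add: G_def)
  have G1: "G (\<lambda>x. 1)"
  proof -
    have "L2_inner Q w (sinb k) = 0" for k
    proof (cases "\<forall>i. 1 \<le> k i")
      case False
      then obtain i where "k i = 0" by (metis One_nat_def Suc_leI neq0_conv)
      then show ?thesis by (simp add: sinb_zero L2_inner_def)
    qed (use orth in blast)
    then show ?thesis by (simp add: G_def)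
  qed
  have Gadd: "G (\<lambda>x. F x + F' x)" if "G F" "G F'" for F F'
    using that GL[OF that(1)] GL[OF that(2)] w
    by (auto simp: G_def distrib_right L2_inner_add_right intro: continuous_on_add)
  have Gscale: "G (\<lambda>x. c * F x)" if "G F" for c F
    using that by (auto simp: G_def mult.assoc L2_inner_scale_right intro: continuous_on_mult_left)
  have Gcos: "G (\<lambda>x. cos (pi * x $ i) * F x)" if F: "G F" for F i
    unfolding G_def
  proof (intro conjI allI)
    show "continuous_on UNIV (\<lambda>x. cos (pi * x $ i) * F x)"
      using F by (auto simp: G_def intro!: continuous_intros)
    fix k
    show "L2_inner Q w (\<lambda>x. cos (pi * x $ i) * F x * sinb k x) = 0"
    proof (cases "k i = 0")
      case True
      then show ?thesis by (simp add: sinb_zero L2_inner_def)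
    next
      case False
      have "cos (pi * x $ i) * F x * sinb k x
          = 1 / 2 * (F x * sinb (k(i := k i + 1)) x) + 1 / 2 * (F x * sinb (k(i := k i - 1)) x)" for x
        using arg_cong[OF cos_mult_sinb[of k i x], of "\<lambda>y. F x * y"] False by (simp add: algebra_simps)
      then show ?thesis
        using w GL[OF F] F
        by (simp only: L2_inner_add_right L2_scale L2_inner_scale_right) (simp add: G_def)
    qed
  qed
  \<comment> \<open>Multipliers that preserve \<open>G\<close> are closed under products by
    construction, as Stone-Weierstrass demands; for \<open>G\<close> itself this is not
    apparent.\<close>
  define P where "P f \<longleftrightarrow> continuous_on UNIV f \<and> (\<forall>F. G F \<longrightarrow> G (\<lambda>x. f x * F x))" for f :: "real^'n \<Rightarrow> real"
  have orthP: "L2_inner Q w (\<lambda>x. f x * sinb k x) = 0" if "P f" for f k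
  proof -
    have "G (\<lambda>x. f x * 1)" using that G1 unfolding P_def by blast
    then show ?thesis by (simp add: G_def)
  qed
  have dense: "L2_inner Q w (\<lambda>x. f x * sinb k x) = 0" if f: "continuous_on UNIV f" for f k
  proof -
    have fL: "(\<lambda>x. f x * sinb k x) \<in> L2_space Q"
      by (intro continuous_L2 continuous_on_mult continuous_on_trig f)
    have "\<bar>L2_inner Q w (\<lambda>x. f x * sinb k x)\<bar> \<le> e * (L2_norm Q w * L2_norm Q (sinb k))"
      if e: "e > 0" for e
    proof -
      have "\<exists>g. P g \<and> (\<forall>x\<in>cbox 0 (1::real^'n). \<bar>f x - g x\<bar> < e)"
      proof (rule Stone_Weierstrass_HOL)
        show "P (\<lambda>x. c)" for c unfolding P_def using Gscale by simp
        show "continuous_on (cbox 0 1) g" if "P g" for g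
          using that by (auto simp: P_def intro: continuous_on_subset)
        show "P (\<lambda>x. g x + h x)" if "P g \<and> P h" for g h
          using that Gadd unfolding P_def by (auto simp: distrib_right intro: continuous_on_add)
        show "P (\<lambda>x. g x * h x)" if "P g \<and> P h" for g h
          using that unfolding P_def by (auto simp: mult.assoc intro: continuous_on_mult)
        show "\<exists>g. P g \<and> g x \<noteq> g y" if xy: "x \<in> cbox 0 1 \<and> y \<in> cbox 0 1 \<and> x \<noteq> y" for x y
        proof -
          obtain i where i: "x $ i \<noteq> y $ i" using xy by (auto simp: vec_eq_iff)
          have "0 \<le> x $ i" "x $ i \<le> 1" "0 \<le> y $ i" "y $ i \<le> 1" using xy by (auto simp: mem_box_cart)
          \<comment> \<open>Cosine is injective on [0, \<pi>], so the coordinate cosines separate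
            the points of the closed cube.\<close>
          then have "cos (pi * x $ i) \<noteq> cos (pi * y $ i)"
            using i cos_inj_pi[of "pi * x $ i" "pi * y $ i"] by (auto simp: mult_left_le)
          moreover have "P (\<lambda>x. cos (pi * x $ i))"
            unfolding P_def using Gcos by (auto intro!: continuous_intros)
          ultimately show ?thesis by blast
        qed
        show "continuous_on (cbox 0 1) f" using f by (rule continuous_on_subset) simp
      qed (use e compact_cbox in auto)
      then obtain g where g: "P g" "\<And>x. x \<in> cbox 0 1 \<Longrightarrow> \<bar>f x - g x\<bar> < e" by blast
      have gL: "(\<lambda>x. g x * sinb k x) \<in> L2_space Q"
        using g(1) by (intro continuous_L2 continuous_on_mult continuous_on_trig) (simp add: P_def)
      have "L2_inner Q w (\<lambda>x. f x * sinb k x)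
          = L2_inner Q w (\<lambda>x. f x * sinb k x - g x * sinb k x)"
        using L2_inner_diff_right[OF fL gL w] orthP[OF g(1)] by simp
      also have "\<bar>\<dots>\<bar> \<le> L2_norm Q w * L2_norm Q (\<lambda>x. f x * sinb k x - g x * sinb k x)"
        by (rule L2_Cauchy_Schwarz[OF w L2_diff[OF fL gL]])
      also have "L2_norm Q (\<lambda>x. f x * sinb k x - g x * sinb k x) \<le> L2_norm Q (\<lambda>x. e * sinb k x)"
      proof (rule L2_norm_mono[OF L2_diff[OF fL gL] L2_scale[OF trig_L2]], rule AE_I2)
        fix x assume "x \<in> space (lebesgue_on (Q :: (real^'n) set))"
        then have "x \<in> cbox 0 1" using box_subset_cbox by (auto simp: unit_cube_eq_box)
        from g(2)[OF this] have "\<bar>f x - g x\<bar> * \<bar>sinb k x\<bar> \<le> e * \<bar>sinb k x\<bar>" by (intro mult_right_mono) auto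
        then show "\<bar>f x * sinb k x - g x * sinb k x\<bar> \<le> \<bar>e * sinb k x\<bar>"
          using e by (simp add: left_diff_distrib[symmetric] abs_mult)
      qed
      also have "\<dots> = e * L2_norm Q (sinb k)" using e by (simp add: L2_norm_scale)
      finally show ?thesis by (simp add: mult_left_mono mult.left_commute)
    qed
    then have "\<forall>\<^sub>F e in at_right 0. \<bar>L2_inner Q w (\<lambda>x. f x * sinb k x)\<bar>
        \<le> e * (L2_norm Q w * L2_norm Q (sinb k))"
      by (auto simp: eventually_at_filter)
    moreover have "((\<lambda>e. e * (L2_norm Q w * L2_norm Q (sinb k))) \<longlongrightarrow> 0) (at_right 0)"
      by (rule tendsto_mult_left_zero) (rule tendsto_ident_at)
    ultimately have "\<bar>L2_inner Q w (\<lambda>x. f x * sinb k x)\<bar> \<le> 0"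
      by (intro tendsto_lowerbound) auto
    then show ?thesis by simp
  qed
  \<comment> \<open>Every factor of this mode is positive on the open cube, so it can be divided out
    at the end.\<close>
  let ?e = "sinb (\<lambda>_. 1) :: real^'n \<Rightarrow> real"
  have "AE x in lebesgue_on Q. ?e x * w x = 0"
  proof (rule fundamental_lemma_of_variations)
    show "(\<lambda>x. ?e x * w x) \<in> L2_space Q"
    proof (rule L2_bounded_mult[OF w])
      show "AE x in lebesgue_on Q. \<bar>?e x\<bar> \<le> (\<Prod>i\<in>(UNIV::'n set). sqrt 2)"
        unfolding trig_def by (intro AE_I2 tensor_abs_bound trig1_bound)
    qed (intro continuous_measurable_lebesgue_on continuous_on_trig)
    fix \<phi> :: "real^'n \<Rightarrow> real" assume "\<phi> \<in> test_functions Q"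
    from dense[OF smooth_continuous_on[OF test_functions_smooth[OF this]], of "\<lambda>_. 1"]
    show "L2_inner Q (\<lambda>x. ?e x * w x) \<phi> = 0" by (simp add: L2_inner_def mult_ac)
  qed
  moreover have "?e x \<noteq> 0" if "x \<in> Q" for x
    using that by (auto simp: trig_def tensor_def trig1_def unit_cube_def intro!: sin_gt_zero less_imp_neq[symmetric])
  ultimately show ?thesis using AE_space[of "lebesgue_on (Q :: (real^'n) set)"]
    by (auto elim!: eventually_elim2)
qed

section \<open>The eigenvalues of -\<Delta> on sine products and the Poisson problem\<close>

definition lam :: "('n::finite \<Rightarrow> nat) \<Rightarrow> real" where
  "lam k = (\<Sum>i\<in>UNIV. (pi * real (k i))\<^sup>2)"

lemma lam_ge: "(pi * real (k i))\<^sup>2 \<le> lam k"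
  unfolding lam_def by (rule member_le_sum) auto

lemma lam_lower:
  assumes "\<And>i. 1 \<le> k i"
  shows "pi\<^sup>2 \<le> lam k"
proof -
  \<comment> \<open>Any coordinate will do; \<open>undefined\<close> names one, the index type being
    nonempty.\<close>
  have "pi \<le> pi * real (k undefined)" using assms[of undefined] by simp
  then have "pi\<^sup>2 \<le> (pi * real (k undefined))\<^sup>2" by (rule power_mono) simp
  then show ?thesis using lam_ge by (rule order_trans)
qed

lemma weak_laplacian_sum: "weak_laplacian \<Omega> u x = (\<Sum>i\<in>UNIV. weak_partial \<Omega> i (weak_partial \<Omega> i u) x)"
  by (simp add: weak_laplacian_def weak_hessian_def trace_def)

lemma weak_laplacian_L2: "u \<in> H2_space \<Omega> \<Longrightarrow> weak_laplacian \<Omega> u \<in> L2_space \<Omega>"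
  unfolding weak_laplacian_sum[abs_def] by (intro L2_sum has_weak_partialD(2)[OF H2_spaceD(2)])

text \<open>Two integrations by parts in each coordinate: one, against a cosine, uses the zero
  boundary values of \<open>u\<close>; the other, against the first derivative of \<open>u\<close>,
  uses those of the sine.\<close>

lemma laplacian_sine_coeff:
  fixes k :: "'n::finite \<Rightarrow> nat"
  assumes u: "u \<in> H2_space Q" "u \<in> H10_space Q"
  shows "lam k * L2_inner Q u (sinb k) = - L2_inner Q (weak_laplacian Q u) (sinb k)"
proof -
  have "(pi * real (k i))\<^sup>2 * L2_inner Q u (sinb k)
      = - L2_inner Q (weak_partial Q i (weak_partial Q i u)) (sinb k)" for i
  proof -
    let ?c = "trig (flip (\<lambda>_. False) i) k"
    have ff: "flip (flip (\<lambda>_. False) i) i = (\<lambda>_. False)" by (auto simp: flip_def)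
    have d: "dcoef (\<lambda>_. False) i k = pi * real (k i)" "dcoef (flip (\<lambda>_. False) i) i k = - (pi * real (k i))"
      by (auto simp: dcoef_def flip_def)
    note p1 = H2_spaceD(1)[OF u(1), of i] and p2 = H2_spaceD(2)[OF u(1), of i i]
    note s1 = trig_has_weak_partial[of i "\<lambda>_. False" k]
    have "L2_inner Q ?c (weak_partial Q i u) = pi * real (k i) * L2_inner Q (sinb k) u"
      using H10_weak_ibp[OF u(2) trig_has_weak_partial[of i "flip (\<lambda>_. False) i" k]]
      unfolding ff d by (simp add: L2_inner_minus_left L2_inner_scale_left)
    moreover have "L2_inner Q (weak_partial Q i u) (weak_partial Q i (sinb k))
        = pi * real (k i) * L2_inner Q (weak_partial Q i u) ?c"
      using L2_inner_cong_AE_right[OF weak_partial_AE[OF s1] has_weak_partialD(2)[OF weak_partial_works[OF s1]]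
          has_weak_partialD(2)[OF s1] has_weak_partialD(2)[OF p1]]
      unfolding d by (simp add: L2_inner_scale_right)
    ultimately show ?thesis
      using H10_weak_ibp[OF trig_H10 p2, of k]
      by (simp add: L2_inner_commute[of _ _ u] L2_inner_commute[of Q ?c] power2_eq_square)
  qed
  then have "lam k * L2_inner Q u (sinb k)
      = (\<Sum>i\<in>UNIV. - L2_inner Q (weak_partial Q i (weak_partial Q i u)) (sinb k))"
    unfolding lam_def sum_distrib_right by simp
  also have "\<dots> = - L2_inner Q (weak_laplacian Q u) (sinb k)"
    unfolding weak_laplacian_sum[abs_def] using has_weak_partialD(2)[OF H2_spaceD(2)[OF u(1)]]
    by (simp add: L2_inner_sum_left sum_negf)
  finally show ?thesis .
qed

text \<open>The sine coefficients of \<open>g\<close> are divided by the eigenvalues. Relative to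
  those of \<open>g\<close>, second derivatives have coefficients \<pi>^2 k_i k_j / lam up to sign,
  whose squares over all i, j sum to 1; for first derivatives the squares sum to 1 / lam, which is
  at most 1 / \<pi>^2.\<close>

lemma poisson_solvable:
  fixes g :: "real^'n \<Rightarrow> real"
  assumes g: "g \<in> L2_space Q"
  obtains \<psi> where "\<psi> \<in> H2_space Q \<inter> H10_space Q"
    "AE x in lebesgue_on Q. weak_laplacian Q \<psi> x = - g x"
    "L2_norm Q \<psi> \<le> L2_norm Q g"
    "(\<Sum>i\<in>UNIV. (L2_norm Q (weak_partial Q i \<psi>))\<^sup>2) \<le> (L2_norm Q g)\<^sup>2 / pi\<^sup>2"
    "(\<Sum>i\<in>UNIV. \<Sum>j\<in>UNIV. (L2_norm Q (weak_partial Q i (weak_partial Q j \<psi>)))\<^sup>2)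
      \<le> (L2_norm Q g)\<^sup>2"
proof -
  define G where "G k = L2_inner Q g (sinb k)" for k
  define c where "c k = G k / lam k" for k
  \<comment> \<open>Coefficients of the first and second derivatives, in the systems flipped at j
    and then at i.\<close>
  define c1 where "c1 j k = dcoef (\<lambda>_. False) j k * c k" for j k
  define c2 where "c2 i j k = dcoef (flip (\<lambda>_. False) j) i k * c1 j k" for i j k
  have bG: "(\<Sum>k\<in>modes N. (G k)\<^sup>2) \<le> (L2_norm Q g)\<^sup>2" for N
    unfolding G_def by (rule bessel_inequality[OF g])
  \<comment> \<open>All eigenvalues are thus at least 1, so the coefficients of the solution are
    dominated by those of \<open>g\<close>; this gives convergence of the series and the bound on
    \<open>\<psi>\<close>.\<close>
  have pi1: "1 \<le> pi\<^sup>2" using pi_gt3 by (simp add: one_le_power)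
  have lam_pos: "0 < lam k" if "k \<in> modes N" for k N
    using lam_lower[of k] modes_pos[OF that] pi1 by fastforce
  have c0: "(c k)\<^sup>2 \<le> (G k)\<^sup>2" if k: "k \<in> modes N" for k N
  proof -
    have "1 \<le> lam k" using lam_lower[of k] modes_pos[OF k] pi1 by fastforce
    then have "1 \<le> (lam k)\<^sup>2" by (simp add: one_le_power)
    then have "(G k)\<^sup>2 / (lam k)\<^sup>2 \<le> (G k)\<^sup>2 / 1" by (intro divide_left_mono) auto
    then show ?thesis by (simp add: c_def power_divide)
  qed
  have c1_sum: "(\<Sum>j\<in>UNIV. (c1 j k)\<^sup>2) \<le> (G k)\<^sup>2 / pi\<^sup>2" if k: "k \<in> modes N" for k N
  proof -
    have "(c1 j k)\<^sup>2 = (pi * real (k j))\<^sup>2 * (c k)\<^sup>2" for j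
      by (simp add: c1_def dcoef_def power_mult_distrib)
    then have "(\<Sum>j\<in>UNIV. (c1 j k)\<^sup>2) = lam k * (c k)\<^sup>2" by (simp add: lam_def sum_distrib_right)
    also have "\<dots> = (G k)\<^sup>2 / lam k" using lam_pos[OF k] by (simp add: c_def power2_eq_square)
    also have "\<dots> \<le> (G k)\<^sup>2 / pi\<^sup>2" using lam_lower[of k] modes_pos[OF k] by (intro divide_left_mono) (auto intro: mult_pos_pos lam_pos[OF k])
    finally show ?thesis .
  qed
  have c2_sum: "(\<Sum>i\<in>UNIV. \<Sum>j\<in>UNIV. (c2 i j k)\<^sup>2) = (G k)\<^sup>2" if k: "k \<in> modes N" for k N
  proof -
    have "(c2 i j k)\<^sup>2 = (pi * real (k i))\<^sup>2 * ((pi * real (k j))\<^sup>2 * (c k)\<^sup>2)" for i j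
      by (simp add: c2_def c1_def dcoef_def power_mult_distrib)
    then have "(\<Sum>i\<in>UNIV. \<Sum>j\<in>UNIV. (c2 i j k)\<^sup>2) = lam k * (lam k * (c k)\<^sup>2)"
      by (simp add: lam_def sum_distrib_right[symmetric] sum_distrib_left[symmetric])
    also have "\<dots> = (G k)\<^sup>2" using lam_pos[OF k] by (simp add: c_def power2_eq_square)
    finally show ?thesis .
  qed
  have trace: "(\<Sum>i\<in>UNIV. c2 i i k) = - G k" if k: "k \<in> modes N" for k N
  proof -
    have "c2 i i k = - ((pi * real (k i))\<^sup>2 * c k)" for i
      by (simp add: c2_def c1_def dcoef_def flip_def power2_eq_square)
    then have "(\<Sum>i\<in>UNIV. c2 i i k) = - (lam k * c k)" by (simp add: lam_def sum_distrib_right sum_negf)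
    then show ?thesis using lam_pos[OF k] by (simp add: c_def)
  qed
  have "(\<Sum>k\<in>modes N. (c k)\<^sup>2) \<le> (L2_norm Q g)\<^sup>2" for N
    using sum_mono[OF c0] bG[of N] by (rule order_trans)
  note bc = this
  obtain \<psi> where \<psi>: "L2_lim Q (fsum (\<lambda>_. False) c) \<psi>" using fsum_converges[OF bc] by blast
  have b1: "(\<Sum>k\<in>modes N. \<Sum>j\<in>UNIV. (c1 j k)\<^sup>2) \<le> (L2_norm Q g)\<^sup>2 / pi\<^sup>2" for N
  proof -
    have "(\<Sum>k\<in>modes N. \<Sum>j\<in>UNIV. (c1 j k)\<^sup>2) \<le> (\<Sum>k\<in>modes N. (G k)\<^sup>2 / pi\<^sup>2)"
      by (rule sum_mono) (rule c1_sum)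
    also have "\<dots> \<le> (L2_norm Q g)\<^sup>2 / pi\<^sup>2"
      unfolding sum_divide_distrib[symmetric] by (intro divide_right_mono bG) simp
    finally show ?thesis .
  qed
  have b2: "(\<Sum>k\<in>modes N. \<Sum>i\<in>UNIV. \<Sum>j\<in>UNIV. (c2 i j k)\<^sup>2) \<le> (L2_norm Q g)\<^sup>2" for N
    using bG[of N] by (simp add: c2_sum cong: sum.cong)
  have "(\<Sum>k\<in>modes N. (c1 j k)\<^sup>2) \<le> (L2_norm Q g)\<^sup>2 / pi\<^sup>2" for j N
    by (rule order_trans[OF sum_mono b1]) (rule member_le_sum, auto)
  from fsum_converges[OF this] have "\<forall>j. \<exists>v. L2_lim Q (fsum (flip (\<lambda>_. False) j) (c1 j)) v" by blast
  then obtain p where p: "\<And>j. L2_lim Q (fsum (flip (\<lambda>_. False) j) (c1 j)) (p j)" by metis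
  have "(\<Sum>k\<in>modes N. (c2 i j k)\<^sup>2) \<le> (L2_norm Q g)\<^sup>2" for i j N
  proof (rule order_trans[OF sum_mono b2])
    fix k
    have "(c2 i j k)\<^sup>2 \<le> (\<Sum>j\<in>UNIV. (c2 i j k)\<^sup>2)" by (rule member_le_sum) auto
    also have "\<dots> \<le> (\<Sum>i\<in>UNIV. \<Sum>j\<in>UNIV. (c2 i j k)\<^sup>2)"
      by (rule member_le_sum[of i UNIV "\<lambda>i. \<Sum>j\<in>UNIV. (c2 i j k)\<^sup>2"]) (auto intro: sum_nonneg)
    finally show "(c2 i j k)\<^sup>2 \<le> (\<Sum>i\<in>UNIV. \<Sum>j\<in>UNIV. (c2 i j k)\<^sup>2)" .
  qed
  from fsum_converges[OF this]
  have "\<forall>i j. \<exists>v. L2_lim Q (fsum (flip (flip (\<lambda>_. False) j) i) (c2 i j)) v" by blast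
  then obtain h where h: "\<And>i j. L2_lim Q (fsum (flip (flip (\<lambda>_. False) j) i) (c2 i j)) (h i j)" by metis
  have wp: "has_weak_partial Q i \<psi> (p i)" for i
    using \<psi> p[of i] unfolding c1_def[abs_def] by (rule fsum_has_weak_partial)
  have wh: "has_weak_partial Q i (p j) (h i j)" for i j
    using p[of j] h[of j i] unfolding c2_def[abs_def] by (rule fsum_has_weak_partial)
  \<comment> \<open>Zero boundary values pass to the limit because the series of first derivatives
    converges as well.\<close>
  have H10: "\<psi> \<in> H10_space Q"
  proof (rule H10_lim[OF _ \<psi> _ p])
    have "(\<lambda>x. \<Sum>k\<in>F. c k * sinb k x) \<in> H10_space Q" if "finite F" for F :: "('n \<Rightarrow> nat) set"
      using that
    proof induction
      case empty
      show ?case using H10_lincomb[OF trig_H10 trig_H10, of 0 _ 0] by simp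
    next
      case (insert k F)
      then show ?case using H10_lincomb[OF trig_H10 insert.IH, of "c k" k 1] by simp
    qed
    then show "fsum (\<lambda>_. False) c m \<in> H10_space Q" for m by (simp add: fsum_def[abs_def])
    show "has_weak_partial Q i (fsum (\<lambda>_. False) c m) (fsum (flip (\<lambda>_. False) i) (c1 i) m)" for i m
    proof -
      have "has_weak_partial Q i (\<lambda>x. \<Sum>k\<in>modes m. c k * sinb k x)
        (\<lambda>x. \<Sum>k\<in>modes m. c k * (dcoef (\<lambda>_. False) i k * trig (flip (\<lambda>_. False) i) k x))"
        by (intro has_weak_partial_sum has_weak_partial_scale trig_has_weak_partial)
      then show ?thesis by (simp add: fsum_def[abs_def] c1_def mult_ac)
    qed
  qed
  have lap: "AE x in lebesgue_on Q. (\<Sum>i\<in>UNIV. h i i x) = - g x"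
  proof -
    have hL: "h i j \<in> L2_space Q" for i j by (rule L2_limD(2)[OF h])
    \<comment> \<open>The trace of the second derivatives has the sine coefficients of
      \<open>- g\<close>, so completeness identifies the two.\<close>
    have "AE x in lebesgue_on Q. (\<Sum>i\<in>UNIV. h i i x) + g x = 0"
    proof (rule sine_complete)
      show "(\<lambda>x. (\<Sum>i\<in>UNIV. h i i x) + g x) \<in> L2_space Q" by (intro L2_add L2_sum hL g)
      fix k :: "'n \<Rightarrow> nat" assume k: "\<And>i. 1 \<le> k i"
      have ff: "flip (flip (\<lambda>_. False) i) i = (\<lambda>_. False)" for i :: 'n by (auto simp: flip_def)
      have "L2_inner Q (h i i) (sinb k) = c2 i i k" for i
        using fsum_lim_coeff[OF h[of i i], of k] k by (simp add: ff)
      moreover obtain N where "k \<in> modes N" using eventually_modes[of k, OF k] by (auto simp: eventually_sequentially)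
      ultimately show "L2_inner Q (\<lambda>x. (\<Sum>i\<in>UNIV. h i i x) + g x) (sinb k) = 0"
        using trace[of k N] by (simp add: L2_inner_add_left L2_sum L2_inner_sum_left hL g G_def)
    qed
    then show ?thesis by eventually_elim linarith
  qed
  \<comment> \<open>The bound holds for every truncated sum of squared coefficients, and by Parseval
    these sums tend to the squared norms.\<close>
  have "(\<lambda>N. \<Sum>i\<in>UNIV. \<Sum>k\<in>modes N. (c1 i k)\<^sup>2) \<longlonglongrightarrow> (\<Sum>i\<in>UNIV. (L2_norm Q (p i))\<^sup>2)"
    by (intro tendsto_sum fsum_lim_norm[OF p])
  then have "(\<Sum>i\<in>UNIV. (L2_norm Q (p i))\<^sup>2) \<le> (L2_norm Q g)\<^sup>2 / pi\<^sup>2"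
    by (rule LIMSEQ_le_const2) (use b1 in \<open>auto simp: sum.swap[of _ "modes _" UNIV]\<close>)
  moreover have "(\<lambda>N. \<Sum>i\<in>UNIV. \<Sum>j\<in>UNIV. \<Sum>k\<in>modes N. (c2 i j k)\<^sup>2)
      \<longlonglongrightarrow> (\<Sum>i\<in>UNIV. \<Sum>j\<in>UNIV. (L2_norm Q (h i j))\<^sup>2)"
    by (intro tendsto_sum fsum_lim_norm[OF h])
  then have "(\<Sum>i\<in>UNIV. \<Sum>j\<in>UNIV. (L2_norm Q (h i j))\<^sup>2) \<le> (L2_norm Q g)\<^sup>2"
    by (rule LIMSEQ_le_const2) (use b2 in \<open>auto simp: sum.swap[of _ "modes _" UNIV]\<close>)
  moreover have "(L2_norm Q \<psi>)\<^sup>2 \<le> (L2_norm Q g)\<^sup>2"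
    using fsum_lim_norm[OF \<psi>] by (rule LIMSEQ_le_const2) (use bc in auto)
  moreover note \<psi>2 = H2_spaceI[OF wp wh]
  moreover have "AE x in lebesgue_on Q. \<forall>i. weak_partial Q i (weak_partial Q i \<psi>) x = h i i x"
    using \<psi>2(2) by (simp add: AE_all_countable)
  then have "AE x in lebesgue_on Q. weak_laplacian Q \<psi> x = - g x"
    using lap by eventually_elim (simp add: weak_laplacian_sum)
  moreover have "L2_norm Q (weak_partial Q i \<psi>) = L2_norm Q (p i)" for i
    by (rule L2_norm_cong_AE[OF weak_partial_AE[OF wp] has_weak_partialD(2)[OF weak_partial_works[OF wp]]
          has_weak_partialD(2)[OF wp]])
  moreover have "L2_norm Q (weak_partial Q i (weak_partial Q j \<psi>)) = L2_norm Q (h i j)" for i j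
    by (intro L2_norm_cong_AE[OF \<psi>2(2)] has_weak_partialD(2)[OF H2_spaceD(2)[OF \<psi>2(1)]] has_weak_partialD(2)[OF wh])
  ultimately show ?thesis using that[of \<psi>] H10 by (simp add: power2_le_iff_abs_le)
qed

text \<open>All eigenvalues are positive, so the Laplacian determines the sine coefficients and, by
  completeness, the function.\<close>

lemma weak_laplacian_determines:
  assumes u: "u \<in> H2_space Q \<inter> H10_space Q" and v: "v \<in> H2_space Q \<inter> H10_space Q"
    and eq: "AE x in lebesgue_on Q. weak_laplacian Q u x = weak_laplacian Q v x"
  shows "AE x in lebesgue_on Q. u x = v x"
proof -
  have L2: "u \<in> L2_space Q" "v \<in> L2_space Q" using u v by (auto simp: H2_space_def H1_space_def)
  have "AE x in lebesgue_on Q. u x - v x = 0"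
  proof (rule sine_complete)
    show "(\<lambda>x. u x - v x) \<in> L2_space Q" using L2 by auto
    fix k :: "'a \<Rightarrow> nat" assume k: "\<And>i. 1 \<le> k i"
    have "0 < pi\<^sup>2" by simp
    then have pos: "0 < lam k" using lam_lower[of k, OF k] by linarith
    have "L2_inner Q (weak_laplacian Q u) (sinb k) = L2_inner Q (weak_laplacian Q v) (sinb k)"
      using u v by (intro L2_inner_cong_AE_left[OF eq] weak_laplacian_L2 trig_L2) auto
    then have "lam k * L2_inner Q u (sinb k) = lam k * L2_inner Q v (sinb k)"
      using laplacian_sine_coeff[of u k] laplacian_sine_coeff[of v k] u v by simp
    then have "L2_inner Q u (sinb k) = L2_inner Q v (sinb k)" using pos by simp
    then show "L2_inner Q (\<lambda>x. u x - v x) (sinb k) = 0"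
      using L2 by (simp add: L2_inner_diff_left)
  qed
  then show ?thesis by simp
qed

text \<open>The Poisson problem with datum \<open>-\<Delta>u\<close> reproduces \<open>u\<close> by
  uniqueness, so the bounds of the constructed solution hold for every element of the space. The
  third is the Miranda-Talenti estimate on the cube.\<close>

lemma H2_estimates:
  fixes u :: "real^'n \<Rightarrow> real"
  assumes u: "u \<in> H2_space Q \<inter> H10_space Q"
  defines "D \<equiv> L2_norm Q (weak_laplacian Q u)"
  shows "L2_norm Q u \<le> D"
    "(\<Sum>i\<in>UNIV. (L2_norm Q (weak_partial Q i u))\<^sup>2) \<le> D\<^sup>2 / pi\<^sup>2"
    "(\<Sum>i\<in>UNIV. \<Sum>j\<in>UNIV. (L2_norm Q (weak_partial Q i (weak_partial Q j u)))\<^sup>2) \<le> D\<^sup>2"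
proof -
  have lapL: "weak_laplacian Q u \<in> L2_space Q" using u by (auto intro: weak_laplacian_L2)
  obtain \<psi> where \<psi>: "\<psi> \<in> H2_space Q \<inter> H10_space Q"
    and lap: "AE x in lebesgue_on Q. weak_laplacian Q \<psi> x = - (- weak_laplacian Q u x)"
    and est: "L2_norm Q \<psi> \<le> D"
    "(\<Sum>i\<in>UNIV. (L2_norm Q (weak_partial Q i \<psi>))\<^sup>2) \<le> D\<^sup>2 / pi\<^sup>2"
    "(\<Sum>i\<in>UNIV. \<Sum>j\<in>UNIV. (L2_norm Q (weak_partial Q i (weak_partial Q j \<psi>)))\<^sup>2) \<le> D\<^sup>2"
    by (rule poisson_solvable[OF L2_minus[OF lapL], unfolded L2_norm_minus, folded D_def])
  have \<psi>2: "\<psi> \<in> H2_space Q" and u2: "u \<in> H2_space Q" using \<psi> u by auto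
  have eq: "AE x in lebesgue_on Q. \<psi> x = u x"
    by (rule weak_laplacian_determines[OF \<psi> u]) (use lap in simp)
  have uL: "u \<in> L2_space Q" using u by (auto simp: H2_space_def H1_space_def)
  note p = H2_spaceD(1)[OF \<psi>2] and h = H2_spaceD(2)[OF \<psi>2]
  have pu: "has_weak_partial Q i u (weak_partial Q i \<psi>)" for i
    using has_weak_partialD(2)[OF p] by (intro has_weak_partial_cong_AE[OF p eq _ uL]) auto
  have "L2_norm Q u = L2_norm Q \<psi>"
    using eq uL has_weak_partialD(1)[OF p] by (intro L2_norm_cong_AE) auto
  then show "L2_norm Q u \<le> D" using est(1) by simp
  have "L2_norm Q (weak_partial Q i u) = L2_norm Q (weak_partial Q i \<psi>)" for i
    by (rule L2_norm_cong_AE[OF weak_partial_AE[OF pu] has_weak_partialD(2)[OF weak_partial_works[OF pu]]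
          has_weak_partialD(2)[OF pu]])
  then show "(\<Sum>i\<in>UNIV. (L2_norm Q (weak_partial Q i u))\<^sup>2) \<le> D\<^sup>2 / pi\<^sup>2" using est(2) by simp
  have "L2_norm Q (weak_partial Q i (weak_partial Q j u))
      = L2_norm Q (weak_partial Q i (weak_partial Q j \<psi>))" for i j
    by (intro L2_norm_cong_AE[OF H2_spaceI(2)[OF pu h]] has_weak_partialD(2)[OF H2_spaceD(2)] \<psi>2 u2)
  then show "(\<Sum>i\<in>UNIV. \<Sum>j\<in>UNIV. (L2_norm Q (weak_partial Q i (weak_partial Q j u)))\<^sup>2) \<le> D\<^sup>2"
    using est(3) by simp
qed

section \<open>Riesz representation and perturbations of the Laplacian\<close>

lemma L2_lim_cong_AE:
  assumes s: "L2_lim \<Omega> s u" and eq: "AE x in lebesgue_on \<Omega>. u x = v x" and v: "v \<in> L2_space \<Omega>"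
  shows "L2_lim \<Omega> s v"
proof -
  note s' = L2_limD[OF s]
  have "L2_norm \<Omega> (\<lambda>x. s m x - u x) = L2_norm \<Omega> (\<lambda>x. s m x - v x)" for m
  proof (rule L2_norm_cong_AE)
    show "AE x in lebesgue_on \<Omega>. s m x - u x = s m x - v x" using eq by eventually_elim simp
  qed (use s' v in auto)
  then show ?thesis using s' v by (simp add: L2_lim_def)
qed

lemma sine_expansion:
  assumes g: "g \<in> L2_space Q"
  shows "L2_lim Q (fsum (\<lambda>_. False) (\<lambda>k. L2_inner Q g (sinb k))) g"
proof -
  obtain v where v: "L2_lim Q (fsum (\<lambda>_. False) (\<lambda>k. L2_inner Q g (sinb k))) v"
    using fsum_converges[OF bessel_inequality[OF g]] by blast
  note vL = L2_limD(2)[OF v]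
  have "AE x in lebesgue_on Q. v x - g x = 0"
  proof (rule sine_complete)
    show "L2_inner Q (\<lambda>x. v x - g x) (sinb k) = 0" if "\<And>i. 1 \<le> k i" for k
      using fsum_lim_coeff[OF v that] vL g by (simp add: L2_inner_diff_left)
  qed (use vL g in auto)
  then show ?thesis by (intro L2_lim_cong_AE[OF v _ g]) simp
qed

text \<open>The coefficients of the representing function are the values of \<open>l\<close> on the
  basis. Testing \<open>l\<close> on the partial sums formed with these coefficients bounds their
  square sum by \<open>C\<^sup>2\<close>; continuity carries the identity from sine sums to all of
  \<open>L\<^sup>2\<close>.\<close>

lemma riesz_representation:
  fixes l :: "(real^'n \<Rightarrow> real) \<Rightarrow> real"
  assumes lin: "\<And>u v a c. u \<in> L2_space Q \<Longrightarrow> v \<in> L2_space Q \<Longrightarrow>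
      l (\<lambda>x. a * u x + c * v x) = a * l u + c * l v"
    and bound: "\<And>u. u \<in> L2_space Q \<Longrightarrow> \<bar>l u\<bar> \<le> C * L2_norm Q u"
  shows "\<exists>u\<in>L2_space Q. \<forall>g\<in>L2_space Q. l g = L2_inner Q u g"
proof -
  define c where "c k = l (sinb k)" for k
  have l0: "l (\<lambda>x. 0) = 0" using lin[of "\<lambda>x. 0" "\<lambda>x. 0" 0 0] by simp
  have lsum: "l (\<lambda>x. \<Sum>k\<in>F. d k * sinb k x) = (\<Sum>k\<in>F. d k * c k)" if "finite F" for F d
    using that
  proof induction
    case (insert k F)
    have "l (\<lambda>x. d k * sinb k x + 1 * (\<Sum>k\<in>F. d k * sinb k x)) = d k * l (sinb k) + 1 * l (\<lambda>x. \<Sum>k\<in>F. d k * sinb k x)"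
      by (rule lin[OF trig_L2 trig_sum_L2])
    then show ?case using insert by (simp add: c_def)
  qed (simp add: l0)
  have lf: "l (fsum (\<lambda>_. False) d N) = (\<Sum>k\<in>modes N. d k * c k)" for d N
    unfolding fsum_def[abs_def] by (rule lsum) simp
  have "(\<Sum>k\<in>modes N. (c k)\<^sup>2) \<le> C\<^sup>2" for N
  proof -
    let ?S = "\<Sum>k\<in>modes N. (c k)\<^sup>2" and ?n = "L2_norm Q (fsum (\<lambda>_. False) c N)"
    have n2: "?n\<^sup>2 = ?S" unfolding fsum_def[abs_def] by (rule trig_sum_norm) (use modes_pos in auto)
    have "?n\<^sup>2 = l (fsum (\<lambda>_. False) c N)" unfolding n2 lf by (simp add: power2_eq_square)
    also have "\<dots> \<le> C * ?n" using bound[OF fsum_L2] by (rule order_trans[OF abs_ge_self])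
    finally have "?n * ?n \<le> C * ?n" by (simp add: power2_eq_square)
    then have "?n = 0 \<or> ?n \<le> C" by (metis L2_norm_nonneg less_eq_real_def mult_right_le_imp_le)
    then have "?n\<^sup>2 \<le> C\<^sup>2" by (auto intro: power_mono)
    then show ?thesis by (simp add: n2)
  qed
  from fsum_converges[OF this] obtain u where u: "L2_lim Q (fsum (\<lambda>_. False) c) u" by blast
  note uL = L2_limD(2)[OF u]
  have "l g = L2_inner Q u g" if g: "g \<in> L2_space Q" for g
  proof (rule LIMSEQ_unique)
    define s where "s = fsum (\<lambda>_. False) (\<lambda>k. L2_inner Q g (sinb k))"
    have s: "L2_lim Q s g" unfolding s_def by (rule sine_expansion[OF g])
    note sL = L2_limD(1)[OF s]
    have us: "l (s N) = L2_inner Q (s N) u" for N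
    proof -
      have "L2_inner Q (s N) u = (\<Sum>k\<in>modes N. L2_inner Q g (sinb k) * L2_inner Q (sinb k) u)"
        unfolding s_def fsum_def[abs_def]
        by (subst L2_inner_sum_left) (auto simp: uL L2_scale L2_inner_scale_left)
      also have "\<dots> = (\<Sum>k\<in>modes N. L2_inner Q g (sinb k) * c k)"
      proof (rule sum.cong[OF refl])
        fix k :: "'n \<Rightarrow> nat" assume "k \<in> modes N"
        then show "L2_inner Q g (sinb k) * L2_inner Q (sinb k) u = L2_inner Q g (sinb k) * c k"
          using fsum_lim_coeff[OF u, of k] modes_pos[of k N] by (simp add: L2_inner_commute[of _ _ u])
      qed
      finally show ?thesis by (simp add: s_def lf)
    qed
    show "(\<lambda>N. l (s N)) \<longlonglongrightarrow> L2_inner Q u g"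
      unfolding us L2_inner_commute[of _ u] by (rule L2_lim_inner[OF s uL])
    have "(\<lambda>N. l (s N) - l g) \<longlonglongrightarrow> 0"
    proof (rule Lim_null_comparison)
      have "l (s N) - l g = l (\<lambda>x. s N x - g x)" for N
        using lin[OF sL g, of 1 N "- 1"] by simp
      then show "\<forall>\<^sub>F N in sequentially. norm (l (s N) - l g) \<le> C * L2_norm Q (\<lambda>x. s N x - g x)"
        using bound[OF L2_diff[OF sL g]] by simp
      show "(\<lambda>N. C * L2_norm Q (\<lambda>x. s N x - g x)) \<longlonglongrightarrow> 0"
        using tendsto_mult_left[OF L2_limD(3)[OF s], of C] by simp
    qed
    then show "(\<lambda>N. l (s N)) \<longlonglongrightarrow> l g" by (simp add: LIM_zero_iff)
  qed
  then show ?thesis using uL by blast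
qed

section \<open>Second weak derivatives up to null sets: linearity and independence of
  representatives\<close>

lemma H2_L2: "u \<in> H2_space \<Omega> \<Longrightarrow> u \<in> L2_space \<Omega>"
  by (simp add: H2_space_def H1_space_def)

lemma H2_lincomb:
  assumes u: "u \<in> H2_space Q" and v: "v \<in> H2_space Q"
  shows "(\<lambda>x. a * u x + c * v x) \<in> H2_space Q"
    "AE x in lebesgue_on Q. weak_partial Q i (\<lambda>x. a * u x + c * v x) x
      = a * weak_partial Q i u x + c * weak_partial Q i v x"
    "AE x in lebesgue_on Q. weak_partial Q i (weak_partial Q j (\<lambda>x. a * u x + c * v x)) x
      = a * weak_partial Q i (weak_partial Q j u) x + c * weak_partial Q i (weak_partial Q j v) x"
proof -
  have 1: "has_weak_partial Q i (\<lambda>x. a * u x + c * v x)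
      (\<lambda>x. a * weak_partial Q i u x + c * weak_partial Q i v x)" for i
    by (intro has_weak_partial_add has_weak_partial_scale H2_spaceD(1) u v)
  have 2: "has_weak_partial Q i (\<lambda>x. a * weak_partial Q j u x + c * weak_partial Q j v x)
      (\<lambda>x. a * weak_partial Q i (weak_partial Q j u) x + c * weak_partial Q i (weak_partial Q j v) x)" for i j
    by (intro has_weak_partial_add has_weak_partial_scale H2_spaceD(2) u v)
  show "(\<lambda>x. a * u x + c * v x) \<in> H2_space Q" by (rule H2_spaceI(1)[OF 1 2])
  show "AE x in lebesgue_on Q. weak_partial Q i (\<lambda>x. a * u x + c * v x) x
      = a * weak_partial Q i u x + c * weak_partial Q i v x"
    by (rule weak_partial_AE[OF 1])
  show "AE x in lebesgue_on Q. weak_partial Q i (weak_partial Q j (\<lambda>x. a * u x + c * v x)) x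
      = a * weak_partial Q i (weak_partial Q j u) x + c * weak_partial Q i (weak_partial Q j v) x"
    by (rule H2_spaceI(2)[OF 1 2])
qed

lemma H2_cong_AE:
  assumes u: "u \<in> H2_space Q" and v: "v \<in> L2_space Q"
    and eq: "AE x in lebesgue_on Q. u x = v x"
  shows "AE x in lebesgue_on Q. weak_partial Q i v x = weak_partial Q i u x"
    "AE x in lebesgue_on Q. weak_partial Q i (weak_partial Q j v) x
      = weak_partial Q i (weak_partial Q j u) x"
proof -
  have 1: "has_weak_partial Q i v (weak_partial Q i u)" for i
    using has_weak_partialD(2)[OF H2_spaceD(1)[OF u]]
    by (intro has_weak_partial_cong_AE[OF H2_spaceD(1)[OF u] eq _ v]) auto
  show "AE x in lebesgue_on Q. weak_partial Q i v x = weak_partial Q i u x"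
    by (rule weak_partial_AE[OF 1])
  show "AE x in lebesgue_on Q. weak_partial Q i (weak_partial Q j v) x
      = weak_partial Q i (weak_partial Q j u) x"
    by (rule H2_spaceI(2)[OF 1 H2_spaceD(2)[OF u]])
qed

text \<open>Operators on \<open>H\<^sup>2 \<inter> H\<^sup>1\<^sub>0\<close> that are close to \<open>-\<Delta>\<close> in the sense of Campanato.\<close>

locale near_laplacian =
  fixes T :: "(real^'n \<Rightarrow> real) \<Rightarrow> real^'n \<Rightarrow> real" and q :: real
  assumes T_L2: "\<And>\<phi>. \<phi> \<in> H2_space Q \<inter> H10_space Q \<Longrightarrow> T \<phi> \<in> L2_space Q"
    and T_lincomb: "\<And>\<phi> \<psi> a c. \<phi> \<in> H2_space Q \<inter> H10_space Q \<Longrightarrow>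
      \<psi> \<in> H2_space Q \<inter> H10_space Q \<Longrightarrow>
      AE x in lebesgue_on Q. T (\<lambda>x. a * \<phi> x + c * \<psi> x) x = a * T \<phi> x + c * T \<psi> x"
    and T_cong: "\<And>\<phi> \<psi>. \<phi> \<in> H2_space Q \<inter> H10_space Q \<Longrightarrow>
      \<psi> \<in> H2_space Q \<inter> H10_space Q \<Longrightarrow> AE x in lebesgue_on Q. \<phi> x = \<psi> x \<Longrightarrow>
      AE x in lebesgue_on Q. T \<phi> x = T \<psi> x"
    and T_near: "\<And>\<phi>. \<phi> \<in> H2_space Q \<inter> H10_space Q \<Longrightarrow>
      L2_norm Q (\<lambda>x. T \<phi> x + weak_laplacian Q \<phi> x) \<le> q * L2_norm Q (weak_laplacian Q \<phi>)"
    and q: "0 \<le> q" "q < 1"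
begin

abbreviation V :: "(real^'n \<Rightarrow> real) set" where
  "V \<equiv> H2_space Q \<inter> H10_space Q"

abbreviation ae_eq :: "(real^'n \<Rightarrow> real) \<Rightarrow> (real^'n \<Rightarrow> real) \<Rightarrow> bool" (infix "\<doteq>" 50) where
  "u \<doteq> v \<equiv> AE x in lebesgue_on Q. u x = v x"

text \<open>With \<open>\<phi>\<close> solving \<Delta>\<phi> = -w, the squared norm of w equals
  -(w, \<Delta>\<phi>). Orthogonality to \<open>T \<phi>\<close> allows \<open>T \<phi>\<close> to
  be added to \<Delta>\<phi>, and what remains is at most q times the squared norm; q < 1 forces w =
  0.\<close>

lemma unique:
  assumes w: "w \<in> L2_space Q" and orth: "\<And>\<phi>. \<phi> \<in> V \<Longrightarrow> L2_inner Q w (T \<phi>) = 0"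
  shows "w \<doteq> (\<lambda>x. 0)"
proof -
  obtain \<phi> where \<phi>: "\<phi> \<in> V" and lap: "AE x in lebesgue_on Q. weak_laplacian Q \<phi> x = - w x"
    using poisson_solvable[OF w] by metis
  have lapL: "weak_laplacian Q \<phi> \<in> L2_space Q" using \<phi> by (auto intro: weak_laplacian_L2)
  have TL: "T \<phi> \<in> L2_space Q" by (rule T_L2[OF \<phi>])
  have n: "L2_norm Q (weak_laplacian Q \<phi>) = L2_norm Q w"
    using L2_norm_cong_AE[OF lap lapL L2_minus[OF w]] by (simp add: L2_norm_minus)
  have "L2_inner Q w w = - L2_inner Q w (\<lambda>x. - w x)"
    by (simp add: L2_inner_minus_right)
  also have "L2_inner Q w (\<lambda>x. - w x) = L2_inner Q w (weak_laplacian Q \<phi>)"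
    by (rule L2_inner_cong_AE_right[OF lap lapL L2_minus[OF w] w, symmetric])
  also have "\<dots> = L2_inner Q w (\<lambda>x. T \<phi> x + weak_laplacian Q \<phi> x)"
    using orth[OF \<phi>] by (simp add: L2_inner_add_right[OF TL lapL w])
  also have "- \<dots> \<le> L2_norm Q w * L2_norm Q (\<lambda>x. T \<phi> x + weak_laplacian Q \<phi> x)"
    using L2_Cauchy_Schwarz[OF w L2_add[OF TL lapL]] by linarith
  also have "\<dots> \<le> L2_norm Q w * (q * L2_norm Q w)"
    using T_near[OF \<phi>] unfolding n by (rule mult_left_mono) simp
  finally have "(1 - q) * L2_inner Q w w \<le> 0"
    unfolding L2_norm_power2[symmetric] by (simp add: power2_eq_square algebra_simps)
  then have "L2_inner Q w w \<le> 0" using q by (simp add: mult_le_0_iff)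
  then show ?thesis
    using L2_inner_self_nonneg[of Q w] by (intro L2_inner_self_eq_0[OF w]) linarith
qed

section \<open>The solution operator of the Poisson problem and the Neumann series\<close>

definition S :: "(real^'n \<Rightarrow> real) \<Rightarrow> real^'n \<Rightarrow> real" where
  "S g = (SOME \<phi>. \<phi> \<in> V \<and> weak_laplacian Q \<phi> \<doteq> (\<lambda>x. - g x))"

text \<open>The identity minus \<open>T\<close> composed with the inverse of -\<Delta>, a map of
  \<open>L\<^sup>2\<close> into itself of norm at most \<open>q\<close>. Because of the choice in
  \<open>S\<close> it is linear only up to null sets.\<close>

definition K :: "(real^'n \<Rightarrow> real) \<Rightarrow> real^'n \<Rightarrow> real" where
  "K g x = g x - T (S g) x"

lemma S_props:
  assumes "g \<in> L2_space Q"
  shows "S g \<in> V" "weak_laplacian Q (S g) \<doteq> (\<lambda>x. - g x)"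
proof -
  have "\<exists>\<phi>. \<phi> \<in> V \<and> weak_laplacian Q \<phi> \<doteq> (\<lambda>x. - g x)"
    using poisson_solvable[OF assms] by metis
  from someI_ex[OF this] show "S g \<in> V" "weak_laplacian Q (S g) \<doteq> (\<lambda>x. - g x)"
    unfolding S_def by auto
qed

lemma S_L2: "g \<in> L2_space Q \<Longrightarrow> S g \<in> L2_space Q"
  using S_props(1) H2_L2 by blast

lemma S_norm:
  assumes g: "g \<in> L2_space Q"
  shows "L2_norm Q (S g) \<le> L2_norm Q g"
proof -
  have "L2_norm Q (weak_laplacian Q (S g)) = L2_norm Q g"
    using L2_norm_cong_AE[OF S_props(2)[OF g] weak_laplacian_L2 L2_minus[OF g]] S_props(1)[OF g]
    by (simp add: L2_norm_minus)
  then show ?thesis using H2_estimates(1)[OF S_props(1)[OF g]] by simp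
qed

lemma V_lincomb: "\<phi> \<in> V \<Longrightarrow> \<psi> \<in> V \<Longrightarrow> (\<lambda>x. a * \<phi> x + c * \<psi> x) \<in> V"
  by (auto intro: H2_lincomb H10_lincomb)

lemma laplacian_lincomb:
  assumes "\<phi> \<in> V" "\<psi> \<in> V"
  shows "weak_laplacian Q (\<lambda>x. a * \<phi> x + c * \<psi> x)
    \<doteq> (\<lambda>x. a * weak_laplacian Q \<phi> x + c * weak_laplacian Q \<psi> x)"
proof -
  have "AE x in lebesgue_on Q. \<forall>i. weak_partial Q i (weak_partial Q i (\<lambda>x. a * \<phi> x + c * \<psi> x)) x
      = a * weak_partial Q i (weak_partial Q i \<phi>) x + c * weak_partial Q i (weak_partial Q i \<psi>) x"
    using H2_lincomb(3)[of \<phi> \<psi>] assms by (simp add: AE_all_countable)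
  then show ?thesis
    by eventually_elim (simp add: weak_laplacian_sum sum.distrib sum_distrib_left)
qed

lemma S_unique:
  assumes "g \<in> L2_space Q" "\<phi> \<in> V" "weak_laplacian Q \<phi> \<doteq> (\<lambda>x. - g x)"
  shows "S g \<doteq> \<phi>"
proof (rule weak_laplacian_determines[OF S_props(1)[OF assms(1)] assms(2)])
  show "weak_laplacian Q (S g) \<doteq> weak_laplacian Q \<phi>"
    using S_props(2)[OF assms(1)] assms(3) by eventually_elim simp
qed

text \<open>\<open>k\<close> is a separate argument that equals the combination only almost
  everywhere, because it will be an iterate of \<open>K\<close> applied to a combination.\<close>

lemma S_lincomb:
  assumes g: "g \<in> L2_space Q" and h: "h \<in> L2_space Q"
    and k: "k \<in> L2_space Q" "k \<doteq> (\<lambda>x. a * g x + c * h x)"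
  shows "S k \<doteq> (\<lambda>x. a * S g x + c * S h x)"
proof (rule S_unique[OF k(1) V_lincomb[OF S_props(1)[OF g] S_props(1)[OF h]]])
  show "weak_laplacian Q (\<lambda>x. a * S g x + c * S h x) \<doteq> (\<lambda>x. - k x)"
    using laplacian_lincomb[OF S_props(1)[OF g] S_props(1)[OF h], of a c] S_props(2)[OF g] S_props(2)[OF h] k(2)
    by eventually_elim simp
qed

lemma K_L2: "g \<in> L2_space Q \<Longrightarrow> K g \<in> L2_space Q"
  unfolding K_def[abs_def] by (intro L2_diff T_L2 S_props)

lemma K_norm:
  assumes g: "g \<in> L2_space Q"
  shows "L2_norm Q (K g) \<le> q * L2_norm Q g"
proof -
  note V = S_props(1)[OF g]
  have lapL: "weak_laplacian Q (S g) \<in> L2_space Q" using V by (auto intro: weak_laplacian_L2)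
  have "K g \<doteq> (\<lambda>x. - (T (S g) x + weak_laplacian Q (S g) x))"
    using S_props(2)[OF g] by eventually_elim (simp add: K_def)
  then have "L2_norm Q (K g) = L2_norm Q (\<lambda>x. T (S g) x + weak_laplacian Q (S g) x)"
    using L2_norm_cong_AE[OF _ K_L2[OF g] L2_minus[OF L2_add[OF T_L2[OF V] lapL]]] by (simp only: L2_norm_minus)
  also have "\<dots> \<le> q * L2_norm Q (weak_laplacian Q (S g))" by (rule T_near[OF V])
  also have "L2_norm Q (weak_laplacian Q (S g)) = L2_norm Q g"
    using L2_norm_cong_AE[OF S_props(2)[OF g] lapL L2_minus[OF g]] by (simp add: L2_norm_minus)
  finally show ?thesis .
qed

lemma K_lincomb:
  assumes g: "g \<in> L2_space Q" and h: "h \<in> L2_space Q"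
    and k: "k \<in> L2_space Q" "k \<doteq> (\<lambda>x. a * g x + c * h x)"
  shows "K k \<doteq> (\<lambda>x. a * K g x + c * K h x)"
proof -
  note V = S_props(1)[OF g] S_props(1)[OF h]
  have "T (S k) \<doteq> T (\<lambda>x. a * S g x + c * S h x)"
    by (rule T_cong[OF S_props(1)[OF k(1)] V_lincomb[OF V] S_lincomb[OF g h k]])
  with T_lincomb[OF V, of a c] k(2) show ?thesis
    by eventually_elim (simp add: K_def algebra_simps)
qed

lemma Kn_L2: "g \<in> L2_space Q \<Longrightarrow> (K ^^ m) g \<in> L2_space Q"
  by (induction m) (auto intro: K_L2)

lemma Kn_norm:
  assumes "g \<in> L2_space Q"
  shows "L2_norm Q ((K ^^ m) g) \<le> q ^ m * L2_norm Q g"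
proof (induction m)
  case (Suc m)
  have "L2_norm Q (K ((K ^^ m) g)) \<le> q * L2_norm Q ((K ^^ m) g)"
    by (rule K_norm[OF Kn_L2[OF assms]])
  also have "\<dots> \<le> q * (q ^ m * L2_norm Q g)" using Suc q by (intro mult_left_mono) auto
  finally show ?case by (simp add: mult.assoc)
qed simp

lemma Kn_lincomb:
  assumes g: "g \<in> L2_space Q" and h: "h \<in> L2_space Q"
  shows "(K ^^ m) (\<lambda>x. a * g x + c * h x) \<doteq> (\<lambda>x. a * (K ^^ m) g x + c * (K ^^ m) h x)"
proof (induction m)
  case (Suc m)
  have "K ((K ^^ m) (\<lambda>x. a * g x + c * h x)) \<doteq> (\<lambda>x. a * K ((K ^^ m) g) x + c * K ((K ^^ m) h) x)"
    using g h Suc by (intro K_lincomb Kn_L2 L2_add L2_scale) auto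
  then show ?case by simp
qed simp

text \<open>A solution \<open>u\<close> is characterised by \<open>(u, g - K g) = (f, S g)\<close>, which suggests the Neumann
  series \<open>g \<mapsto> \<Sum>\<^sub>m (f, S (K\<^sup>m g))\<close> for the functional \<open>(u, \<cdot>)\<close>.\<close>

lemma existence:
  assumes f: "f \<in> L2_space Q"
  shows "\<exists>u\<in>L2_space Q. \<forall>\<phi>\<in>V. L2_inner Q u (T \<phi>) = L2_inner Q f \<phi>"
proof -
  define t where "t g m = L2_inner Q f (S ((K ^^ m) g))" for g m
  have t_bound: "\<bar>t g m\<bar> \<le> L2_norm Q f * L2_norm Q g * q ^ m" if g: "g \<in> L2_space Q" for g m
  proof -
    have "\<bar>t g m\<bar> \<le> L2_norm Q f * L2_norm Q (S ((K ^^ m) g))"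
      unfolding t_def by (rule L2_Cauchy_Schwarz[OF f S_L2[OF Kn_L2[OF g]]])
    also have "\<dots> \<le> L2_norm Q f * (q ^ m * L2_norm Q g)"
      using S_norm[OF Kn_L2[OF g], of m] Kn_norm[OF g, of m] by (intro mult_left_mono) auto
    finally show ?thesis by (simp add: mult_ac)
  qed
  have geo: "summable (\<lambda>m. L2_norm Q f * L2_norm Q g * q ^ m)" for g
    using q by (intro summable_mult summable_geometric) simp
  have t_summable: "summable (t g)" if "g \<in> L2_space Q" for g
    by (rule summable_comparison_test'[OF geo[of g], of 0]) (use t_bound[OF that] in simp)
  define l where "l g = (\<Sum>m. t g m)" for g
  have lin: "l (\<lambda>x. a * g x + c * h x) = a * l g + c * l h"
    if g: "g \<in> L2_space Q" and h: "h \<in> L2_space Q" for g h a c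
  proof -
    have "t (\<lambda>x. a * g x + c * h x) m = a * t g m + c * t h m" for m
    proof -
      have k: "(\<lambda>x. a * g x + c * h x) \<in> L2_space Q" using g h by auto
      have SL: "S ((K ^^ m) g) \<in> L2_space Q" "S ((K ^^ m) h) \<in> L2_space Q"
        by (intro S_L2 Kn_L2 g h)+
      have "S ((K ^^ m) (\<lambda>x. a * g x + c * h x)) \<doteq> (\<lambda>x. a * S ((K ^^ m) g) x + c * S ((K ^^ m) h) x)"
        by (rule S_lincomb[OF Kn_L2[OF g] Kn_L2[OF h] Kn_L2[OF k] Kn_lincomb[OF g h]])
      from L2_inner_cong_AE_right[OF this S_L2[OF Kn_L2[OF k]] L2_add[OF L2_scale[OF SL(1)] L2_scale[OF SL(2)]] f]
      show ?thesis
        unfolding t_def using L2_inner_add_right[OF L2_scale[OF SL(1)] L2_scale[OF SL(2)] f]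
        by (simp add: L2_inner_scale_right)
    qed
    then have "t (\<lambda>x. a * g x + c * h x) = (\<lambda>m. a * t g m + c * t h m)" by (rule ext)
    then show ?thesis
      unfolding l_def using t_summable[OF g] t_summable[OF h]
      by (simp add: suminf_add[symmetric] suminf_mult summable_mult)
  qed
  have bound: "\<bar>l g\<bar> \<le> (L2_norm Q f / (1 - q)) * L2_norm Q g" if g: "g \<in> L2_space Q" for g
  proof -
    have sa: "summable (\<lambda>m. \<bar>t g m\<bar>)"
      by (rule summable_comparison_test'[OF geo[of g], of 0]) (use t_bound[OF g] in simp)
    have "\<bar>l g\<bar> \<le> (\<Sum>m. \<bar>t g m\<bar>)" unfolding l_def by (rule summable_rabs[OF sa])
    also have "\<dots> \<le> (\<Sum>m. L2_norm Q f * L2_norm Q g * q ^ m)"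
      by (rule suminf_le[OF t_bound[OF g] sa geo])
    also have "\<dots> = L2_norm Q f * L2_norm Q g * (1 / (1 - q))"
      using q by (subst suminf_mult) (auto simp: suminf_geometric summable_geometric)
    finally show ?thesis by simp
  qed
  \<comment> \<open>The sum of the series is linear and bounded, hence an inner product with a fixed
    function.\<close>
  obtain u where u: "u \<in> L2_space Q" and ul: "\<And>g. g \<in> L2_space Q \<Longrightarrow> l g = L2_inner Q u g"
    using riesz_representation[of l, OF lin bound] by blast
  have "L2_inner Q u (T \<phi>) = L2_inner Q f \<phi>" if \<phi>: "\<phi> \<in> V" for \<phi>
  proof -
    \<comment> \<open>Up to a null set every test function is \<open>S g\<close> for this
      \<open>g\<close>, and then \<open>T \<phi>\<close> is \<open>g - K g\<close>.\<close>
    define g where "g x = - weak_laplacian Q \<phi> x" for x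
    have g: "g \<in> L2_space Q" unfolding g_def[abs_def] using \<phi> by (intro L2_minus weak_laplacian_L2) auto
    have S\<phi>: "S g \<doteq> \<phi>" by (rule S_unique[OF g \<phi>]) (simp add: g_def)
    have "T (S g) \<doteq> T \<phi>" by (rule T_cong[OF S_props(1)[OF g] \<phi> S\<phi>])
    then have "T \<phi> \<doteq> (\<lambda>x. g x - K g x)" by eventually_elim (simp add: K_def)
    then have "L2_inner Q u (T \<phi>) = L2_inner Q u (\<lambda>x. g x - K g x)"
      by (rule L2_inner_cong_AE_right[OF _ T_L2[OF \<phi>] L2_diff[OF g K_L2[OF g]] u])
    also have "\<dots> = l g - l (K g)"
      using L2_inner_diff_right[OF g K_L2[OF g] u] ul[OF g] ul[OF K_L2[OF g]] by simp
    \<comment> \<open>Applying \<open>K\<close> to the argument shifts the series by one index, so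
      the difference is its first term.\<close>
    also have "\<dots> = t g 0"
    proof -
      have "t (K g) m = t g (Suc m)" for m by (simp add: t_def funpow_swap1)
      then have "t (K g) = (\<lambda>m. t g (Suc m))" by (rule ext)
      then show ?thesis unfolding l_def using suminf_split_head[OF t_summable[OF g]] by simp
    qed
    also have "\<dots> = L2_inner Q f \<phi>"
      unfolding t_def using L2_inner_cong_AE_right[OF S\<phi> S_L2[OF g] H2_L2 f] \<phi> by simp
    finally show ?thesis .
  qed
  then show ?thesis using u by blast
qed

end

section \<open>Coefficients satisfying the Cordes condition\<close>

lemma Linf_space_bound:
  assumes "g \<in> Linf_space \<Omega>"
  obtains B where "0 \<le> B" "AE x in lebesgue_on \<Omega>. norm (g x) \<le> B"
proof -
  have "Linf_norm \<Omega> g \<noteq> \<infinity>" using assms by (auto simp: Linf_space_def)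
  then obtain n :: nat where n: "Linf_norm \<Omega> g < ereal (real n)"
    using less_PInf_Ex_of_nat by (metis ereal_infty_less(1) less_PInf_Ex_of_nat)
  have "AE x in lebesgue_on \<Omega>. ereal (norm (g x)) \<le> Linf_norm \<Omega> g"
    unfolding Linf_norm_def by (rule esssup_AE)
  then have "AE x in lebesgue_on \<Omega>. norm (g x) \<le> real n"
  proof eventually_elim
    case (elim x)
    then have "ereal (norm (g x)) \<le> ereal (real n)" using n by (meson less_imp_le order_trans)
    then show ?case by simp
  qed
  then show ?thesis using that[of "real n"] by simp
qed

lemma measurable_vec_component:
  "b \<in> borel_measurable M \<Longrightarrow> (\<lambda>x. b x $ i :: real) \<in> borel_measurable M"
  by (rule borel_measurable_continuous_on[where f="\<lambda>v. v $ i"]) (intro continuous_intros)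

lemma measurable_mat_component:
  "A \<in> borel_measurable M \<Longrightarrow> (\<lambda>x. A x $ i $ j :: real) \<in> borel_measurable M"
  by (rule borel_measurable_continuous_on[where f="\<lambda>v. v $ i $ j"]) (intro continuous_intros)

section \<open>Pointwise linear algebra behind the Cordes condition\<close>

lemma trace_eq_inner_mat1: "trace (A :: real^'n^'n) = A \<bullet> mat 1"
proof -
  have "A \<bullet> mat 1 = (\<Sum>i\<in>UNIV. \<Sum>j\<in>UNIV. A $ i $ j * (if i = j then 1 else 0))"
    by (simp add: inner_vec_def mat_def)
  also have "\<dots> = (\<Sum>i\<in>UNIV. A $ i $ i)"
    by (simp add: if_distrib cong: if_cong)
  finally show ?thesis by (simp add: trace_def)
qed

lemma mat1_inner_self: "(mat 1 :: real^'n^'n) \<bullet> mat 1 = real CARD('n)"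
  using trace_eq_inner_mat1[of "mat 1 :: real^'n^'n"] by (simp add: trace_I)

lemma norm_mat_power2: "(norm (M :: real^'n^'m))\<^sup>2 = (\<Sum>i\<in>UNIV. \<Sum>j\<in>UNIV. (M $ i $ j)\<^sup>2)"
  unfolding power2_norm_eq_inner by (simp add: inner_vec_def power2_eq_square)

lemma norm_vec_power2: "(norm (v :: real^'n))\<^sup>2 = (\<Sum>i\<in>UNIV. (v $ i)\<^sup>2)"
  unfolding power2_norm_eq_inner by (simp add: inner_vec_def power2_eq_square)

text \<open>Evaluating the quadratic form at the unit vectors bounds each diagonal entry from
  below.\<close>

lemma trace_lower_bound:
  assumes "qf_le (l *\<^sub>R mat 1) (A :: real^'n^'n)"
  shows "real CARD('n) * l \<le> trace A"
proof -
  have "l \<le> A $ i $ i" for i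
  proof -
    have "axis i 1 \<bullet> ((l *\<^sub>R mat 1 :: real^'n^'n) *v axis i 1) \<le> axis i 1 \<bullet> (A *v axis i 1)"
      using assms by (simp add: qf_le_def)
    moreover have "axis i 1 \<bullet> (M *v axis i 1) = M $ i $ i" for M :: "real^'n^'n"
      by (simp add: inner_axis' matrix_vector_mul_component inner_axis)
    ultimately show ?thesis by (simp add: mat_def)
  qed
  then have "(\<Sum>i\<in>(UNIV::'n set). l) \<le> (\<Sum>i\<in>UNIV. A $ i $ i)" by (intro sum_mono)
  then show ?thesis by (simp add: trace_def)
qed

text \<open>The choice of \<open>\<gamma>\<close> minimises the left-hand side over all scalings of \<open>(A, b)\<close>.\<close>

lemma cordes_distance:
  fixes A :: "real^'n^'n" and b :: "real^'n"
  assumes t: "trace A > 0" and s: "(norm A)\<^sup>2 + (norm b)\<^sup>2 > 0"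
    and \<delta>: "0 < \<delta>" and cordes: "((norm A)\<^sup>2 + (norm b)\<^sup>2) / (trace A)\<^sup>2 \<le> 1 / (real CARD('n) - 1 + \<delta>)"
  defines "\<gamma> \<equiv> trace A / ((norm A)\<^sup>2 + (norm b)\<^sup>2)"
  shows "(norm (\<gamma> *\<^sub>R A - mat 1))\<^sup>2 + (norm (\<gamma> *\<^sub>R b))\<^sup>2 \<le> 1 - \<delta>"
proof -
  let ?s = "(norm A)\<^sup>2 + (norm b)\<^sup>2"
  have "real CARD('n) \<ge> 1" by simp
  then have d: "real CARD('n) - 1 + \<delta> > 0" using \<delta> by linarith
  have "(norm (\<gamma> *\<^sub>R A - mat 1))\<^sup>2 = \<gamma>\<^sup>2 * (norm A)\<^sup>2 - 2 * \<gamma> * trace A + real CARD('n)"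
    unfolding power2_norm_eq_inner trace_eq_inner_mat1
    by (simp add: inner_diff_left inner_diff_right mat1_inner_self inner_commute[of "mat 1" A] power2_eq_square algebra_simps)
  then have "(norm (\<gamma> *\<^sub>R A - mat 1))\<^sup>2 + (norm (\<gamma> *\<^sub>R b))\<^sup>2 = \<gamma>\<^sup>2 * ?s - 2 * \<gamma> * trace A + real CARD('n)"
    by (simp add: power_mult_distrib algebra_simps)
  also have "\<dots> = real CARD('n) - (trace A)\<^sup>2 / ?s"
    using s by (simp add: \<gamma>_def power2_eq_square)
  also have "\<dots> \<le> 1 - \<delta>"
  proof -
    have "?s * (real CARD('n) - 1 + \<delta>) \<le> (trace A)\<^sup>2"
      using cordes t d by (simp add: field_simps)
    then have "real CARD('n) - 1 + \<delta> \<le> (trace A)\<^sup>2 / ?s"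
      using s by (simp add: pos_le_divide_eq mult.commute)
    then show ?thesis by linarith
  qed
  finally show ?thesis .
qed

text \<open>Cauchy-Schwarz in the product space. After each inner product is bounded separately, the
  gap is the square of \<open>norm X * norm G - norm Y * norm H\<close> (Lagrange's
  identity).\<close>

lemma inner_pair_bound:
  fixes X H :: "'a::real_inner" and Y G :: "'b::real_inner"
  shows "(X \<bullet> H + Y \<bullet> G)\<^sup>2 \<le> ((norm X)\<^sup>2 + (norm Y)\<^sup>2) * ((norm H)\<^sup>2 + (norm G)\<^sup>2)"
proof -
  have "\<bar>X \<bullet> H + Y \<bullet> G\<bar> \<le> norm X * norm H + norm Y * norm G"
    using Cauchy_Schwarz_ineq2[of X H] Cauchy_Schwarz_ineq2[of Y G] by linarith
  then have "(X \<bullet> H + Y \<bullet> G)\<^sup>2 \<le> (norm X * norm H + norm Y * norm G)\<^sup>2"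
    by (metis abs_ge_zero power2_abs power_mono)
  also have "\<dots> \<le> (norm X * norm H + norm Y * norm G)\<^sup>2 + (norm X * norm G - norm Y * norm H)\<^sup>2" by simp
  also have "\<dots> = ((norm X)\<^sup>2 + (norm Y)\<^sup>2) * ((norm H)\<^sup>2 + (norm G)\<^sup>2)"
    by (simp add: power2_eq_square algebra_simps)
  finally show ?thesis .
qed

lemma L2_inner_power2: "L2_inner \<Omega> u u = (LINT x|lebesgue_on \<Omega>. (u x)\<^sup>2)"
  by (simp add: L2_inner_def power2_eq_square)

text \<open>The value \<open>\<kappa> = 0\<close> covers the case without drift, in which first derivatives do not enter the
  estimate; otherwise \<open>\<kappa> = 1\<close>.\<close>

locale cordes =
  fixes A :: "real^'n \<Rightarrow> real^'n^'n" and b :: "real^'n \<Rightarrow> real^'n" and \<delta> \<kappa> :: real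
  assumes A_meas: "A \<in> borel_measurable (lebesgue_on Q)"
    and b_meas: "b \<in> borel_measurable (lebesgue_on Q)"
    and bounded: "\<exists>B. AE x in lebesgue_on Q. norm (A x) \<le> B \<and> norm (b x) \<le> B"
    and elliptic: "\<exists>l>0. AE x in lebesgue_on Q. l \<le> trace (A x)"
    and cordes: "AE x in lebesgue_on Q.
      ((norm (A x))\<^sup>2 + (norm (b x))\<^sup>2) / (trace (A x))\<^sup>2 \<le> 1 / (real CARD('n) - 1 + \<delta>)"
    and \<delta>: "0 < \<delta>" "\<delta> \<le> 1"
    and \<kappa>: "0 \<le> \<kappa>" "(1 - \<delta>) * (1 + \<kappa> / pi\<^sup>2) < 1" "AE x in lebesgue_on Q. b x = 0 \<or> \<kappa> = 1"
begin

abbreviation \<gamma> :: "real^'n \<Rightarrow> real" where "\<gamma> \<equiv> renorm A b"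

definition T :: "(real^'n \<Rightarrow> real) \<Rightarrow> real^'n \<Rightarrow> real" where
  "T \<phi> x = \<gamma> x * L_op Q A b \<phi> x"

lemma renorm_measurable: "\<gamma> \<in> borel_measurable (lebesgue_on Q)"
proof -
  note [measurable] = A_meas b_meas measurable_mat_component[OF A_meas]
  show ?thesis unfolding renorm_def[abs_def] trace_def by measurable
qed

text \<open>With t the trace and s the denominator of \<gamma>, Cauchy-Schwarz against the identity
  matrix gives t^2 <= n s, hence s > 0 and t/s <= n/t <= n/l. From below, t >= l and s <= 2
  B^2.\<close>

lemma renorm_bounds: "\<exists>m M. 0 < m \<and> (AE x in lebesgue_on Q. m \<le> \<gamma> x \<and> \<gamma> x \<le> M \<and> 0 < trace (A x)
    \<and> 0 < (norm (A x))\<^sup>2 + (norm (b x))\<^sup>2)"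
proof -
  obtain B where B: "AE x in lebesgue_on Q. norm (A x) \<le> B \<and> norm (b x) \<le> B" using bounded by blast
  obtain l where l: "l > 0" "AE x in lebesgue_on Q. l \<le> trace (A x)" using elliptic by blast
  let ?n = "real CARD('n)"
  \<comment> \<open>The summand 1 keeps the denominator positive whatever \<open>B\<close>
    is.\<close>
  have "AE x in lebesgue_on Q. l / (2 * B\<^sup>2 + 1) \<le> \<gamma> x \<and> \<gamma> x \<le> ?n / l \<and> 0 < trace (A x)
    \<and> 0 < (norm (A x))\<^sup>2 + (norm (b x))\<^sup>2"
    using B l(2)
  proof eventually_elim
    case (elim x)
    let ?t = "trace (A x)" and ?s = "(norm (A x))\<^sup>2 + (norm (b x))\<^sup>2"
    have t: "?t > 0" using elim l(1) by linarith
    have "\<bar>?t\<bar> \<le> norm (A x) * norm (mat 1 :: real^'n^'n)"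
      unfolding trace_eq_inner_mat1 by (rule Cauchy_Schwarz_ineq2)
    then have "\<bar>?t\<bar>\<^sup>2 \<le> (norm (A x) * norm (mat 1 :: real^'n^'n))\<^sup>2" by (rule power_mono) simp
    then have "?t\<^sup>2 \<le> (norm (A x))\<^sup>2 * ?n"
      by (simp add: power_mult_distrib power2_norm_eq_inner[of "mat 1"] mat1_inner_self)
    also have "\<dots> \<le> ?s * ?n" by (intro mult_right_mono) auto
    finally have ts: "?t\<^sup>2 \<le> ?s * ?n" .
    have "0 < ?t\<^sup>2" using t by simp
    then have s: "?s > 0" using ts by (metis add_nonneg_nonneg less_le_not_le mult_zero_left order_le_less zero_le_power2)
    have "?t \<le> ?s * (?n / l)"
    proof -
      have "?t * l \<le> ?t * ?t" using elim t by (intro mult_left_mono) auto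
      also have "\<dots> \<le> ?s * ?n" using ts by (simp add: power2_eq_square)
      finally show ?thesis using l(1) by (simp add: field_simps)
    qed
    then have "\<gamma> x \<le> ?n / l" using s by (simp add: renorm_def pos_divide_le_eq mult.commute)
    moreover have "l / (2 * B\<^sup>2 + 1) \<le> \<gamma> x"
    proof -
      have "(norm (A x))\<^sup>2 \<le> B\<^sup>2" "(norm (b x))\<^sup>2 \<le> B\<^sup>2" using elim by (auto intro: power_mono)
      then have "?s \<le> 2 * B\<^sup>2 + 1" by linarith
      then show ?thesis unfolding renorm_def using elim s l(1) by (intro frac_le) auto
    qed
    ultimately show ?case using t s by blast
  qed
  moreover have "0 < l / (2 * B\<^sup>2 + 1)" using l(1) by (simp add: add_nonneg_pos)
  ultimately show ?thesis by blast
qed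

lemma T_eq: "T \<phi> x = - (\<Sum>i\<in>UNIV. \<Sum>j\<in>UNIV. (\<gamma> x * A x $ i $ j) * weak_partial Q i (weak_partial Q j \<phi>) x)
    - (\<Sum>i\<in>UNIV. (\<gamma> x * b x $ i) * weak_partial Q i \<phi> x)"
  by (simp add: T_def L_op_def inner_vec_def weak_hessian_def weak_grad_def sum_distrib_left algebra_simps)

lemma coeff_bounds: "\<exists>C. AE x in lebesgue_on Q. \<forall>i j. \<bar>\<gamma> x * A x $ i $ j\<bar> \<le> C \<and> \<bar>\<gamma> x * b x $ i\<bar> \<le> C"
proof -
  obtain B where B: "AE x in lebesgue_on Q. norm (A x) \<le> B \<and> norm (b x) \<le> B" using bounded by blast
  obtain m M where m: "0 < m" "AE x in lebesgue_on Q. m \<le> \<gamma> x \<and> \<gamma> x \<le> M \<and> 0 < trace (A x)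
      \<and> 0 < (norm (A x))\<^sup>2 + (norm (b x))\<^sup>2" using renorm_bounds by blast
  have "AE x in lebesgue_on Q. \<forall>i j. \<bar>\<gamma> x * A x $ i $ j\<bar> \<le> M * B \<and> \<bar>\<gamma> x * b x $ i\<bar> \<le> M * B"
    using B m(2)
  proof eventually_elim
    case (elim x)
    have g: "\<bar>\<gamma> x\<bar> \<le> M" "0 \<le> M" using elim m(1) by auto
    have "\<bar>A x $ i $ j\<bar> \<le> B" "\<bar>b x $ i\<bar> \<le> B" for i j
      using component_le_norm_cart[of "A x $ i" j] Finite_Cartesian_Product.norm_nth_le[of "A x" i]
        component_le_norm_cart[of "b x" i] elim by auto
    then show ?case using g by (auto simp: abs_mult intro!: mult_mono)
  qed
  then show ?thesis by blast
qed

lemma T_L2: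
  assumes "\<phi> \<in> H2_space Q"
  shows "T \<phi> \<in> L2_space Q"
proof -
  obtain C where C: "AE x in lebesgue_on Q. \<forall>i j. \<bar>\<gamma> x * A x $ i $ j\<bar> \<le> C \<and> \<bar>\<gamma> x * b x $ i\<bar> \<le> C"
    using coeff_bounds by blast
  have "(\<lambda>x. (\<gamma> x * A x $ i $ j) * weak_partial Q i (weak_partial Q j \<phi>) x) \<in> L2_space Q" for i j
    using C by (intro L2_bounded_mult[of _ _ _ C] has_weak_partialD(2)[OF H2_spaceD(2)[OF assms]]
        borel_measurable_times renorm_measurable measurable_mat_component A_meas) auto
  moreover have "(\<lambda>x. (\<gamma> x * b x $ i) * weak_partial Q i \<phi> x) \<in> L2_space Q" for i
    using C by (intro L2_bounded_mult[of _ _ _ C] has_weak_partialD(2)[OF H2_spaceD(1)[OF assms]]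
        borel_measurable_times renorm_measurable measurable_vec_component b_meas) auto
  ultimately show ?thesis unfolding T_eq[abs_def] by (intro L2_diff L2_minus L2_sum)
qed

text \<open>With Hessian H and gradient G the error is pointwise the negative of (\<gamma>A - I) : H
  + \<gamma>b . G, so Cauchy-Schwarz brings in exactly the quantity that the Cordes condition bounds
  by 1 - \<delta>.\<close>

lemma near_sq:
  assumes \<phi>: "\<phi> \<in> H2_space Q"
  shows "AE x in lebesgue_on Q. (T \<phi> x + weak_laplacian Q \<phi> x)\<^sup>2
    \<le> (1 - \<delta>) * ((\<Sum>i\<in>UNIV. \<Sum>j\<in>UNIV. (weak_partial Q i (weak_partial Q j \<phi>) x)\<^sup>2)
      + \<kappa> * (\<Sum>i\<in>UNIV. (weak_partial Q i \<phi> x)\<^sup>2))"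
proof -
  obtain m M where m: "0 < m" "AE x in lebesgue_on Q. m \<le> \<gamma> x \<and> \<gamma> x \<le> M \<and> 0 < trace (A x)
      \<and> 0 < (norm (A x))\<^sup>2 + (norm (b x))\<^sup>2" using renorm_bounds by blast
  show ?thesis
    using m(2) cordes \<kappa>(3)
  proof eventually_elim
    case (elim x)
    define H where "H = weak_hessian Q \<phi> x"
    define G where "G = weak_grad Q \<phi> x"
    \<comment> \<open>If \<open>\<kappa>\<close> is not 1 the drift vanishes at x, so the gradient
      may be replaced by 0 before Cauchy-Schwarz, which keeps it out of the estimate.\<close>
    define G' where "G' = (if \<kappa> = 1 then G else 0)"
    define X where "X = \<gamma> x *\<^sub>R A x - mat 1"
    define Y where "Y = \<gamma> x *\<^sub>R b x"
    have YG: "Y \<bullet> G = Y \<bullet> G'" using elim by (auto simp: Y_def G'_def)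
    have "weak_laplacian Q \<phi> x = H \<bullet> mat 1"
      by (simp add: weak_laplacian_def H_def trace_eq_inner_mat1)
    then have "T \<phi> x + weak_laplacian Q \<phi> x = - (X \<bullet> H + Y \<bullet> G)"
      by (simp add: T_def L_op_def H_def G_def X_def Y_def inner_diff_left inner_commute[of _ "mat 1"] algebra_simps)
    then have "(T \<phi> x + weak_laplacian Q \<phi> x)\<^sup>2 = (X \<bullet> H + Y \<bullet> G')\<^sup>2"
      by (simp only: YG power2_minus)
    also have "\<dots> \<le> ((norm X)\<^sup>2 + (norm Y)\<^sup>2) * ((norm H)\<^sup>2 + (norm G')\<^sup>2)" by (rule inner_pair_bound)
    also have "\<dots> \<le> (1 - \<delta>) * ((norm H)\<^sup>2 + (norm G')\<^sup>2)"
      using cordes_distance[of "A x" "b x" \<delta>] elim \<delta>(1)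
      unfolding X_def Y_def renorm_def by (intro mult_right_mono) auto
    also have "\<dots> \<le> (1 - \<delta>) * ((norm H)\<^sup>2 + \<kappa> * (norm G)\<^sup>2)"
      using \<delta>(2) \<kappa>(1) by (intro mult_left_mono) (auto simp: G'_def)
    finally show ?case
      by (simp add: norm_mat_power2 norm_vec_power2 H_def G_def weak_hessian_def weak_grad_def)
  qed
qed

text \<open>The pointwise bound is integrated; the Hessian estimate contributes 1 and the gradient
  estimate \<kappa> / \<pi>^2 to the contraction factor.\<close>

lemma T_near:
  assumes \<phi>: "\<phi> \<in> H2_space Q \<inter> H10_space Q"
  shows "L2_norm Q (\<lambda>x. T \<phi> x + weak_laplacian Q \<phi> x)
    \<le> sqrt ((1 - \<delta>) * (1 + \<kappa> / pi\<^sup>2)) * L2_norm Q (weak_laplacian Q \<phi>)"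
proof -
  have \<phi>2: "\<phi> \<in> H2_space Q" using \<phi> by simp
  let ?M = "lebesgue_on (Q :: (real^'n) set)"
  let ?D = "L2_norm Q (weak_laplacian Q \<phi>)"
  let ?h = "\<lambda>i j. weak_partial Q i (weak_partial Q j \<phi>)" and ?g = "\<lambda>i. weak_partial Q i \<phi>"
  have hi: "integrable ?M (\<lambda>x. (?h i j x)\<^sup>2)" and gi: "integrable ?M (\<lambda>x. (?g i x)\<^sup>2)" for i j
    using has_weak_partialD(2)[OF H2_spaceD(2)[OF \<phi>2]] has_weak_partialD(2)[OF H2_spaceD(1)[OF \<phi>2]]
    by (auto dest: L2_spaceD)
  have TL: "(\<lambda>x. T \<phi> x + weak_laplacian Q \<phi> x) \<in> L2_space Q"
    by (intro L2_add T_L2 weak_laplacian_L2 \<phi>2)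
  have "(L2_norm Q (\<lambda>x. T \<phi> x + weak_laplacian Q \<phi> x))\<^sup>2
      = (LINT x|?M. (T \<phi> x + weak_laplacian Q \<phi> x)\<^sup>2)"
    by (simp add: L2_norm_power2 L2_inner_power2)
  also have "\<dots> \<le> (LINT x|?M. (1 - \<delta>) * ((\<Sum>i\<in>UNIV. \<Sum>j\<in>UNIV. (?h i j x)\<^sup>2) + \<kappa> * (\<Sum>i\<in>UNIV. (?g i x)\<^sup>2)))"
    by (rule integral_mono_AE[OF L2_spaceD(2)[OF TL] _ near_sq[OF \<phi>2]])
      (intro integrable_mult_right Bochner_Integration.integrable_add Bochner_Integration.integrable_sum hi gi)
  also have "\<dots> = (1 - \<delta>) * ((\<Sum>i\<in>UNIV. \<Sum>j\<in>UNIV. (L2_norm Q (?h i j))\<^sup>2) + \<kappa> * (\<Sum>i\<in>UNIV. (L2_norm Q (?g i))\<^sup>2))"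
    using hi gi by (simp add: L2_norm_power2 L2_inner_power2)
  also have "\<dots> \<le> (1 - \<delta>) * (?D\<^sup>2 + \<kappa> * (?D\<^sup>2 / pi\<^sup>2))"
    using H2_estimates(2,3)[OF \<phi>] \<delta>(2) \<kappa>(1) by (intro mult_left_mono add_mono) auto
  also have "\<dots> = (1 - \<delta>) * (1 + \<kappa> / pi\<^sup>2) * ?D\<^sup>2" by (simp add: algebra_simps)
  also have "\<dots> = (sqrt ((1 - \<delta>) * (1 + \<kappa> / pi\<^sup>2)) * ?D)\<^sup>2"
  proof -
    have "0 \<le> (1 - \<delta>) * (1 + \<kappa> / pi\<^sup>2)" using \<delta>(2) \<kappa>(1) by simp
    then show ?thesis by (simp only: power_mult_distrib real_sqrt_pow2)
  qed
  finally show ?thesis by (rule power2_le_imp_le) (use \<delta>(2) \<kappa>(1) in simp)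
qed

sublocale near_laplacian T "sqrt ((1 - \<delta>) * (1 + \<kappa> / pi\<^sup>2))"
proof
  fix \<phi> \<psi> :: "real^'n \<Rightarrow> real" and a c :: real
  assume \<phi>: "\<phi> \<in> H2_space Q \<inter> H10_space Q"
  then have \<phi>2: "\<phi> \<in> H2_space Q" by simp
  show "T \<phi> \<in> L2_space Q" by (rule T_L2[OF \<phi>2])
  show "L2_norm Q (\<lambda>x. T \<phi> x + weak_laplacian Q \<phi> x)
      \<le> sqrt ((1 - \<delta>) * (1 + \<kappa> / pi\<^sup>2)) * L2_norm Q (weak_laplacian Q \<phi>)"
    by (rule T_near[OF \<phi>])
  assume "\<psi> \<in> H2_space Q \<inter> H10_space Q"
  then have \<psi>2: "\<psi> \<in> H2_space Q" by simp
  have "AE x in lebesgue_on Q. \<forall>i j.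
      weak_partial Q i (\<lambda>x. a * \<phi> x + c * \<psi> x) x = a * weak_partial Q i \<phi> x + c * weak_partial Q i \<psi> x
      \<and> weak_partial Q i (weak_partial Q j (\<lambda>x. a * \<phi> x + c * \<psi> x)) x
        = a * weak_partial Q i (weak_partial Q j \<phi>) x + c * weak_partial Q i (weak_partial Q j \<psi>) x"
    using H2_lincomb(2,3)[OF \<phi>2 \<psi>2] by (simp add: AE_all_countable)
  then show "AE x in lebesgue_on Q. T (\<lambda>x. a * \<phi> x + c * \<psi> x) x = a * T \<phi> x + c * T \<psi> x"
    by eventually_elim
      (simp add: T_def L_op_def inner_vec_def weak_hessian_def weak_grad_def sum_distrib_left sum.distrib algebra_simps)
  assume eq: "AE x in lebesgue_on Q. \<phi> x = \<psi> x"
  have "AE x in lebesgue_on Q. \<forall>i j. weak_partial Q i \<psi> x = weak_partial Q i \<phi> x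
      \<and> weak_partial Q i (weak_partial Q j \<psi>) x = weak_partial Q i (weak_partial Q j \<phi>) x"
    using H2_cong_AE[OF \<phi>2 H2_L2[OF \<psi>2] eq] by (simp add: AE_all_countable)
  then show "AE x in lebesgue_on Q. T \<phi> x = T \<psi> x"
    by eventually_elim (simp add: T_eq)
qed (use \<delta> \<kappa> in \<open>auto intro: real_sqrt_lt_1_iff[THEN iffD2]\<close>)

section \<open>Passing between the original, the renormalised and the potential problem\<close>

context
  fixes f :: "real^'n \<Rightarrow> real"
  assumes f: "f \<in> L2_space Q"
begin

lemma renorm_solution_iff:
  "very_weak_solution_renorm Q A b f u \<longleftrightarrow>
    u \<in> L2_space Q \<and> (\<forall>\<phi>\<in>V. L2_inner Q u (T \<phi>) = L2_inner Q f \<phi>)"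
  by (simp add: very_weak_solution_renorm_def T_def[abs_def])

lemma renorm_solution_unique:
  assumes "very_weak_solution_renorm Q A b f u" "very_weak_solution_renorm Q A b f v"
  shows "v \<doteq> u"
proof -
  have "(\<lambda>x. v x - u x) \<doteq> (\<lambda>x. 0)"
  proof (rule unique)
    show "L2_inner Q (\<lambda>x. v x - u x) (T \<phi>) = 0" if "\<phi> \<in> V" for \<phi>
      using assms that T_L2[of \<phi>] by (simp add: renorm_solution_iff L2_inner_diff_left)
  qed (use assms in \<open>auto simp: renorm_solution_iff\<close>)
  then show ?thesis by simp
qed

lemma renorm_solution_cong:
  assumes u: "very_weak_solution_renorm Q A b f u" and v: "v \<in> L2_space Q" "u \<doteq> v"
  shows "very_weak_solution_renorm Q A b f v"
  unfolding renorm_solution_iff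
proof (intro conjI ballI v)
  fix \<phi> assume "\<phi> \<in> V"
  then show "L2_inner Q v (T \<phi>) = L2_inner Q f \<phi>"
    using u L2_inner_cong_AE_left[OF v(2) _ v(1) T_L2[of \<phi>]] by (auto simp: renorm_solution_iff)
qed

text \<open>The potential problem is the renormalised one for functions of the form -\<Delta>\<psi>;
  since the Laplacian is onto, this form is no restriction.\<close>

lemma potential_solution_iff:
  "potential_solution Q A b f \<psi> \<longleftrightarrow>
    \<psi> \<in> V \<and> very_weak_solution_renorm Q A b f (\<lambda>x. - weak_laplacian Q \<psi> x)"
  by (auto simp: potential_solution_def very_weak_solution_renorm_def intro: weak_laplacian_L2)

lemma renorm_times_solution:
  assumes "very_weak_solution_renorm Q A b f u"
  shows "very_weak_solution Q A b f (\<lambda>x. \<gamma> x * u x)"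
proof -
  obtain m M where m: "0 < m" "AE x in lebesgue_on Q. m \<le> \<gamma> x \<and> \<gamma> x \<le> M \<and> 0 < trace (A x)
      \<and> 0 < (norm (A x))\<^sup>2 + (norm (b x))\<^sup>2" using renorm_bounds by blast
  have "(\<lambda>x. \<gamma> x * u x) \<in> L2_space Q"
  proof (rule L2_bounded_mult[OF _ renorm_measurable])
    show "AE x in lebesgue_on Q. \<bar>\<gamma> x\<bar> \<le> M" using m(2) by eventually_elim (use m(1) in auto)
  qed (use assms in \<open>simp add: renorm_solution_iff\<close>)
  then show ?thesis using assms
    by (simp add: very_weak_solution_def very_weak_solution_renorm_def L2_inner_def mult_ac)
qed

text \<open>\<gamma> moves from one factor of the inner product to the other. Division is legitimate
  because \<gamma> is bounded away from 0 outside a null set, which also keeps the quotient square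
  integrable.\<close>

lemma solution_div_renorm:
  assumes u: "very_weak_solution Q A b f u"
  shows "very_weak_solution_renorm Q A b f (\<lambda>x. inverse (\<gamma> x) * u x)"
    and "u \<doteq> (\<lambda>x. \<gamma> x * (inverse (\<gamma> x) * u x))"
proof -
  obtain m M where m: "0 < m" "AE x in lebesgue_on Q. m \<le> \<gamma> x \<and> \<gamma> x \<le> M \<and> 0 < trace (A x)
      \<and> 0 < (norm (A x))\<^sup>2 + (norm (b x))\<^sup>2" using renorm_bounds by blast
  have uL: "u \<in> L2_space Q" using u by (simp add: very_weak_solution_def)
  have vL: "(\<lambda>x. inverse (\<gamma> x) * u x) \<in> L2_space Q"
  proof (rule L2_bounded_mult[OF uL])
    show "(\<lambda>x. inverse (\<gamma> x)) \<in> borel_measurable (lebesgue_on Q)"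
      using renorm_measurable by measurable
    show "AE x in lebesgue_on Q. \<bar>inverse (\<gamma> x)\<bar> \<le> inverse m"
      using m(2) by eventually_elim (use m(1) in \<open>auto intro: le_imp_inverse_le\<close>)
  qed
  have pos: "AE x in lebesgue_on Q. \<gamma> x > 0" using m(2) by eventually_elim (use m(1) in auto)
  then show "u \<doteq> (\<lambda>x. \<gamma> x * (inverse (\<gamma> x) * u x))" by eventually_elim simp
  have "L2_inner Q (\<lambda>x. inverse (\<gamma> x) * u x) (T \<phi>) = L2_inner Q u (L_op Q A b \<phi>)"
    if "\<phi> \<in> V" for \<phi>
    unfolding L2_inner_def
  proof (rule integral_cong_AE)
    have [measurable]: "T \<phi> \<in> borel_measurable (lebesgue_on Q)"
      using that T_L2[of \<phi>] by (auto dest: L2_spaceD)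
    note [measurable] = renorm_measurable L2_spaceD(1)[OF uL] L2_spaceD(1)[OF vL]
    show "(\<lambda>x. inverse (\<gamma> x) * u x * T \<phi> x) \<in> borel_measurable (lebesgue_on Q)" by measurable
    have "\<phi> \<in> H2_space Q" using that by simp
    note L2_spaceD(1)[OF has_weak_partialD(2)[OF H2_spaceD(1)[OF this]]]
      L2_spaceD(1)[OF has_weak_partialD(2)[OF H2_spaceD(2)[OF this]]]
    note [measurable] = this measurable_mat_component[OF A_meas] measurable_vec_component[OF b_meas]
    show "(\<lambda>x. u x * L_op Q A b \<phi> x) \<in> borel_measurable (lebesgue_on Q)"
      unfolding L_op_def inner_vec_def weak_hessian_def weak_grad_def by (simp, measurable)
    show "AE x in lebesgue_on Q. inverse (\<gamma> x) * u x * T \<phi> x = u x * L_op Q A b \<phi> x"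
      using pos by eventually_elim (simp add: T_def field_simps)
  qed
  then show "very_weak_solution_renorm Q A b f (\<lambda>x. inverse (\<gamma> x) * u x)"
    using u vL by (simp add: renorm_solution_iff very_weak_solution_def)
qed

text \<open>All three problems are reduced to the renormalised solution \<open>ut\<close>:
  multiplication by \<gamma> yields the original solution, inversion of the Laplacian at
  \<open>- ut\<close> yields \<psi>, and uniqueness is carried back along the same maps.\<close>

lemma well_posed:
  "ex1_ae Q (very_weak_solution Q A b f)
    \<and> ex1_ae Q (very_weak_solution_renorm Q A b f)
    \<and> ex1_ae Q (potential_solution Q A b f)"
proof -
  obtain ut where ut: "very_weak_solution_renorm Q A b f ut"
    using existence[OF f] by (auto simp: renorm_solution_iff)
  have utL: "ut \<in> L2_space Q" using ut by (simp add: renorm_solution_iff)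
  obtain \<psi> where \<psi>: "\<psi> \<in> V" and lap: "AE x in lebesgue_on Q. weak_laplacian Q \<psi> x = - ut x"
    using poisson_solvable[OF utL] by metis
  have "ex1_ae Q (very_weak_solution_renorm Q A b f)"
    unfolding ex1_ae_def using ut renorm_solution_unique by blast
  moreover have "ex1_ae Q (very_weak_solution Q A b f)"
    unfolding ex1_ae_def
  proof (intro exI conjI allI impI)
    show "very_weak_solution Q A b f (\<lambda>x. \<gamma> x * ut x)" by (rule renorm_times_solution[OF ut])
    fix v assume v: "very_weak_solution Q A b f v"
    show "v \<doteq> (\<lambda>x. \<gamma> x * ut x)"
      using renorm_solution_unique[OF ut solution_div_renorm(1)[OF v]] solution_div_renorm(2)[OF v]
      by eventually_elim simp
  qed
  moreover have "ex1_ae Q (potential_solution Q A b f)"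
    unfolding ex1_ae_def
  proof (intro exI conjI allI impI)
    have "(\<lambda>x. - weak_laplacian Q \<psi> x) \<in> L2_space Q"
      using \<psi> by (intro L2_minus weak_laplacian_L2) auto
    moreover have "ut \<doteq> (\<lambda>x. - weak_laplacian Q \<psi> x)" using lap by eventually_elim simp
    ultimately have sol: "very_weak_solution_renorm Q A b f (\<lambda>x. - weak_laplacian Q \<psi> x)"
      by (rule renorm_solution_cong[OF ut])
    then show "potential_solution Q A b f \<psi>" using \<psi> by (simp add: potential_solution_iff)
    fix v assume "potential_solution Q A b f v"
    then have v: "v \<in> V" "very_weak_solution_renorm Q A b f (\<lambda>x. - weak_laplacian Q v x)"
      by (auto simp: potential_solution_iff)
    show "v \<doteq> \<psi>"
      using renorm_solution_unique[OF sol v(2)] by (intro weak_laplacian_determines[OF v(1) \<psi>]) simp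
  qed
  ultimately show ?thesis by blast
qed

text \<open>Both \<open>inverse (\<gamma> x) * u x\<close> and -\<Delta>\<psi> solve the
  renormalised problem, so by uniqueness both agree with \<open>ut\<close>.\<close>

lemma solution_formula:
  assumes u: "very_weak_solution Q A b f u" and ut: "very_weak_solution_renorm Q A b f ut"
    and \<psi>: "potential_solution Q A b f \<psi>"
  shows "AE x in lebesgue_on Q. u x = \<gamma> x * ut x
    \<and> u x = trace (A x) / ((norm (A x))\<^sup>2 + (norm (b x))\<^sup>2) * (- weak_laplacian Q \<psi> x)"
proof -
  have "very_weak_solution_renorm Q A b f (\<lambda>x. - weak_laplacian Q \<psi> x)"
    using \<psi> by (simp add: potential_solution_iff)
  from renorm_solution_unique[OF ut this] renorm_solution_unique[OF ut solution_div_renorm(1)[OF u]]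
    solution_div_renorm(2)[OF u]
  show ?thesis
    by eventually_elim (simp add: renorm_def)
qed

end

end

theorem theorem5p2:
  fixes A :: "(real^'n) \<Rightarrow> real^'n^'n"
    and b :: "(real^'n) \<Rightarrow> real^'n"
    and f :: "(real^'n) \<Rightarrow> real"
    and \<delta> :: real
  assumes "A \<in> Linf_space unit_cube"
    and "AE x in lebesgue_on unit_cube. transpose (A x) = A x"
    and "uniformly_elliptic unit_cube A"
    and "b \<in> Linf_space unit_cube"
    and "f \<in> L2_space unit_cube"
    and "delta0 unit_cube b < \<delta>" and "\<delta> \<le> 1"
    and "AE x in lebesgue_on unit_cube.
           ((norm (A x))\<^sup>2 + (norm (b x))\<^sup>2) / (trace (A x))\<^sup>2 \<le> 1 / (real CARD('n) - 1 + \<delta>)"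
  shows "ex1_ae unit_cube (very_weak_solution unit_cube A b f)
    \<and> ex1_ae unit_cube (very_weak_solution_renorm unit_cube A b f)
    \<and> ex1_ae unit_cube (potential_solution unit_cube A b f)
    \<and> (\<forall>u ut \<psi>. very_weak_solution unit_cube A b f u
          \<and> very_weak_solution_renorm unit_cube A b f ut
          \<and> potential_solution unit_cube A b f \<psi>
        \<longrightarrow> (AE x in lebesgue_on unit_cube.
               u x = renorm A b x * ut x
               \<and> u x = trace (A x) / ((norm (A x))\<^sup>2 + (norm (b x))\<^sup>2) * (- weak_laplacian unit_cube \<psi> x)))"
proof -
  \<comment> \<open>A nonzero drift brings the gradient into the estimate; this is the case
    distinction made in \<open>delta0\<close>.\<close>
  define \<kappa> :: real where "\<kappa> = (if Linf_norm Q b \<noteq> 0 then 1 else 0)"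
  have \<delta>0: "0 < \<delta>"
  proof -
    have "0 < 1 + pi\<^sup>2" by (simp add: add_pos_nonneg)
    then have "0 \<le> delta0 Q b" by (simp add: delta0_def)
    then show ?thesis using assms(6) by linarith
  qed
  interpret cordes A b \<delta> \<kappa>
  proof
    show "A \<in> borel_measurable (lebesgue_on Q)" "b \<in> borel_measurable (lebesgue_on Q)"
      using assms by (auto simp: Linf_space_def)
    obtain B1 B2 where B: "AE x in lebesgue_on Q. norm (A x) \<le> B1" "AE x in lebesgue_on Q. norm (b x) \<le> B2"
      using Linf_space_bound[OF assms(1)] Linf_space_bound[OF assms(4)] by metis
    have "AE x in lebesgue_on Q. norm (A x) \<le> max B1 B2 \<and> norm (b x) \<le> max B1 B2"
      using B by eventually_elim auto
    then show "\<exists>B. AE x in lebesgue_on Q. norm (A x) \<le> B \<and> norm (b x) \<le> B" by blast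
    obtain l u where l: "0 < l" "AE x in lebesgue_on Q. qf_le (l *\<^sub>R mat 1) (A x) \<and> qf_le (A x) (u *\<^sub>R mat 1)"
      using assms(3) by (auto simp: uniformly_elliptic_def)
    have "AE x in lebesgue_on Q. real CARD('n) * l \<le> trace (A x)"
      using l(2) by eventually_elim (simp add: trace_lower_bound)
    moreover have "0 < real CARD('n) * l" using l(1) by simp
    ultimately show "\<exists>l>0. AE x in lebesgue_on Q. l \<le> trace (A x)" by blast
    show "0 \<le> \<kappa>" by (simp add: \<kappa>_def)
    show "(1 - \<delta>) * (1 + \<kappa> / pi\<^sup>2) < 1"
    proof (cases "Linf_norm Q b = 0")
      case True
      then show ?thesis using \<delta>0 by (simp add: \<kappa>_def)
    next
      case False
      have p: "0 < pi\<^sup>2" by simp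
      have "inverse (1 + pi\<^sup>2) < \<delta>" using assms(6) False by (simp add: delta0_def)
      \<comment> \<open>The factor decreases strictly in \<delta> and equals 1 exactly at the
        threshold \<open>inverse (1 + pi\<^sup>2)\<close>.\<close>
      then have "(1 - \<delta>) * (1 + 1 / pi\<^sup>2) < (1 - inverse (1 + pi\<^sup>2)) * (1 + 1 / pi\<^sup>2)"
        using p by (intro mult_strict_right_mono) (auto intro: add_pos_pos)
      also have "\<dots> = 1"
      proof -
        have "(1 - inverse (1 + P)) * (1 + 1 / P) = 1" if "0 < P" for P :: real
        proof -
          have "0 < P + P * P" using that by (intro add_pos_pos mult_pos_pos)
          then have "P + P * P \<noteq> 0" by (metis less_irrefl)
          then show ?thesis using that by (simp add: field_simps)
        qed
        from this[OF p] show ?thesis .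
      qed
      finally show ?thesis using False by (simp add: \<kappa>_def)
    qed
    show "AE x in lebesgue_on Q. b x = 0 \<or> \<kappa> = 1"
    proof (cases "Linf_norm Q b = 0")
      case True
      have "AE x in lebesgue_on Q. ereal (norm (b x)) \<le> Linf_norm Q b"
        unfolding Linf_norm_def by (rule esssup_AE)
      then show ?thesis unfolding True by eventually_elim simp
    qed (simp add: \<kappa>_def)
  qed (use assms \<delta>0 in auto)
  show ?thesis
    using well_posed[OF assms(5)] solution_formula[OF assms(5)] by blast
qed

end
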